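(* Let $X\subset \mathbb P^{a_1}\times\mathbb P^{a_2}$ be a finite set of points with the $(\star)$-property: for any $(P_1,Q_1),(P_2,Q_2)\in X$, at least one of $(P_1,Q_2)$, $(P_2,Q_1)$ also belongs to $X$. Then $X$ is arithmetically Cohen-Macaulay.
   Context: We work over a field $k$ of characteristic zero. Let $R=k[x_0,\dots,x_{a_1},y_0,\dots,y_{a_2}]$ be the bigraded coordinate ring of $\mathbb P^{a_1}\times\mathbb P^{a_2}$, with $\deg x_i=(1,0)$ and $\deg y_j=(0,1)$. For a finite set of points $X\subset\mathbb P^{a_1}\times\mathbb P^{a_2}$ (with its reduced structure), $I_X\subset R$ is the ideal generated by all bihomogeneous polynomials vanishing at every point of $X$. $X$ is arithmetically Cohen-Macaulay (ACM) if $R/I_X$ is a Cohen-Macaulay ring. *)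

theory Defs
  imports "HOL-Algebra.Algebraic_Closure_Type" "HOL-Library.Poly_Mapping" "HOL-Library.Extended_Nat"
begin

section \<open>Cohen--Macaulay rings\<close>

text \<open>
  The localization of a commutative ring at a prime ideal \<open>P\<close>: fractions \<open>a / s\<close> with
  \<open>s \<notin> P\<close>, where \<open>a / s = b / t\<close> iff \<open>u (a t - b s) = 0\<close> for some \<open>u \<notin> P\<close>.
\<close>

definition frac_rel :: "('a, 'b) ring_scheme \<Rightarrow> 'a set \<Rightarrow> (('a \<times> 'a) \<times> ('a \<times> 'a)) set" where
  "frac_rel R P =
     {((a, s), (b, t)). a \<in> carrier R \<and> b \<in> carrier R \<and> s \<in> carrier R - P \<and> t \<in> carrier R - P \<and>
        (\<exists>u \<in> carrier R - P. u \<otimes>\<^bsub>R\<^esub> (a \<otimes>\<^bsub>R\<^esub> t \<ominus>\<^bsub>R\<^esub> b \<otimes>\<^bsub>R\<^esub> s) = \<zero>\<^bsub>R\<^esub>)}"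

definition loc_frac :: "('a, 'b) ring_scheme \<Rightarrow> 'a set \<Rightarrow> 'a \<Rightarrow> 'a \<Rightarrow> ('a \<times> 'a) set" where
  "loc_frac R P a s = frac_rel R P `` {(a, s)}"

definition localization :: "('a, 'b) ring_scheme \<Rightarrow> 'a set \<Rightarrow> (('a \<times> 'a) set) ring" where
  "localization R P =
     \<lparr>carrier = (carrier R \<times> (carrier R - P)) // frac_rel R P,
      monoid.mult = (\<lambda>x y. \<Union>(a, s) \<in> x. \<Union>(b, t) \<in> y. loc_frac R P (a \<otimes>\<^bsub>R\<^esub> b) (s \<otimes>\<^bsub>R\<^esub> t)),
      one = loc_frac R P \<one>\<^bsub>R\<^esub> \<one>\<^bsub>R\<^esub>,
      ring.zero = loc_frac R P \<zero>\<^bsub>R\<^esub> \<one>\<^bsub>R\<^esub>,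
      add = (\<lambda>x y. \<Union>(a, s) \<in> x. \<Union>(b, t) \<in> y.
               loc_frac R P (a \<otimes>\<^bsub>R\<^esub> t \<oplus>\<^bsub>R\<^esub> b \<otimes>\<^bsub>R\<^esub> s) (s \<otimes>\<^bsub>R\<^esub> t))\<rparr>"

text \<open>The operations on fractions are well defined and make the localization a commutative ring.\<close>

context
  fixes R :: "('a, 'b) ring_scheme" (structure) and P
  assumes prime: "primeideal P R"
begin

interpretation primeideal P R by (rule prime)

private abbreviation "S \<equiv> carrier R - P"

private lemma S_one: "\<one> \<in> S"
  using I_notcarr one_imp_carrier by auto

private lemma S_mult: "s \<in> S \<Longrightarrow> t \<in> S \<Longrightarrow> s \<otimes> t \<in> S"
  using I_prime by blast

private lemma frac_rel_iff:
  "((a, s), (b, t)) \<in> frac_rel R P \<longleftrightarrow> a \<in> carrier R \<and> b \<in> carrier R \<and> s \<in> S \<and> t \<in> S \<and>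
     (\<exists>u \<in> S. u \<otimes> (a \<otimes> t) = u \<otimes> (b \<otimes> s))"
proof -
  have "u \<otimes> (a \<otimes> t \<ominus> b \<otimes> s) = \<zero> \<longleftrightarrow> u \<otimes> (a \<otimes> t) = u \<otimes> (b \<otimes> s)"
    if "a \<in> carrier R" "b \<in> carrier R" "s \<in> S" "t \<in> S" "u \<in> S" for u
    using that by (simp add: minus_eq r_distr r_minus r_right_minus_eq[unfolded minus_eq])
  then show ?thesis by (auto simp: frac_rel_def)
qed

lemma equiv_frac_rel: "equiv (carrier R \<times> S) (frac_rel R P)"
proof (rule equivI)
  show "frac_rel R P \<subseteq> (carrier R \<times> S) \<times> (carrier R \<times> S)"
    by (auto simp: frac_rel_def)
  show "refl_on (carrier R \<times> S) (frac_rel R P)"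
    using S_one by (auto simp: refl_on_def frac_rel_iff)
  show "sym (frac_rel R P)"
    by (rule symI) (force simp: frac_rel_iff)
  show "trans (frac_rel R P)"
  proof (rule transI, clarify)
    fix a s b t c v
    assume 1: "((a, s), (b, t)) \<in> frac_rel R P" and 2: "((b, t), (c, v)) \<in> frac_rel R P"
    from 1 obtain u where u: "u \<in> S" "u \<otimes> (a \<otimes> t) = u \<otimes> (b \<otimes> s)" by (auto simp: frac_rel_iff)
    from 2 obtain w where w: "w \<in> S" "w \<otimes> (b \<otimes> v) = w \<otimes> (c \<otimes> t)" by (auto simp: frac_rel_iff)
    have c: "a \<in> carrier R" "b \<in> carrier R" "c \<in> carrier R" "s \<in> S" "t \<in> S" "v \<in> S"
      using 1 2 by (auto simp: frac_rel_iff)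
    have c': "s \<in> carrier R" "t \<in> carrier R" "v \<in> carrier R" "u \<in> carrier R" "w \<in> carrier R"
      using c u w by auto
    have "(u \<otimes> w \<otimes> t) \<otimes> (a \<otimes> v) = (w \<otimes> v) \<otimes> (u \<otimes> (a \<otimes> t))" using c c' by (simp add: m_ac)
    also have "\<dots> = (u \<otimes> s) \<otimes> (w \<otimes> (b \<otimes> v))" using c c' unfolding u(2) by (simp add: m_ac)
    also have "\<dots> = (u \<otimes> w \<otimes> t) \<otimes> (c \<otimes> s)" using c c' unfolding w(2) by (simp add: m_ac)
    finally show "((a, s), (c, v)) \<in> frac_rel R P"
      using c S_mult[OF S_mult[OF u(1) w(1)] c(5)] unfolding frac_rel_iff by blast
  qed
qed

private lemma mult_congr:
  assumes "((a, s), (a', s')) \<in> frac_rel R P" "b \<in> carrier R" "t \<in> S"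
  shows "((a \<otimes> b, s \<otimes> t), (a' \<otimes> b, s' \<otimes> t)) \<in> frac_rel R P"
proof -
  from assms(1) obtain u where u: "u \<in> S" "u \<otimes> (a \<otimes> s') = u \<otimes> (a' \<otimes> s)" by (auto simp: frac_rel_iff)
  have c: "a \<in> carrier R" "a' \<in> carrier R" "s \<in> S" "s' \<in> S" using assms by (auto simp: frac_rel_iff)
  have c': "s \<in> carrier R" "s' \<in> carrier R" "t \<in> carrier R" "u \<in> carrier R" using c u assms by auto
  have "u \<otimes> (a \<otimes> b \<otimes> (s' \<otimes> t)) = (b \<otimes> t) \<otimes> (u \<otimes> (a \<otimes> s'))" using c c' assms by (simp add: m_ac)
  also have "\<dots> = u \<otimes> (a' \<otimes> b \<otimes> (s \<otimes> t))" using c c' assms unfolding u(2) by (simp add: m_ac)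
  finally show ?thesis using c assms u(1) S_mult unfolding frac_rel_iff by blast
qed

private lemma add_congr:
  assumes "((a, s), (a', s')) \<in> frac_rel R P" "b \<in> carrier R" "t \<in> S"
  shows "((a \<otimes> t \<oplus> b \<otimes> s, s \<otimes> t), (a' \<otimes> t \<oplus> b \<otimes> s', s' \<otimes> t)) \<in> frac_rel R P"
proof -
  from assms(1) obtain u where u: "u \<in> S" "u \<otimes> (a \<otimes> s') = u \<otimes> (a' \<otimes> s)" by (auto simp: frac_rel_iff)
  have c: "a \<in> carrier R" "a' \<in> carrier R" "s \<in> S" "s' \<in> S" using assms by (auto simp: frac_rel_iff)
  have c': "s \<in> carrier R" "s' \<in> carrier R" "t \<in> carrier R" "u \<in> carrier R" using c u assms by auto
  have "u \<otimes> ((a \<otimes> t \<oplus> b \<otimes> s) \<otimes> (s' \<otimes> t)) =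
      (t \<otimes> t) \<otimes> (u \<otimes> (a \<otimes> s')) \<oplus> u \<otimes> (b \<otimes> s \<otimes> (s' \<otimes> t))"
    using c c' assms by (simp add: m_ac l_distr r_distr)
  also have "\<dots> = u \<otimes> ((a' \<otimes> t \<oplus> b \<otimes> s') \<otimes> (s \<otimes> t))"
    using c c' assms unfolding u(2) by (simp add: m_ac l_distr r_distr)
  finally show ?thesis using c c' assms u(1) S_mult unfolding frac_rel_iff by blast
qed

lemma loc_frac_eq_iff:
  assumes "a \<in> carrier R" "b \<in> carrier R" "s \<in> S" "t \<in> S"
  shows "loc_frac R P a s = loc_frac R P b t \<longleftrightarrow> (\<exists>u \<in> S. u \<otimes> (a \<otimes> t) = u \<otimes> (b \<otimes> s))"
  using assms eq_equiv_class_iff[OF equiv_frac_rel, of "(a, s)" "(b, t)"]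
  by (simp add: loc_frac_def frac_rel_iff)

lemma carrier_localization:
  "carrier (localization R P) = {loc_frac R P a s |a s. a \<in> carrier R \<and> s \<in> S}"
  by (auto simp: localization_def quotient_def loc_frac_def)

lemma mult_localization:
  assumes "a \<in> carrier R" "b \<in> carrier R" "s \<in> S" "t \<in> S"
  shows "loc_frac R P a s \<otimes>\<^bsub>localization R P\<^esub> loc_frac R P b t = loc_frac R P (a \<otimes> b) (s \<otimes> t)"
proof -
  let ?f = "\<lambda>x y. loc_frac R P (fst x \<otimes> fst y) (snd x \<otimes> snd y)"
  have comm: "?f y z = ?f z y" if "y \<in> carrier R \<times> S" "z \<in> carrier R \<times> S" for y z
    using that by (auto simp: m_comm)
  have "congruent2 (frac_rel R P) (frac_rel R P) ?f"
  proof (rule congruent2_commuteI[OF equiv_frac_rel])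
    fix y z assume "y \<in> carrier R \<times> S" "z \<in> carrier R \<times> S"
    then show "?f y z = ?f z y" by (rule comm)
  next
    fix y z w assume w: "w \<in> carrier R \<times> S" and yz: "(y, z) \<in> frac_rel R P"
    then have mem: "y \<in> carrier R \<times> S" "z \<in> carrier R \<times> S" by (auto simp: frac_rel_def)
    have "?f y w = ?f z w"
      unfolding loc_frac_def
      by (rule equiv_class_eq[OF equiv_frac_rel], rule mult_congr) (use w yz in auto)
    then show "?f w y = ?f w z" using comm[OF w mem(1)] comm[OF w mem(2)] by simp
  qed
  from UN_equiv_class2[OF equiv_frac_rel equiv_frac_rel this, of "(a, s)" "(b, t)"] assms
  show ?thesis by (simp add: localization_def loc_frac_def case_prod_unfold)
qed

lemma add_localization:
  assumes "a \<in> carrier R" "b \<in> carrier R" "s \<in> S" "t \<in> S"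
  shows "loc_frac R P a s \<oplus>\<^bsub>localization R P\<^esub> loc_frac R P b t =
    loc_frac R P (a \<otimes> t \<oplus> b \<otimes> s) (s \<otimes> t)"
proof -
  let ?f = "\<lambda>x y. loc_frac R P (fst x \<otimes> snd y \<oplus> fst y \<otimes> snd x) (snd x \<otimes> snd y)"
  have comm: "?f y z = ?f z y" if "y \<in> carrier R \<times> S" "z \<in> carrier R \<times> S" for y z
    using that by (auto simp: m_comm a_comm)
  have "congruent2 (frac_rel R P) (frac_rel R P) ?f"
  proof (rule congruent2_commuteI[OF equiv_frac_rel])
    fix y z assume "y \<in> carrier R \<times> S" "z \<in> carrier R \<times> S"
    then show "?f y z = ?f z y" by (rule comm)
  next
    fix y z w assume w: "w \<in> carrier R \<times> S" and yz: "(y, z) \<in> frac_rel R P"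
    then have mem: "y \<in> carrier R \<times> S" "z \<in> carrier R \<times> S" by (auto simp: frac_rel_def)
    have "?f y w = ?f z w"
      unfolding loc_frac_def
      by (rule equiv_class_eq[OF equiv_frac_rel], rule add_congr) (use w yz in auto)
    then show "?f w y = ?f w z" using comm[OF w mem(1)] comm[OF w mem(2)] by simp
  qed
  from UN_equiv_class2[OF equiv_frac_rel equiv_frac_rel this, of "(a, s)" "(b, t)"] assms
  show ?thesis by (simp add: localization_def loc_frac_def case_prod_unfold)
qed

lemma one_localization: "\<one>\<^bsub>localization R P\<^esub> = loc_frac R P \<one> \<one>"
  and zero_localization: "\<zero>\<^bsub>localization R P\<^esub> = loc_frac R P \<zero> \<one>"
  by (simp_all add: localization_def)

lemma cring_localization: "cring (localization R P)"
proof (rule cringI)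
  note [simp] = mult_localization add_localization one_localization zero_localization
    S_mult[simplified] S_one[simplified]
  have eqI: "loc_frac R P a s = loc_frac R P b t"
    if "a \<in> carrier R" "b \<in> carrier R" "s \<in> S" "t \<in> S" "a \<otimes> t = b \<otimes> s" for a b s t
    using that S_one by (subst loc_frac_eq_iff) auto
  show "abelian_group (localization R P)"
  proof (rule abelian_groupI)
    fix x y z
    assume "x \<in> carrier (localization R P)" "y \<in> carrier (localization R P)" "z \<in> carrier (localization R P)"
    then show "x \<oplus>\<^bsub>localization R P\<^esub> y \<oplus>\<^bsub>localization R P\<^esub> z =
        x \<oplus>\<^bsub>localization R P\<^esub> (y \<oplus>\<^bsub>localization R P\<^esub> z)"
      by (auto simp: carrier_localization l_distr r_distr m_ac a_ac intro!: eqI)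
  next
    fix x assume "x \<in> carrier (localization R P)"
    then obtain a s where x: "x = loc_frac R P a s" "a \<in> carrier R" "s \<in> S"
      by (auto simp: carrier_localization)
    have "loc_frac R P (\<ominus> a) s \<oplus>\<^bsub>localization R P\<^esub> x = \<zero>\<^bsub>localization R P\<^esub>"
      using x by (simp add: l_minus l_neg) (rule eqI; simp)
    then show "\<exists>y \<in> carrier (localization R P). y \<oplus>\<^bsub>localization R P\<^esub> x = \<zero>\<^bsub>localization R P\<^esub>"
      using x by (intro bexI[of _ "loc_frac R P (\<ominus> a) s"]) (auto simp: carrier_localization)
  qed (fastforce simp: carrier_localization m_ac a_ac intro!: eqI)+
  show "Group.comm_monoid (localization R P)"
    by (rule comm_monoidI) (fastforce simp: carrier_localization m_ac intro!: eqI)+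
  fix x y z
  assume "x \<in> carrier (localization R P)" "y \<in> carrier (localization R P)" "z \<in> carrier (localization R P)"
  then show "(x \<oplus>\<^bsub>localization R P\<^esub> y) \<otimes>\<^bsub>localization R P\<^esub> z =
      x \<otimes>\<^bsub>localization R P\<^esub> z \<oplus>\<^bsub>localization R P\<^esub> y \<otimes>\<^bsub>localization R P\<^esub> z"
    by (clarsimp simp: carrier_localization) (rule eqI; simp add: l_distr r_distr m_ac a_ac)
qed

end

text \<open>
  A sequence \<open>x\<^sub>1, \<dots>, x\<^sub>r\<close> is regular if each \<open>x\<^sub>i\<close> is a nonzerodivisor modulo
  \<open>(x\<^sub>1, \<dots>, x\<^sub>i\<^sub>-\<^sub>1)\<close> and \<open>(x\<^sub>1, \<dots>, x\<^sub>r)\<close> is a proper ideal.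
\<close>

definition regular_sequence :: "('a, 'b) ring_scheme \<Rightarrow> 'a list \<Rightarrow> bool" where
  "regular_sequence R xs \<longleftrightarrow>
     set xs \<subseteq> carrier R \<and>
     (\<forall>i < length xs. \<forall>a \<in> carrier R.
        xs ! i \<otimes>\<^bsub>R\<^esub> a \<in> Idl\<^bsub>R\<^esub> (set (take i xs)) \<longrightarrow> a \<in> Idl\<^bsub>R\<^esub> (set (take i xs))) \<and>
     Idl\<^bsub>R\<^esub> (set xs) \<noteq> carrier R"

definition depth :: "('a, 'b) ring_scheme \<Rightarrow> 'a set \<Rightarrow> enat" where
  "depth R I = Sup {enat (length xs) |xs. regular_sequence R xs \<and> set xs \<subseteq> I}"

definition krull_dim :: "('a, 'b) ring_scheme \<Rightarrow> enat" where
  "krull_dim R =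
     Sup {enat n |n. \<exists>P. (\<forall>i \<le> n. primeideal (P i) R) \<and> (\<forall>i < n. P i \<subset> P (Suc i))}"

definition local_ring :: "('a, 'b) ring_scheme \<Rightarrow> bool" where
  "local_ring R \<longleftrightarrow> cring R \<and> (\<exists>!M. maximalideal M R)"

definition the_maximal_ideal :: "('a, 'b) ring_scheme \<Rightarrow> 'a set" where
  "the_maximal_ideal R = (THE M. maximalideal M R)"

definition cohen_macaulay_local_ring :: "('a, 'b) ring_scheme \<Rightarrow> bool" where
  "cohen_macaulay_local_ring R \<longleftrightarrow>
     local_ring R \<and> noetherian_ring R \<and> depth R (the_maximal_ideal R) = krull_dim R"

text \<open>The zero ring has no maximal ideals and so is Cohen--Macaulay.\<close>

definition cohen_macaulay_ring :: "('a, 'b) ring_scheme \<Rightarrow> bool" where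
  "cohen_macaulay_ring R \<longleftrightarrow>
     cring R \<and> noetherian_ring R \<and>
     (\<forall>M. maximalideal M R \<longrightarrow> cohen_macaulay_local_ring (localization R M))"


section \<open>Points in a product of two projective spaces\<close>

text \<open>
  The projective space with homogeneous coordinates indexed by the finite type \<open>'m\<close>, of
  dimension \<open>CARD('m) - 1\<close>: nonzero vectors up to nonzero scalars. A point is the set of all its
  coordinate vectors.
\<close>

definition proj_rel :: "(('m \<Rightarrow> 'k::field) \<times> ('m \<Rightarrow> 'k)) set" where
  "proj_rel = {(u, v). u \<noteq> (\<lambda>_. 0) \<and> v \<noteq> (\<lambda>_. 0) \<and> (\<exists>c. c \<noteq> 0 \<and> v = (\<lambda>i. c * u i))}"

definition proj_space :: "('m::finite \<Rightarrow> 'k::field) set set" where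
  "proj_space = {v. v \<noteq> (\<lambda>_. 0)} // proj_rel"

text \<open>
  Polynomials in the variables \<open>x\<^sub>i\<close> (index \<open>Inl i\<close>) and \<open>y\<^sub>j\<close> (index \<open>Inr j\<close>), as finitely
  supported maps from exponent vectors to coefficients.
\<close>

type_synonym ('m, 'n, 'k) bipoly = "(('m + 'n) \<Rightarrow>\<^sub>0 nat) \<Rightarrow>\<^sub>0 'k"

definition eval_bipoly ::
  "('m::finite, 'n::finite, 'k::field) bipoly \<Rightarrow> ('m \<Rightarrow> 'k) \<Rightarrow> ('n \<Rightarrow> 'k) \<Rightarrow> 'k" where
  "eval_bipoly f u v =
     (\<Sum>e \<in> Poly_Mapping.keys f. Poly_Mapping.lookup f e *
        ((\<Prod>i \<in> UNIV. u i ^ Poly_Mapping.lookup e (Inl i)) *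
         (\<Prod>j \<in> UNIV. v j ^ Poly_Mapping.lookup e (Inr j))))"

definition bihomogeneous_of_degree ::
  "nat \<times> nat \<Rightarrow> ('m::finite, 'n::finite, 'k::field) bipoly \<Rightarrow> bool" where
  "bihomogeneous_of_degree d f \<longleftrightarrow>
     (\<forall>e \<in> Poly_Mapping.keys f.
        ((\<Sum>i \<in> UNIV. Poly_Mapping.lookup e (Inl i)),
         (\<Sum>j \<in> UNIV. Poly_Mapping.lookup e (Inr j))) = d)"

definition bihomogeneous :: "('m::finite, 'n::finite, 'k::field) bipoly \<Rightarrow> bool" where
  "bihomogeneous f \<longleftrightarrow> (\<exists>d. bihomogeneous_of_degree d f)"

text \<open>
  Vanishing is required at all coordinate vectors of the point; for bihomogeneous polynomials the
  choice does not matter.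
\<close>

definition vanishes_at ::
  "('m::finite, 'n::finite, 'k::field) bipoly \<Rightarrow> ('m \<Rightarrow> 'k) set \<times> ('n \<Rightarrow> 'k) set \<Rightarrow> bool" where
  "vanishes_at f p \<longleftrightarrow> (\<forall>u \<in> fst p. \<forall>v \<in> snd p. eval_bipoly f u v = 0)"

definition bipoly_ring :: "('m::finite, 'n::finite, 'k::field) bipoly ring" where
  "bipoly_ring = ring_of_type_algebra"

definition vanishing_ideal ::
  "(('m::finite \<Rightarrow> 'k::field) set \<times> ('n::finite \<Rightarrow> 'k) set) set \<Rightarrow> ('m, 'n, 'k) bipoly set" where
  "vanishing_ideal Z =
     Idl\<^bsub>bipoly_ring\<^esub> {f. bihomogeneous f \<and> (\<forall>p \<in> Z. vanishes_at f p)}"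

definition arithmetically_cohen_macaulay ::
  "(('m::finite \<Rightarrow> 'k::field) set \<times> ('n::finite \<Rightarrow> 'k) set) set \<Rightarrow> bool" where
  "arithmetically_cohen_macaulay Z \<longleftrightarrow> cohen_macaulay_ring (bipoly_ring Quot vanishing_ideal Z)"

definition star_property :: "('p \<times> 'q) set \<Rightarrow> bool" where
  "star_property Z \<longleftrightarrow>
     (\<forall>P1 Q1 P2 Q2. (P1, Q1) \<in> Z \<and> (P2, Q2) \<in> Z \<longrightarrow> (P1, Q2) \<in> Z \<or> (P2, Q1) \<in> Z)"

end

(*
  Choose linear forms l in the x_i and m in the y_j that vanish at no point of X, and normalize all
  coordinate vectors by l = 1 and m = 1. By the star property the fibres of X over the first factor
  are nested, and so are those over the second, so X is a Ferrers diagram for a suitable order of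
  the points of both factors. Forms e_a, each of the least degree for which it vanishes at the first
  a points of the first factor but not at the next one, and similarly h_b for the second factor,
  give products e_a h_b, indexed by the points (a, b) of X, which are a basis of R/I_X over
  k[l, m]: triangularity gives independence, and e_a h_b vanishes on X when (a, b) is not in X.
  A maximal ideal M of R/I_X contains the ideal of some point of X, modulo which R is k[l, m], so
  that M contains nonzero polynomials f(l) and g(m). They form a regular sequence by freeness,
  while dim R/I_X <= 2 because any three elements of k[s, t] are algebraically dependent.
*)

theory Submission
  imports Defs
begin

section \<open>Regular sequences and chains of primes\<close>

text \<open>Cohen-Macaulayness is tested at every maximal ideal M, homogeneous or not, and k need
  not be algebraically closed. So M need not contain l and m, nor any l - c and m - d, and general
  f(l) and g(m) are unavoidable; freeness over k[l, m] handles every such pair at once. Freeness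
  over this ring, and not merely over its fraction field, is the reason for the least degrees:
  expanding a form of degree d in the e_a takes coefficients that are multiples of l^(d - deg e_a),
  and these exponents must not be negative. A point is treated through f(s u, t v) in k[s, t]
  instead of a value in k. The two parameters keep the bidegrees apart, so that I_X becomes a finite
  intersection of kernels of maps to a domain. Depth is a supremum over regular sequences, which the
  pair bounds only from below. The bound by the dimension is proved for arbitrary commutative rings,
  by turning regular sequences into chains of primes. Characteristic zero makes k infinite, which
  provides the linear forms l and m.\<close>

lemma (in cring) mem_add_cgenideal:
  assumes "ideal J R" "a \<in> carrier R"
  shows "c \<in> J <+> PIdl a \<longleftrightarrow> (\<exists>j \<in> J. \<exists>r \<in> carrier R. c = j \<oplus> r \<otimes> a)"
  unfolding set_add_def' cgenideal_def by auto

text \<open>Zorn's lemma gives an ideal \<open>M\<close> maximal among those above \<open>I\<close>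
  that miss \<open>S\<close>, and such an ideal is prime: for \<open>a\<close> and \<open>b\<close>
  outside \<open>M\<close> both enlarged ideals meet \<open>S\<close>, and if
  \<open>a \<otimes> b\<close> were in \<open>M\<close>, the product of the two elements found would
  lie in both \<open>M\<close> and \<open>S\<close>.\<close>

lemma (in cring) prime_avoiding_mult_set:
  assumes I: "ideal I R" and S: "S \<subseteq> carrier R" "\<one> \<in> S" "\<And>s t. s \<in> S \<Longrightarrow> t \<in> S \<Longrightarrow> s \<otimes> t \<in> S"
    and disj: "I \<inter> S = {}"
  shows "\<exists>Q. primeideal Q R \<and> I \<subseteq> Q \<and> Q \<inter> S = {}"
proof -
  define A where "A = {J. ideal J R \<and> I \<subseteq> J \<and> J \<inter> S = {}}"
  have "\<exists>M\<in>A. \<forall>J\<in>A. M \<subseteq> J \<longrightarrow> J = M"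
  proof (rule subset_Zorn_nonempty)
    show "A \<noteq> {}" using I disj by (auto simp: A_def)
    fix C assume C: "C \<noteq> {}" "subset.chain A C"
    have "subset.chain {J. ideal J R} C"
      using C(2) unfolding pred_on.chain_def A_def by blast
    from chain_Union_is_ideal[OF this] C(1) have "ideal (\<Union>C) R" by simp
    then show "\<Union>C \<in> A" using C unfolding A_def pred_on.chain_def by blast
  qed
  then obtain M where MA: "M \<in> A" and mx: "\<And>J. J \<in> A \<Longrightarrow> M \<subseteq> J \<Longrightarrow> J = M" by blast
  have M: "ideal M R" "I \<subseteq> M" "M \<inter> S = {}" using MA by (auto simp: A_def)
  have max: "J = M" if "ideal J R" "M \<subseteq> J" "J \<inter> S = {}" for J
    using mx[of J] that M(2) by (simp add: A_def)
  interpret M: ideal M R by fact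
  have meet: "\<exists>j \<in> M. \<exists>r \<in> carrier R. j \<oplus> r \<otimes> a \<in> S" if a: "a \<in> carrier R" "a \<notin> M" for a
  proof (rule ccontr)
    assume no: "\<not> ?thesis"
    have "ideal (M <+> PIdl a) R" using add_ideals[OF M(1) cgenideal_ideal[OF a(1)]] .
    moreover have "M \<subseteq> M <+> PIdl a"
    proof
      fix m assume m: "m \<in> M"
      then have "m = m \<oplus> \<zero> \<otimes> a" using a M.Icarr by simp
      then show "m \<in> M <+> PIdl a" unfolding mem_add_cgenideal[OF M(1) a(1)] using m by blast
    qed
    moreover have "(M <+> PIdl a) \<inter> S = {}" using no by (auto simp: mem_add_cgenideal[OF M(1) a(1)])
    ultimately have "M <+> PIdl a = M" by (rule max)
    moreover have "a = \<zero> \<oplus> \<one> \<otimes> a" using a by simp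
    then have "a \<in> M <+> PIdl a"
      unfolding mem_add_cgenideal[OF M(1) a(1)] using M.zero_closed by blast
    ultimately show False using a by simp
  qed
  have "primeideal M R"
  proof (rule primeidealI[OF M(1) is_cring])
    show "carrier R \<noteq> M" using S M by blast
    fix a b assume ab: "a \<in> carrier R" "b \<in> carrier R" "a \<otimes> b \<in> M"
    show "a \<in> M \<or> b \<in> M"
    proof (rule ccontr)
      assume "\<not> (a \<in> M \<or> b \<in> M)"
      then obtain j r k q where h: "j \<in> M" "r \<in> carrier R" "j \<oplus> r \<otimes> a \<in> S"
          "k \<in> M" "q \<in> carrier R" "k \<oplus> q \<otimes> b \<in> S"
        using meet[of a] meet[of b] ab by blast
      have c: "j \<in> carrier R" "k \<in> carrier R" using h M.Icarr by auto
      have "(j \<oplus> r \<otimes> a) \<otimes> (k \<oplus> q \<otimes> b) = j \<otimes> (k \<oplus> q \<otimes> b) \<oplus> (r \<otimes> a) \<otimes> k \<oplus> (r \<otimes> q) \<otimes> (a \<otimes> b)"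
        using c h ab by (simp add: l_distr r_distr m_ac a_ac)
      also have "\<dots> \<in> M" using h c ab M.I_r_closed M.I_l_closed by simp
      finally show False using S(3)[OF h(3) h(6)] M(3) by blast
    qed
  qed
  then show ?thesis using M by blast
qed

text \<open>A nonzerodivisor modulo \<open>I\<close> lies in no minimal prime over \<open>I\<close>.
  Regularity strips the powers of \<open>x\<close> from an element s x^n of \<open>I\<close>,
  leaving s in \<open>I\<close> and hence in \<open>P\<close>. So the multiplicative set of all s
  x^n with s outside \<open>P\<close> misses \<open>I\<close>, and a prime over \<open>I\<close>
  that avoids this set lies in \<open>P\<close> and omits \<open>x\<close>.\<close>

lemma (in cring) smaller_prime_of_regular:
  assumes I: "ideal I R" and P: "primeideal P R" "I \<subseteq> P" and x: "x \<in> P"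
    and reg: "\<And>a. a \<in> carrier R \<Longrightarrow> x \<otimes> a \<in> I \<Longrightarrow> a \<in> I"
  shows "\<exists>Q. primeideal Q R \<and> I \<subseteq> Q \<and> Q \<subset> P"
proof -
  interpret P: primeideal P R by fact
  have xc: "x \<in> carrier R" using x P.Icarr by blast
  define S where "S = {s \<otimes> x [^] n |s n. s \<in> carrier R - P \<and> n \<in> (UNIV :: nat set)}"
  have one: "\<one> \<notin> P" using P.I_notcarr P.one_imp_carrier by auto
  have pow: "a \<in> I" if "x [^] (n::nat) \<otimes> a \<in> I" "a \<in> carrier R" for n a
    using that(1)
  proof (induction n)
    case 0
    then show ?case using that by simp
  next
    case (Suc n)
    have "x \<otimes> (x [^] n \<otimes> a) \<in> I" using Suc.prems xc that by (simp add: m_ac)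
    from reg[OF _ this] have "x [^] n \<otimes> a \<in> I" using xc that(2) by simp
    then show ?case by (rule Suc.IH)
  qed
  have "\<exists>Q. primeideal Q R \<and> I \<subseteq> Q \<and> Q \<inter> S = {}"
  proof (rule prime_avoiding_mult_set[OF I])
    show "S \<subseteq> carrier R" using xc by (auto simp: S_def)
    show "\<one> \<in> S" unfolding S_def using one by (auto intro!: exI[of _ \<one>] exI[of _ "0::nat"])
    fix s t assume "s \<in> S" "t \<in> S"
    then obtain s' n t' m where st: "s = s' \<otimes> x [^] (n::nat)" "t = t' \<otimes> x [^] (m::nat)"
        "s' \<in> carrier R - P" "t' \<in> carrier R - P"
      by (auto simp: S_def)
    have "s \<otimes> t = (s' \<otimes> t') \<otimes> (x [^] n \<otimes> x [^] m)"
      using st xc by (simp add: m_ac del: nat_pow_mult)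
    then have "s \<otimes> t = (s' \<otimes> t') \<otimes> x [^] (n + m)"
      using xc by (simp add: nat_pow_mult)
    moreover have "s' \<otimes> t' \<in> carrier R - P" using st P.I_prime by blast
    ultimately show "s \<otimes> t \<in> S" unfolding S_def by blast
  next
    have "s \<otimes> x [^] n \<notin> I" if "s \<in> carrier R - P" for s and n :: nat
      using pow[of n s] that P(2) xc by (auto simp: m_comm)
    then show "I \<inter> S = {}" by (auto simp: S_def)
  qed
  then obtain Q where Q: "primeideal Q R" "I \<subseteq> Q" "Q \<inter> S = {}" by blast
  have "Q \<subseteq> P"
  proof
    fix q assume q: "q \<in> Q"
    then have c: "q \<in> carrier R" using Q(1) ideal.Icarr primeideal.axioms(1) by metis
    show "q \<in> P"
    proof (rule ccontr)
      assume "q \<notin> P"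
      then have "q \<otimes> x [^] (0::nat) \<in> S" using c unfolding S_def by blast
      then show False using c q Q by auto
    qed
  qed
  moreover have "\<one> \<otimes> x [^] (1::nat) \<in> S" using one unfolding S_def by blast
  then have "x \<notin> Q" using xc Q by auto
  ultimately show ?thesis using Q x by blast
qed

text \<open>The chain grows downward from \<open>P\<close>, whence the reversed induction with
  \<open>P\<close> arbitrary: the last entry is regular modulo the ideal of the others, so some
  prime strictly below \<open>P\<close> still contains them.\<close>

lemma (in cring) prime_chain_of_regular:
  assumes "set xs \<subseteq> carrier R"
    and "\<forall>i < length xs. \<forall>a \<in> carrier R. xs ! i \<otimes> a \<in> Idl (set (take i xs)) \<longrightarrow> a \<in> Idl (set (take i xs))"
    and "primeideal P R" "set xs \<subseteq> P"
  shows "\<exists>Q. (\<forall>i \<le> length xs. primeideal (Q i) R) \<and> (\<forall>i < length xs. Q i \<subset> Q (Suc i)) \<and> Q (length xs) = P"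
  using assms
proof (induction xs arbitrary: P rule: rev_induct)
  case Nil
  then show ?case by (intro exI[of _ "\<lambda>_. P"]) auto
next
  case (snoc x xs)
  have xs: "set xs \<subseteq> carrier R" and x: "x \<in> P" using snoc.prems by auto
  interpret P: primeideal P R by fact
  have "a \<in> Idl (set xs)" if "a \<in> carrier R" "x \<otimes> a \<in> Idl (set xs)" for a
    using snoc.prems(2)[rule_format, of "length xs" a] that by auto
  moreover have "Idl (set xs) \<subseteq> P" using snoc.prems genideal_minimal[OF P.is_ideal] by auto
  ultimately obtain Q' where Q': "primeideal Q' R" "Idl (set xs) \<subseteq> Q'" "Q' \<subset> P"
    using smaller_prime_of_regular[OF genideal_ideal[OF xs] snoc.prems(3)] x by blast
  have "\<forall>i < length xs. \<forall>a \<in> carrier R. xs ! i \<otimes> a \<in> Idl (set (take i xs)) \<longrightarrow> a \<in> Idl (set (take i xs))"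
  proof (intro allI impI)
    fix i assume "i < length xs"
    then show "\<forall>a \<in> carrier R. xs ! i \<otimes> a \<in> Idl (set (take i xs)) \<longrightarrow> a \<in> Idl (set (take i xs))"
      using snoc.prems(2)[rule_format, of i] by (auto simp: nth_append)
  qed
  moreover have "set xs \<subseteq> Q'" using Q' genideal_self[OF xs] by blast
  ultimately obtain Q where Q: "\<forall>i \<le> length xs. primeideal (Q i) R"
      "\<forall>i < length xs. Q i \<subset> Q (Suc i)" "Q (length xs) = Q'"
    using snoc.IH[OF xs _ Q'(1)] by blast
  show ?case
  proof (intro exI conjI allI impI)
    let ?Q = "Q(Suc (length xs) := P)"
    show "primeideal (?Q i) R" if "i \<le> length (xs @ [x])" for i
      using that Q snoc.prems by auto
    show "?Q i \<subset> ?Q (Suc i)" if "i < length (xs @ [x])" for i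
      using that Q Q' by (cases "i = length xs") auto
  qed simp
qed

lemma depth_le_krull_dim:
  assumes "cring R" "primeideal P R"
  shows "depth R P \<le> krull_dim R"
  unfolding depth_def krull_dim_def
proof (rule Sup_least, safe)
  interpret cring R by fact
  fix xs assume xs: "regular_sequence R xs" "set xs \<subseteq> P"
  from prime_chain_of_regular[OF _ _ assms(2) xs(2)] xs(1)
  obtain Q where "\<forall>i \<le> length xs. primeideal (Q i) R" "\<forall>i < length xs. Q i \<subset> Q (Suc i)"
    unfolding regular_sequence_def by blast
  then show "enat (length xs) \<le>
      Sup {enat n |n. \<exists>P. (\<forall>i\<le>n. primeideal (P i) R) \<and> (\<forall>i<n. P i \<subset> P (Suc i))}"
    by (intro Sup_upper) blast
qed

section \<open>Ideals and primes of type-class rings, elementwise\<close>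

abbreviation type_ring :: "'a::comm_ring_1 ring" where
  "type_ring \<equiv> ring_of_type_algebra"

lemma type_ring_simps [simp]:
  "carrier type_ring = UNIV" "x \<otimes>\<^bsub>type_ring\<^esub> y = x * y" "x \<oplus>\<^bsub>type_ring\<^esub> y = x + y"
  "\<one>\<^bsub>type_ring\<^esub> = 1" "\<zero>\<^bsub>type_ring\<^esub> = 0"
  by (simp_all add: ring_of_type_algebra_def)

lemma a_inv_type_ring [simp]: "\<ominus>\<^bsub>type_ring\<^esub> x = - x"
proof -
  interpret cring "type_ring :: 'a ring" by (rule cring_from_type_algebra)
  show ?thesis using minus_equality[of "- x" x] by simp
qed

lemma
  assumes "ideal J type_ring"
  shows type_ideal_zero: "0 \<in> J"
    and type_ideal_add: "a \<in> J \<Longrightarrow> b \<in> J \<Longrightarrow> a + b \<in> J"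
    and type_ideal_mult: "a \<in> J \<Longrightarrow> c * a \<in> J"
    and type_ideal_mult_right: "a \<in> J \<Longrightarrow> a * c \<in> J"
    and type_ideal_uminus: "a \<in> J \<Longrightarrow> - a \<in> J"
    and type_ideal_diff: "a \<in> J \<Longrightarrow> b \<in> J \<Longrightarrow> a - b \<in> J"
proof -
  interpret ideal J type_ring by fact
  show "0 \<in> J" using additive_subgroup.zero_closed[OF is_additive_subgroup] by simp
  show add: "a + b \<in> J" if "a \<in> J" "b \<in> J" for a b using additive_subgroup.a_closed[OF is_additive_subgroup] that by simp
  show mult: "c * a \<in> J" if "a \<in> J" for a c using I_l_closed[of a c] that by simp
  show "a * c \<in> J" if "a \<in> J" using mult[OF that, of c] by (simp add: mult.commute)
  show um: "- a \<in> J" if "a \<in> J" for a using mult[OF that, of "- 1"] by simp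
  show "a - b \<in> J" if "a \<in> J" "b \<in> J" using add[OF that(1) um[OF that(2)]] by simp
qed

lemma type_idealI:
  assumes "0 \<in> J" "\<And>a b. a \<in> J \<Longrightarrow> b \<in> J \<Longrightarrow> a + b \<in> J" "\<And>a c. a \<in> J \<Longrightarrow> c * a \<in> J"
  shows "ideal J (type_ring :: 'a::comm_ring_1 ring)"
proof -
  have uminus: "- a \<in> J" if "a \<in> J" for a using assms(3)[OF that, of "- 1"] by simp
  interpret cring "type_ring :: 'a ring" by (rule cring_from_type_algebra)
  show ?thesis
  proof (rule idealI)
    show "ring (type_ring :: 'a ring)" by (rule ring_from_type_algebra)
    have "inv\<^bsub>add_monoid type_ring\<^esub> a = - a" for a :: 'a
      using a_inv_type_ring[of a] by (simp add: a_inv_def)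
    then show "subgroup J (add_monoid (type_ring :: 'a ring))"
      using assms uminus by (intro subgroup.intro) auto
  qed (use assms in \<open>auto simp: mult.commute\<close>)
qed

lemma
  assumes "primeideal P (type_ring :: 'a::comm_ring_1 ring)"
  shows type_prime_ideal: "ideal P type_ring"
    and type_prime_one: "1 \<notin> P"
    and type_prime_mult_iff: "a * b \<in> P \<longleftrightarrow> a \<in> P \<or> b \<in> P"
proof -
  interpret primeideal P type_ring by fact
  show id: "ideal P type_ring" by (rule is_ideal)
  show "1 \<notin> P" using I_notcarr one_imp_carrier by auto
  show "a * b \<in> P \<longleftrightarrow> a \<in> P \<or> b \<in> P"
    using I_prime[of a b] type_ideal_mult[OF id] type_ideal_mult_right[OF id] by auto
qed

lemma type_primeI:
  assumes "ideal P (type_ring :: 'a::comm_ring_1 ring)" "1 \<notin> P"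
    "\<And>a b. a * b \<in> P \<Longrightarrow> a \<in> P \<or> b \<in> P"
  shows "primeideal P type_ring"
  using assms by (intro primeidealI cring_from_type_algebra) auto

text \<open>By \<open>pre\<close> every element of \<open>S\<close> belongs to the same ideals as
  some \<open>h a\<close>, so ideals of \<open>S\<close> are determined by their preimages and
  chains of them pull back to \<open>R\<close>. This covers surjections and also localizations,
  where \<open>z\<close> and \<open>h a\<close> differ by a unit.\<close>

lemma (in ring_hom_ring) noetherian_codomain:
  assumes noeth: "noetherian_ring R"
    and pre: "\<And>z. z \<in> carrier S \<Longrightarrow> \<exists>a \<in> carrier R. \<forall>K. ideal K S \<longrightarrow> z \<in> K \<longleftrightarrow> h a \<in> K"
  shows "noetherian_ring S"
proof (rule S.trivial_ideal_chain_imp_noetherian)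
  fix C assume C: "C \<noteq> {}" "subset.chain {I. ideal I S} C"
  let ?pre = "\<lambda>K. {r \<in> carrier R. h r \<in> K}"
  have id: "ideal K S" if "K \<in> C" for K using C(2) that unfolding pred_on.chain_def by blast
  have "subset.chain {I. ideal I R} (?pre ` C)"
    unfolding subset_chain_def
  proof (intro conjI ballI subsetI)
    fix J assume "J \<in> ?pre ` C"
    then show "J \<in> {I. ideal I R}" using ideal_vimage id by blast
  next
    fix J K assume "J \<in> ?pre ` C" "K \<in> ?pre ` C"
    then obtain J' K' where JK: "J' \<in> C" "K' \<in> C" "J = ?pre J'" "K = ?pre K'" by blast
    then have "J' \<subseteq> K' \<or> K' \<subseteq> J'" using C(2) unfolding subset_chain_def by blast
    then show "J \<subseteq> K \<or> K \<subseteq> J" using JK by blast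
  qed
  from noetherian_ring.ideal_chain_is_trivial[OF noeth _ this] C(1)
  have "\<Union>(?pre ` C) \<in> ?pre ` C" by simp
  then obtain K where K: "\<Union>(?pre ` C) = ?pre K" "K \<in> C" by (rule imageE)
  have "\<Union>C \<subseteq> K"
  proof
    fix z assume "z \<in> \<Union>C"
    then obtain J where J: "J \<in> C" "z \<in> J" by blast
    then have z: "z \<in> carrier S" using id ideal.Icarr by metis
    obtain a where a: "a \<in> carrier R" "\<And>K. ideal K S \<Longrightarrow> z \<in> K \<longleftrightarrow> h a \<in> K" using pre[OF z] by blast
    have "h a \<in> J" using a(2)[OF id[OF J(1)]] J by blast
    then have "a \<in> \<Union>(?pre ` C)" using J a(1) by auto
    then have "h a \<in> K" unfolding K(1) by simp
    then show "z \<in> K" using a(2)[OF id[OF K(2)]] by blast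
  qed
  then have "\<Union>C = K" using K by blast
  then show "\<Union>C \<in> C" using K by simp
qed

section \<open>Localizations of quotients\<close>

text \<open>
  \<open>S\<close> stands for the localization of \<open>R / I\<close> at the image of a prime \<open>M \<supseteq> I\<close>, and \<open>h\<close> for the
  canonical map from \<open>R\<close>; the fractions in \<open>S\<close> enter only through these axioms.
\<close>

locale localized_quotient = cring S for S :: "('s, 'x) ring_scheme" (structure) +
  fixes h :: "'a::comm_ring_1 \<Rightarrow> 's" and I M :: "'a set"
  assumes h_closed [simp]: "h a \<in> carrier S"
    and h_add: "h (a + b) = h a \<oplus> h b"
    and h_mult: "h (a * b) = h a \<otimes> h b"
    and h_one: "h 1 = \<one>"
    and I: "ideal I type_ring"
    and M: "primeideal M type_ring"
    and I_subset: "I \<subseteq> M"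
    and frac: "z \<in> carrier S \<Longrightarrow> \<exists>a s. s \<notin> M \<and> z \<otimes> h s = h a"
    and unit: "s \<notin> M \<Longrightarrow> h s \<in> Units S"
    and ker: "h a = \<zero> \<longleftrightarrow> (\<exists>u. u \<notin> M \<and> u * a \<in> I)"
begin

lemma ring_hom: "ring_hom_ring type_ring S h"
  by (rule ring_hom_ringI[OF ring_from_type_algebra ring_axioms])
     (simp_all add: h_add h_mult h_one)

lemma h_minus: "h (a - b) = h a \<ominus> h b"
proof -
  interpret ring_hom_ring type_ring S h by (rule ring_hom)
  show ?thesis using hom_a_inv[of b] by (simp add: a_minus_def h_add flip: diff_conv_add_uminus)
       (metis a_minus_def diff_conv_add_uminus h_add)
qed

lemma h_eq_iff: "h a = h b \<longleftrightarrow> (\<exists>u. u \<notin> M \<and> u * (a - b) \<in> I)"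
  using ker[of "a - b"] by (simp add: h_minus r_right_minus_eq)

lemma frac_mem_iff:
  assumes "ideal K S" "z \<in> carrier S" "s \<notin> M" "z \<otimes> h s = h a"
  shows "z \<in> K \<longleftrightarrow> h a \<in> K"
proof -
  interpret K: ideal K S by fact
  have "z = h a \<otimes> inv (h s)"
    using assms(2,4) unit[OF assms(3)] by (metis Units_closed Units_inv_closed Units_r_inv m_assoc r_one)
  then show ?thesis
    using K.I_r_closed assms(2,4) Units_inv_closed[OF unit[OF assms(3)]] h_closed by metis
qed

lemma Units_iff:
  assumes "z \<in> carrier S" "s \<notin> M" "z \<otimes> h s = h a"
  shows "z \<in> Units S \<longleftrightarrow> a \<notin> M"
proof
  assume "a \<notin> M"
  then have "z \<otimes> h s \<in> Units S" using unit assms(3) by simp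
  then show "z \<in> Units S" using assms(1) by (metis h_closed unit_factor)
next
  assume z: "z \<in> Units S"
  then have "h a \<in> Units S" using unit[OF assms(2)] assms(3) by (metis Units_m_closed)
  then obtain w where w: "w \<in> carrier S" "h a \<otimes> w = \<one>" by (meson Units_inv_closed Units_r_inv)
  obtain b t where bt: "t \<notin> M" "w \<otimes> h t = h b" using frac[OF w(1)] by blast
  have "h (a * b) = h t" using w bt by (simp add: h_mult flip: bt(2) m_assoc)
  then obtain u where u: "u \<notin> M" "u * (a * b - t) \<in> I" using h_eq_iff by blast
  show "a \<notin> M"
  proof
    assume "a \<in> M"
    note Mi = type_prime_ideal[OF M]
    have "a * b - t \<in> M" using u I_subset type_prime_mult_iff[OF M] by blast
    then have "a * b - (a * b - t) \<in> M"
      using type_ideal_diff[OF Mi type_ideal_mult_right[OF Mi \<open>a \<in> M\<close>]] by blast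
    then show False using bt(1) by simp
  qed
qed

lemma Units_h_iff: "h a \<in> Units S \<longleftrightarrow> a \<notin> M"
  using Units_iff[of "h a" 1 a] type_prime_one[OF M] by (simp add: h_one)

definition nonunits where "nonunits = carrier S - Units S"

lemma ideal_nonunits: "ideal nonunits S"
proof (rule idealI[OF ring_axioms])
  note Mi = type_prime_ideal[OF M]
  have mult_closed: "x \<otimes> a \<in> nonunits" if "a \<in> nonunits" "x \<in> carrier S" for a x
    using that unfolding nonunits_def by (metis Diff_iff m_closed m_comm unit_factor)
  have zero: "\<zero> \<in> nonunits"
  proof -
    have "h 0 = \<zero>" using ker[of 0] type_ideal_zero[OF I] type_prime_one[OF M] by auto
    then show ?thesis unfolding nonunits_def using Units_h_iff[of 0] type_ideal_zero[OF Mi] by auto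
  qed
  have add: "x \<oplus> y \<in> nonunits" if xy: "x \<in> nonunits" "y \<in> nonunits" for x y
  proof -
    have c: "x \<in> carrier S" "y \<in> carrier S" using xy by (auto simp: nonunits_def)
    obtain a s b t where h: "s \<notin> M" "x \<otimes> h s = h a" "t \<notin> M" "y \<otimes> h t = h b"
      using frac c by metis
    have "(x \<oplus> y) \<otimes> h (s * t) = (x \<otimes> h s) \<otimes> h t \<oplus> (y \<otimes> h t) \<otimes> h s"
      using c by (simp add: h_mult l_distr r_distr m_ac)
    also have "\<dots> = h (a * t + b * s)" unfolding h by (simp add: h_mult h_add)
    finally have eq: "(x \<oplus> y) \<otimes> h (s * t) = h (a * t + b * s)" .
    have "a \<in> M" "b \<in> M" using Units_iff[OF c(1) h(1,2)] Units_iff[OF c(2) h(3,4)] xy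
      by (auto simp: nonunits_def)
    then have "a * t + b * s \<in> M" by (intro type_ideal_add[OF Mi] type_ideal_mult_right[OF Mi])
    moreover have "s * t \<notin> M" using h type_prime_mult_iff[OF M] by blast
    ultimately show ?thesis using Units_iff[OF _ _ eq] c by (simp add: nonunits_def)
  qed
  have neg: "\<ominus> x \<in> nonunits" if "x \<in> nonunits" for x
    using mult_closed[OF that, of "\<ominus> \<one>"] that by (simp add: nonunits_def l_minus)
  show "subgroup nonunits (add_monoid S)"
    by (intro subgroup.intro) (use zero add neg in \<open>auto simp: nonunits_def a_inv_def\<close>)
  show "x \<otimes> a \<in> nonunits" "a \<otimes> x \<in> nonunits" if "a \<in> nonunits" "x \<in> carrier S" for a x
    using mult_closed[OF that] that by (simp_all add: nonunits_def m_comm)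
qed

lemma maximalideal_iff: "maximalideal J S \<longleftrightarrow> J = nonunits"
proof -
  have no_unit: "K = carrier S" if "ideal K S" "x \<in> K" "x \<in> Units S" for K x
  proof -
    interpret K: ideal K S by fact
    have "x \<otimes> inv x \<in> K" using K.I_r_closed that Units_inv_closed by blast
    then show ?thesis using that Units_r_inv K.one_imp_carrier by simp
  qed
  have notcarr: "carrier S \<noteq> nonunits" unfolding nonunits_def using Units_one_closed by blast
  have sub: "K \<subseteq> nonunits" if "ideal K S" "K \<noteq> carrier S" for K
    using that no_unit ideal.Icarr[of K S] unfolding nonunits_def by blast
  show ?thesis
  proof
    assume J: "maximalideal J S"
    interpret J: maximalideal J S by fact
    have "J \<subseteq> nonunits" using sub J.is_ideal J.I_notcarr by blast
    then show "J = nonunits" using J.I_maximal[OF ideal_nonunits] notcarr by (auto simp: nonunits_def)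
  next
    assume "J = nonunits"
    then show "maximalideal J S"
      using maximalidealI[OF ideal_nonunits notcarr] sub by blast
  qed
qed

lemma local_ring: "local_ring S" and the_maximal_ideal: "the_maximal_ideal S = nonunits"
  unfolding local_ring_def the_maximal_ideal_def maximalideal_iff using is_cring by auto

lemma noetherian:
  assumes "noetherian_ring (type_ring :: 'a ring)"
  shows "noetherian_ring S"
  using assms ring_hom_ring.noetherian_codomain[OF ring_hom] frac frac_mem_iff by (metis UNIV_I type_ring_simps(1))

text \<open>Primes of \<open>S\<close> contract along \<open>h\<close> to primes above
  \<open>I\<close>. Strictness survives because an element separating two primes of \<open>S\<close>
  may be replaced by its numerator. Of a longer chain only the first \<open>Suc n\<close> steps are
  used.\<close>

lemma krull_dim_le:
  assumes "\<nexists>P. (\<forall>i \<le> Suc n. primeideal (P i) (type_ring :: 'a ring)) \<and> (\<forall>i \<le> n. P i \<subset> P (Suc i)) \<and> I \<subseteq> P 0"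
  shows "krull_dim S \<le> enat n"
  unfolding krull_dim_def
proof (rule Sup_least, safe)
  interpret ring_hom_ring type_ring S h by (rule ring_hom)
  fix m P assume P: "\<forall>i\<le>m. primeideal (P i) S" "\<forall>i<m. P i \<subset> P (Suc i)"
  show "enat m \<le> enat n"
  proof (rule ccontr)
    assume "\<not> enat m \<le> enat n"
    then have m: "Suc n \<le> m" by simp
    define Q where "Q i = {r \<in> carrier type_ring. h r \<in> P i}" for i
    have "primeideal (Q i) type_ring" if "i \<le> Suc n" for i
      unfolding Q_def using primeideal_vimage[OF cring_from_type_algebra] P m that by simp
    moreover have "Q i \<subset> Q (Suc i)" if "i \<le> n" for i
    proof -
      have sub: "P i \<subset> P (Suc i)" using P(2) that m by auto
      have pr: "primeideal (P i) S" "primeideal (P (Suc i)) S" using P(1) that m by auto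
      then have id: "ideal (P i) S" "ideal (P (Suc i)) S" by (auto dest: primeideal.axioms)
      obtain z where z: "z \<in> P (Suc i)" "z \<notin> P i" using sub by blast
      then have zc: "z \<in> carrier S" using ideal.Icarr[OF id(2)] by blast
      obtain a s where as: "s \<notin> M" "z \<otimes> h s = h a" using frac[OF zc] by blast
      have "a \<in> Q (Suc i)" "a \<notin> Q i"
        using frac_mem_iff[OF id(1) zc as] frac_mem_iff[OF id(2) zc as] z by (auto simp: Q_def)
      then show ?thesis using sub unfolding Q_def by blast
    qed
    moreover have "I \<subseteq> Q 0"
    proof
      fix a assume "a \<in> I"
      then have "h a = \<zero>" using ker[of a] type_prime_one[OF M] by (metis mult_1)
      moreover have "ideal (P 0) S" using P(1) by (auto dest: primeideal.axioms)
      ultimately show "a \<in> Q 0" unfolding Q_def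
        using additive_subgroup.zero_closed[OF ideal.axioms(1)] by auto
    qed
    ultimately show False using assms by blast
  qed
qed

text \<open>The hypotheses \<open>x\<close> and \<open>y\<close> say without fractions that
  \<open>x\<close> is a nonzerodivisor modulo \<open>I\<close> and \<open>y\<close> is one modulo
  \<open>I\<close> and \<open>x\<close>. Clearing denominators carries both over to
  \<open>S\<close>; the generated ideal is proper since it consists of nonunits.\<close>

lemma regular_sequence_pair:
  assumes xy: "x \<in> M" "y \<in> M"
    and x: "\<And>a. x * a \<in> I \<Longrightarrow> a \<in> I"
    and y: "\<And>a b. y * a - x * b \<in> I \<Longrightarrow> \<exists>c. a - x * c \<in> I"
  shows "regular_sequence S [h x, h y]" and "set [h x, h y] \<subseteq> nonunits"
proof -
  note Mi = type_prime_ideal[OF M]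
  show hN: "set [h x, h y] \<subseteq> nonunits" using xy by (simp add: nonunits_def Units_h_iff)
  have "Idl (set [h x, h y]) \<subseteq> nonunits" using genideal_minimal[OF ideal_nonunits hN] .
  then have proper: "Idl (set [h x, h y]) \<noteq> carrier S" unfolding nonunits_def using Units_one_closed by blast
  have Idl0: "Idl {} = {\<zero>}"
    using genideal_minimal[OF zeroideal, of "{}"] additive_subgroup.zero_closed[OF ideal.axioms(1)[OF genideal_ideal]]
    by blast
  have reg0: "z = \<zero>" if z: "z \<in> carrier S" and eq: "h x \<otimes> z = \<zero>" for z
  proof -
    obtain a s where as: "s \<notin> M" "z \<otimes> h s = h a" using frac[OF z] by blast
    have "h (x * a) = (h x \<otimes> z) \<otimes> h s" using z as by (simp add: h_mult m_assoc)
    then have "h (x * a) = \<zero>" using eq by simp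
    then obtain u where u: "u \<notin> M" "u * (x * a) \<in> I" using ker by blast
    then have "x * (u * a) \<in> I" by (simp add: mult.left_commute)
    from x[OF this] have "h a = \<zero>" using ker u by blast
    then show ?thesis
      using frac_mem_iff[OF zeroideal z as] by simp
  qed
  have reg1: "z \<in> PIdl (h x)" if z: "z \<in> carrier S" and zm: "h y \<otimes> z \<in> PIdl (h x)" for z
  proof -
    obtain w where w: "w \<in> carrier S" "h y \<otimes> z = w \<otimes> h x" using zm unfolding cgenideal_def by blast
    obtain a s where as: "s \<notin> M" "z \<otimes> h s = h a" using frac[OF z] by blast
    obtain b t where bt: "t \<notin> M" "w \<otimes> h t = h b" using frac[OF w(1)] by blast
    have "h (y * (a * t)) = (h y \<otimes> z) \<otimes> (h s \<otimes> h t)"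
      using z by (simp add: h_mult as(2)[symmetric] m_ac)
    also have "\<dots> = h (x * (b * s))"
      unfolding w(2) using w(1) by (simp add: h_mult bt(2)[symmetric] m_ac)
    finally obtain u where u: "u \<notin> M" "u * (y * (a * t) - x * (b * s)) \<in> I" using h_eq_iff by blast
    then have "y * (u * a * t) - x * (u * b * s) \<in> I" by (simp add: algebra_simps)
    from y[OF this] obtain c where c: "u * a * t - x * c \<in> I" by blast
    have ut: "u * t \<notin> M" using u bt type_prime_mult_iff[OF M] by blast
    have "1 * (u * a * t - x * c) \<in> I" using c by simp
    then have "h (u * a * t) = h (x * c)" using h_eq_iff type_prime_one[OF M] by blast
    moreover have "z \<otimes> h (s * (u * t)) = (z \<otimes> h s) \<otimes> h (u * t)" using z by (simp add: h_mult m_assoc)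
    then have "z \<otimes> h (s * (u * t)) = h (u * a * t)" unfolding as(2) by (simp add: h_mult m_ac)
    ultimately have "z \<otimes> h (s * (u * t)) = h (x * c)" by simp
    moreover have "s * (u * t) \<notin> M" using ut as type_prime_mult_iff[OF M] by blast
    moreover have "h (x * c) \<in> PIdl (h x)" unfolding cgenideal_def by (auto simp: h_mult m_comm)
    ultimately show ?thesis using frac_mem_iff[OF cgenideal_ideal[OF h_closed] z] by blast
  qed
  show "regular_sequence S [h x, h y]"
    unfolding regular_sequence_def
    using proper reg0 reg1 by (auto simp: less_Suc_eq Idl0 cgenideal_eq_genideal)
qed

text \<open>Equality by squeezing: the pair makes the depth at least 2, the depth never exceeds the
  dimension, and \<open>dim\<close> bounds the dimension by 2.\<close>

lemma cohen_macaulay: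
  assumes noeth: "noetherian_ring (type_ring :: 'a ring)"
    and xy: "x \<in> M" "y \<in> M"
    and x: "\<And>a. x * a \<in> I \<Longrightarrow> a \<in> I"
    and y: "\<And>a b. y * a - x * b \<in> I \<Longrightarrow> \<exists>c. a - x * c \<in> I"
    and dim: "\<nexists>P. (\<forall>i \<le> 3. primeideal (P i) (type_ring :: 'a ring)) \<and> (\<forall>i \<le> 2. P i \<subset> P (Suc i)) \<and> I \<subseteq> P 0"
  shows "cohen_macaulay_local_ring S"
proof -
  have "enat 2 \<le> depth S nonunits"
    unfolding depth_def using regular_sequence_pair[OF xy x y]
    by (intro Sup_upper) (force intro!: exI[of _ "[h x, h y]"])
  moreover have "depth S nonunits \<le> krull_dim S"
    using depth_le_krull_dim[OF is_cring] maximalideal_prime maximalideal_iff by blast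
  moreover have "krull_dim S \<le> enat 2"
    using krull_dim_le[of 2] dim by (simp add: eval_nat_numeral)
  ultimately have "depth S nonunits = krull_dim S" by order
  then show ?thesis
    unfolding cohen_macaulay_local_ring_def the_maximal_ideal using local_ring noetherian[OF noeth] by simp
qed

end

text \<open>Both layers of the definition, the quotient and its localizations, are pulled back to
  the ring itself, so that the remaining obligations mention neither cosets nor fractions. The
  premise on \<open>r\<close> says elementwise that the ring modulo \<open>M\<close> is a
  field.\<close>

lemma cohen_macaulay_quotient:
  fixes I :: "'a::comm_ring_1 set"
  assumes I: "ideal I type_ring"
    and noeth: "noetherian_ring (type_ring :: 'a ring)"
    and dim: "\<nexists>P. (\<forall>i \<le> 3. primeideal (P i) (type_ring :: 'a ring)) \<and> (\<forall>i \<le> 2. P i \<subset> P (Suc i)) \<and> I \<subseteq> P 0"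
    and reg: "\<And>M. primeideal M (type_ring :: 'a ring) \<Longrightarrow> I \<subseteq> M \<Longrightarrow> (\<And>r. r \<notin> M \<Longrightarrow> \<exists>a. 1 - a * r \<in> M) \<Longrightarrow>
      \<exists>x \<in> M. \<exists>y \<in> M. (\<forall>a. x * a \<in> I \<longrightarrow> a \<in> I) \<and> (\<forall>a b. y * a - x * b \<in> I \<longrightarrow> (\<exists>c. a - x * c \<in> I))"
  shows "cohen_macaulay_ring (type_ring Quot I)"
  unfolding cohen_macaulay_ring_def
proof (intro conjI allI impI)
  let ?A = "type_ring Quot I"
  define \<pi> where "\<pi> r = I +>\<^bsub>type_ring\<^esub> r" for r
  interpret I: ideal I type_ring by fact
  interpret T: cring "type_ring :: 'a ring" by (rule cring_from_type_algebra)
  show A: "cring ?A" using I.quotient_is_cring[OF T.is_cring] .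
  interpret A: cring ?A by (rule A)
  interpret \<pi>: ring_hom_ring type_ring ?A \<pi>
    using I.rcos_ring_hom_ring unfolding \<pi>_def[abs_def] .
  have surj: "\<exists>r. z = \<pi> r" if "z \<in> carrier ?A" for z
    using that unfolding \<pi>_def FactRing_def A_RCOSETS_def' by auto
  have \<pi>_closed [simp]: "\<pi> r \<in> carrier ?A" for r using \<pi>.hom_closed[of r] by simp
  have \<pi>_add: "\<pi> (a + b) = \<pi> a \<oplus>\<^bsub>?A\<^esub> \<pi> b" for a b using \<pi>.hom_add[of a b] by simp
  have \<pi>_mult: "\<pi> (a * b) = \<pi> a \<otimes>\<^bsub>?A\<^esub> \<pi> b" for a b using \<pi>.hom_mult[of a b] by simp
  have \<pi>_one: "\<pi> 1 = \<one>\<^bsub>?A\<^esub>" using \<pi>.hom_one by simp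
  have \<pi>_diff: "\<pi> (a - b) = \<pi> a \<ominus>\<^bsub>?A\<^esub> \<pi> b" for a b
    using \<pi>_add[of a "- b"] \<pi>.hom_a_inv[of b] by (simp add: a_minus_def)
  have \<pi>_zero_iff: "\<pi> a = \<zero>\<^bsub>?A\<^esub> \<longleftrightarrow> a \<in> I" for a
  proof -
    have "\<pi> a = \<zero>\<^bsub>?A\<^esub> \<longleftrightarrow> I +>\<^bsub>type_ring\<^esub> a = I" by (simp add: \<pi>_def FactRing_def)
    then show ?thesis using I.rcos_const_imp_mem[of a] ring.a_rcos_zero[OF ring_from_type_algebra I, of a] by auto
  qed
  show "noetherian_ring ?A"
    using \<pi>.noetherian_codomain[OF noeth] surj by auto
  fix M' assume M': "maximalideal M' ?A"
  then interpret M': maximalideal M' ?A .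
  have M'_prime: "primeideal M' ?A" by (rule A.maximalideal_prime[OF M'])
  interpret P: primeideal M' ?A by (rule M'_prime)
  define M where "M = {r. \<pi> r \<in> M'}"
  have M: "primeideal M type_ring"
    using \<pi>.primeideal_vimage[OF T.is_cring M'_prime] by (simp add: M_def)
  have zM: "\<zero>\<^bsub>?A\<^esub> \<in> M'" using additive_subgroup.zero_closed[OF M'.is_additive_subgroup] .
  have IM: "I \<subseteq> M"
  proof
    fix a assume "a \<in> I"
    then have "\<pi> a = \<zero>\<^bsub>?A\<^esub>" using \<pi>_zero_iff by blast
    then show "a \<in> M" using zM unfolding M_def by simp
  qed
  have "\<exists>a. 1 - a * r \<in> M" if r: "r \<notin> M" for r
  proof -
    have J: "ideal (M' <+>\<^bsub>?A\<^esub> PIdl\<^bsub>?A\<^esub> \<pi> r) ?A"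
      by (rule A.add_ideals[OF M'.is_ideal A.cgenideal_ideal]) simp
    have sub: "M' \<subseteq> M' <+>\<^bsub>?A\<^esub> PIdl\<^bsub>?A\<^esub> \<pi> r"
    proof
      fix m assume m: "m \<in> M'"
      then have "m = m \<oplus>\<^bsub>?A\<^esub> \<zero>\<^bsub>?A\<^esub> \<otimes>\<^bsub>?A\<^esub> \<pi> r" using M'.Icarr by simp
      then show "m \<in> M' <+>\<^bsub>?A\<^esub> PIdl\<^bsub>?A\<^esub> \<pi> r"
        unfolding A.mem_add_cgenideal[OF M'.is_ideal \<pi>_closed] using m by blast
    qed
    have "\<pi> r = \<zero>\<^bsub>?A\<^esub> \<oplus>\<^bsub>?A\<^esub> \<one>\<^bsub>?A\<^esub> \<otimes>\<^bsub>?A\<^esub> \<pi> r" by simp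
    then have mem: "\<pi> r \<in> M' <+>\<^bsub>?A\<^esub> PIdl\<^bsub>?A\<^esub> \<pi> r"
      unfolding A.mem_add_cgenideal[OF M'.is_ideal \<pi>_closed]
      using zM A.one_closed by blast
    have "M' <+>\<^bsub>?A\<^esub> PIdl\<^bsub>?A\<^esub> \<pi> r \<subseteq> carrier ?A" using ideal.Icarr[OF J] by blast
    from M'.I_maximal[OF J sub this] mem r
    have "M' <+>\<^bsub>?A\<^esub> PIdl\<^bsub>?A\<^esub> \<pi> r = carrier ?A" unfolding M_def by blast
    then have "\<one>\<^bsub>?A\<^esub> \<in> M' <+>\<^bsub>?A\<^esub> PIdl\<^bsub>?A\<^esub> \<pi> r" by simp
    then obtain m c where mc: "m \<in> M'" "c \<in> carrier ?A" "\<one>\<^bsub>?A\<^esub> = m \<oplus>\<^bsub>?A\<^esub> c \<otimes>\<^bsub>?A\<^esub> \<pi> r"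
      unfolding A.mem_add_cgenideal[OF M'.is_ideal \<pi>_closed] by blast
    obtain a where a: "c = \<pi> a" using surj mc by blast
    have "m \<in> carrier ?A" using mc M'.Icarr by blast
    then have "\<pi> (1 - a * r) = m"
      unfolding \<pi>_diff \<pi>_one mc(3) \<pi>_mult a[symmetric]
      using mc(2) by (simp add: a_minus_def A.a_assoc A.r_neg)
    then show ?thesis using mc by (auto simp: M_def)
  qed
  from reg[OF M IM this] obtain x y where xy: "x \<in> M" "y \<in> M"
      "\<And>a. x * a \<in> I \<Longrightarrow> a \<in> I" "\<And>a b. y * a - x * b \<in> I \<Longrightarrow> \<exists>c. a - x * c \<in> I"
    by blast
  let ?L = "localization ?A M'"
  define h where "h r = loc_frac ?A M' (\<pi> r) \<one>\<^bsub>?A\<^esub>" for r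
  note loc = carrier_localization[OF M'_prime] mult_localization[OF M'_prime]
    add_localization[OF M'_prime] one_localization[OF M'_prime] zero_localization[OF M'_prime]
  have one: "\<one>\<^bsub>?A\<^esub> \<notin> M'" using M'.I_notcarr M'.one_imp_carrier by auto
  have not_mem: "\<pi> s \<notin> M' \<longleftrightarrow> s \<notin> M" for s by (simp add: M_def)
  have L_closed: "loc_frac ?A M' a s \<in> carrier ?L" if "a \<in> carrier ?A" "s \<in> carrier ?A" "s \<notin> M'" for a s
    unfolding loc(1) using that by blast
  have h_closed: "h a \<in> carrier ?L" for a
    unfolding h_def by (rule L_closed) (use one in auto)
  have "localized_quotient ?L h I M"
  proof (intro localized_quotient.intro localized_quotient_axioms.intro)
    show "cring ?L" by (rule cring_localization[OF M'_prime])
    show "h a \<in> carrier ?L" for a by (rule h_closed)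
    show "h (a + b) = h a \<oplus>\<^bsub>?L\<^esub> h b" for a b using one by (simp add: h_def loc \<pi>_add)
    show "h (a * b) = h a \<otimes>\<^bsub>?L\<^esub> h b" for a b using one by (simp add: h_def loc \<pi>_mult)
    show "h 1 = \<one>\<^bsub>?L\<^esub>" by (simp add: h_def loc \<pi>_one)
    show "ideal I type_ring" "primeideal M type_ring" "I \<subseteq> M" by fact+
    show "\<exists>a s. s \<notin> M \<and> z \<otimes>\<^bsub>?L\<^esub> h s = h a" if "z \<in> carrier ?L" for z
    proof -
      from that obtain a s where as: "z = loc_frac ?A M' (\<pi> a) (\<pi> s)" "s \<notin> M"
        unfolding loc using surj not_mem by blast
      have "z \<otimes>\<^bsub>?L\<^esub> h s = h a"
        unfolding h_def as(1) using as(2) not_mem one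
        by (auto simp: loc loc_frac_eq_iff[OF M'_prime] intro!: exI[of _ "\<one>\<^bsub>?A\<^esub>"])
      then show ?thesis using as(2) by blast
    qed
    show "h s \<in> Units ?L" if "s \<notin> M" for s
    proof -
      interpret L: cring ?L by (rule cring_localization[OF M'_prime])
      let ?i = "loc_frac ?A M' \<one>\<^bsub>?A\<^esub> (\<pi> s)"
      have i: "?i \<in> carrier ?L" "h s \<in> carrier ?L"
        using h_closed L_closed that not_mem by auto
      have "h s \<otimes>\<^bsub>?L\<^esub> ?i = \<one>\<^bsub>?L\<^esub>"
        unfolding h_def using one that not_mem
        by (auto simp add: loc loc_frac_eq_iff[OF M'_prime])
      moreover from this have "?i \<otimes>\<^bsub>?L\<^esub> h s = \<one>\<^bsub>?L\<^esub>" using L.m_comm[OF i] by simp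
      ultimately show ?thesis unfolding Units_def using i by blast
    qed
    show "h a = \<zero>\<^bsub>?L\<^esub> \<longleftrightarrow> (\<exists>u. u \<notin> M \<and> u * a \<in> I)" for a
    proof -
      have "h a = \<zero>\<^bsub>?L\<^esub> \<longleftrightarrow> (\<exists>u \<in> carrier ?A - M'. u \<otimes>\<^bsub>?A\<^esub> \<pi> a = \<zero>\<^bsub>?A\<^esub>)"
        unfolding h_def using one by (simp add: loc loc_frac_eq_iff[OF M'_prime])
      also have "\<dots> \<longleftrightarrow> (\<exists>u. u \<notin> M \<and> \<pi> (u * a) = \<zero>\<^bsub>?A\<^esub>)"
        unfolding \<pi>_mult using surj not_mem by (metis Diff_iff \<pi>_closed)
      finally show ?thesis unfolding \<pi>_zero_iff .
    qed
  qed
  from localized_quotient.cohen_macaulay[OF this noeth xy dim]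
  show "cohen_macaulay_local_ring ?L" .
qed

section \<open>Polynomial rings are Noetherian\<close>

text \<open>Pick the indices at which \<open>s\<close> attains its minimum over all later indices.
  There is one beyond every bound, and from one to the next the values cannot drop.\<close>

lemma nondecreasing_subsequence:
  fixes s :: "nat \<Rightarrow> nat"
  shows "\<exists>f :: nat \<Rightarrow> nat. strict_mono f \<and> mono (s \<circ> f)"
proof -
  have ex: "\<exists>y>x. \<forall>m\<ge>y. s y \<le> s m" for x
  proof -
    obtain y where "x < y" "\<forall>m. x < m \<longrightarrow> s y \<le> s m"
      using ex_has_least_nat[of "\<lambda>i. x < i" "Suc x" s] by auto
    then show ?thesis by (intro exI[of _ y]) auto
  qed
  have "\<exists>f. \<forall>n. (\<forall>m\<ge>f n. s (f n) \<le> s m) \<and> f n < f (Suc n)"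
    by (rule dependent_nat_choice) (use ex in blast)+
  then obtain f where f: "\<And>n. \<forall>m\<ge>f n. s (f n) \<le> s m" "\<And>n. f n < f (Suc n)" by blast
  then have "strict_mono f" by (simp add: strict_mono_Suc_iff)
  moreover from this have "mono (s \<circ> f)"
    using f(1) by (auto intro!: monoI simp: strict_mono_less_eq)
  ultimately show ?thesis by blast
qed

text \<open>Passing to a subsequence for one coordinate after the other makes all coordinates
  nondecreasing; its first two terms are then comparable.\<close>

lemma dickson:
  fixes e :: "nat \<Rightarrow> 'v::finite \<Rightarrow> nat"
  shows "\<exists>i j. i < j \<and> e i \<le> e j"
proof -
  have "\<exists>f::nat\<Rightarrow>nat. strict_mono f \<and> (\<forall>v\<in>V. mono (\<lambda>n. e (f n) v))" if "finite V" for V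
    using that
  proof induction
    case empty
    then show ?case by (auto intro!: exI[of _ id] strict_monoI)
  next
    case (insert v V)
    then obtain f :: "nat \<Rightarrow> nat" where f: "strict_mono f" "\<forall>w\<in>V. mono (\<lambda>n. e (f n) w)" by blast
    obtain g :: "nat \<Rightarrow> nat" where g: "strict_mono g" "mono ((\<lambda>n. e (f n) v) \<circ> g)"
      using nondecreasing_subsequence by blast
    have "mono (\<lambda>n. e (f (g n)) w)" if "w \<in> V" for w
      using f(2) that strict_mono_mono[OF g(1)] unfolding mono_def by blast
    then show ?case
      using f(1) g by (intro exI[of _ "f \<circ> g"]) (auto simp: strict_mono_def comp_def)
  qed
  from this[of UNIV] obtain f :: "nat \<Rightarrow> nat" where f: "strict_mono f" "\<And>v. mono (\<lambda>n. e (f n) v)" by auto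
  have "e (f 0) \<le> e (f 1)" using f(2) by (auto simp: le_fun_def mono_def)
  moreover have "f 0 < f 1" using f(1) by (simp add: strict_mono_less)
  ultimately show ?thesis by blast
qed

text \<open>Lexicographic order of monomials. The finite type of variables carries no order of its
  own, so \<open>to_nat_on UNIV\<close> supplies one.\<close>

definition lex_less :: "('v::finite \<Rightarrow>\<^sub>0 nat) \<Rightarrow> ('v \<Rightarrow>\<^sub>0 nat) \<Rightarrow> bool" where
  "lex_less d e \<longleftrightarrow> (\<exists>v. Poly_Mapping.lookup d v < Poly_Mapping.lookup e v \<and>
     (\<forall>w. to_nat_on UNIV w < to_nat_on UNIV v \<longrightarrow> Poly_Mapping.lookup d w = Poly_Mapping.lookup e w))"

lemma lex_less_irrefl: "\<not> lex_less d d"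
  by (simp add: lex_less_def)

lemma lex_less_linear: "lex_less d e \<or> d = e \<or> lex_less e d"
proof (cases "d = e")
  case False
  let ?t = "to_nat_on (UNIV :: 'a set)"
  have inj: "inj ?t" by (simp add: countable_finite inj_on_to_nat_on)
  obtain v where "Poly_Mapping.lookup d v \<noteq> Poly_Mapping.lookup e v" using False by (meson poly_mapping_eqI)
  then obtain v where v: "Poly_Mapping.lookup d v \<noteq> Poly_Mapping.lookup e v" "\<And>w. Poly_Mapping.lookup d w \<noteq> Poly_Mapping.lookup e w \<Longrightarrow> ?t v \<le> ?t w"
    using ex_has_least_nat[of "\<lambda>v. Poly_Mapping.lookup d v \<noteq> Poly_Mapping.lookup e v" v ?t] by blast
  then have "Poly_Mapping.lookup d w = Poly_Mapping.lookup e w" if "?t w < ?t v" for w using that leD by blast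
  then show ?thesis using v(1) unfolding lex_less_def by (metis linorder_neqE_nat)
qed simp

lemma lex_less_trans: "lex_less c d \<Longrightarrow> lex_less d e \<Longrightarrow> lex_less c e"
proof -
  let ?t = "to_nat_on (UNIV :: 'a set)"
  have inj: "inj ?t" by (simp add: countable_finite inj_on_to_nat_on)
  assume "lex_less c d" "lex_less d e"
  then obtain v w where v: "Poly_Mapping.lookup c v < Poly_Mapping.lookup d v" "\<And>u. ?t u < ?t v \<Longrightarrow> Poly_Mapping.lookup c u = Poly_Mapping.lookup d u"
    and w: "Poly_Mapping.lookup d w < Poly_Mapping.lookup e w" "\<And>u. ?t u < ?t w \<Longrightarrow> Poly_Mapping.lookup d u = Poly_Mapping.lookup e u"
    unfolding lex_less_def by blast
  consider "?t v < ?t w" | "v = w" | "?t w < ?t v" using inj by (metis injD linorder_neqE_nat)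
  then show ?thesis
  proof cases
    case 1
    then show ?thesis unfolding lex_less_def using v w by (intro exI[of _ v]) auto
  next
    case 2
    then show ?thesis unfolding lex_less_def using v w by (intro exI[of _ v]) auto
  next
    case 3
    then show ?thesis unfolding lex_less_def using v w by (intro exI[of _ w]) auto
  qed
qed

lemma lex_less_add: "lex_less (c + d) (c + e) \<longleftrightarrow> lex_less d e"
  by (simp add: lex_less_def lookup_add)

lemma lex_less_of_le:
  assumes "Poly_Mapping.lookup d \<le> Poly_Mapping.lookup e" "d \<noteq> e"
  shows "lex_less d e"
proof -
  have "\<not> lex_less e d" using assms(1) unfolding lex_less_def le_fun_def by (meson leD)
  then show ?thesis using lex_less_linear assms(2) by blast
qed

text \<open>By Dickson's lemma an infinite descent contains an exponent that divides a later one,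
  and a divisor is never lexicographically larger.\<close>

lemma wf_lex_less: "wf {(d, e). lex_less d e}"
  unfolding wf_iff_no_infinite_down_chain
proof safe
  fix f :: "nat \<Rightarrow> 'a \<Rightarrow>\<^sub>0 nat"
  assume "\<forall>i. (f (Suc i), f i) \<in> {(d, e). lex_less d e}"
  then have dec: "lex_less (f (Suc i)) (f i)" for i by simp
  have "lex_less (f j) (f i)" if "i < j" for i j
    using that by (induction rule: less_Suc_induct) (auto intro: dec lex_less_trans)
  moreover obtain i j where "i < j" "Poly_Mapping.lookup (f i) \<le> Poly_Mapping.lookup (f j)" using dickson[of "\<lambda>i. Poly_Mapping.lookup (f i)"] by blast
  ultimately show False by (metis lex_less_irrefl lex_less_of_le lex_less_trans)
qed

definition is_lead :: "(('v::finite \<Rightarrow>\<^sub>0 nat) \<Rightarrow>\<^sub>0 'k::zero) \<Rightarrow> ('v \<Rightarrow>\<^sub>0 nat) \<Rightarrow> bool" where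
  "is_lead p e \<longleftrightarrow> e \<in> Poly_Mapping.keys p \<and> (\<forall>d \<in> Poly_Mapping.keys p. d = e \<or> lex_less d e)"

lemma ex_is_lead:
  assumes "p \<noteq> 0"
  shows "\<exists>e. is_lead p e"
proof -
  have "\<exists>e\<in>A. \<forall>d\<in>A. d = e \<or> lex_less d e" if "finite A" "A \<noteq> {}" for A :: "('v::finite \<Rightarrow>\<^sub>0 nat) set"
    using that
  proof (induction rule: finite_ne_induct)
    case (insert a A)
    then obtain e where e: "e \<in> A" "\<forall>d\<in>A. d = e \<or> lex_less d e" by blast
    show ?case
    proof (cases "lex_less e a")
      case True
      then have "\<forall>d\<in>insert a A. d = a \<or> lex_less d a" using e(2) lex_less_trans[OF _ True] True by auto
      then show ?thesis by blast
    next
      case False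
      then have "\<forall>d\<in>insert a A. d = e \<or> lex_less d e" using e(2) lex_less_linear[of a e] False by auto
      then show ?thesis using e(1) by blast
    qed
  qed simp
  from this[of "Poly_Mapping.keys p"] assms show ?thesis by (auto simp: is_lead_def)
qed

lemma poly_mapping_sum_single:
  "p = (\<Sum>e \<in> Poly_Mapping.keys p. Poly_Mapping.single e (Poly_Mapping.lookup p e))"
  by (rule poly_mapping_eqI) (simp add: lookup_sum lookup_single when_def in_keys_iff sum.If_cases)

lemma lookup_single_mult:
  fixes p :: "('v \<Rightarrow>\<^sub>0 nat) \<Rightarrow>\<^sub>0 'k::comm_ring_1"
  shows "Poly_Mapping.lookup (Poly_Mapping.single d c * p) (d + e) = c * Poly_Mapping.lookup p e"
proof -
  have "Poly_Mapping.single d c * p = (\<Sum>e \<in> Poly_Mapping.keys p. Poly_Mapping.single (d + e) (c * Poly_Mapping.lookup p e))"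
    by (subst poly_mapping_sum_single[of p]) (simp add: sum_distrib_left mult_single)
  then show ?thesis
    by (simp add: lookup_sum lookup_single when_def in_keys_iff)
qed

lemma keys_single_mult:
  "Poly_Mapping.keys (Poly_Mapping.single d c * p) \<subseteq> (+) d ` Poly_Mapping.keys p"
  using keys_mult[of "Poly_Mapping.single d c" p] by (fastforce split: if_splits)

text \<open>One step of division: \<open>c\<close> is the term that matches the leading terms of
  \<open>c * p\<close> and \<open>q\<close>. All other monomials of \<open>c * p\<close> stay below
  \<open>e\<close> because the order is compatible with addition of exponents.\<close>

lemma lead_reduction:
  fixes p q :: "('v::finite \<Rightarrow>\<^sub>0 nat) \<Rightarrow>\<^sub>0 'k::field"
  assumes p: "is_lead p d" and q: "is_lead q e" and de: "Poly_Mapping.lookup d \<le> Poly_Mapping.lookup e"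
  shows "\<exists>c. \<forall>b \<in> Poly_Mapping.keys (q - c * p). lex_less b e"
proof -
  define c where "c = Poly_Mapping.single (e - d) (Poly_Mapping.lookup q e / Poly_Mapping.lookup p d)"
  have e: "e = (e - d) + d"
    using de by (intro poly_mapping_eqI) (simp add: lookup_add lookup_minus le_fun_def)
  have "Poly_Mapping.lookup (c * p) e = Poly_Mapping.lookup q e"
    using p lookup_single_mult[of "e - d" _ p d] e
    by (simp add: c_def is_lead_def in_keys_iff)
  then have ne: "e \<notin> Poly_Mapping.keys (q - c * p)" by (simp add: in_keys_iff lookup_minus)
  have "lex_less b e" if b: "b \<in> Poly_Mapping.keys (q - c * p)" for b
  proof -
    have "b \<in> Poly_Mapping.keys q \<or> b \<in> Poly_Mapping.keys (c * p)"
      using b keys_diff[of q "c * p"] by (auto simp: in_keys_iff lookup_minus)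
    moreover have "b = e \<or> lex_less b e" if "b \<in> Poly_Mapping.keys (c * p)"
    proof -
      obtain b' where b': "b' \<in> Poly_Mapping.keys p" "b = (e - d) + b'"
        using \<open>b \<in> Poly_Mapping.keys (c * p)\<close> keys_single_mult unfolding c_def by blast
      then have "b' = d \<or> lex_less b' d" using p by (auto simp: is_lead_def)
      then show ?thesis using e b'(2) lex_less_add[of "e - d" b' d] by auto
    qed
    ultimately show ?thesis using q b ne by (auto simp: is_lead_def)
  qed
  then show ?thesis by blast
qed

text \<open>
  Pick successively elements of least leading monomial outside the ideal generated so far. By
  Dickson's lemma one of the leading monomials divides a later one, so that the later element
  could have been reduced to one with a smaller leading monomial.
\<close>

lemma noetherian_ring_polynomials:
  "noetherian_ring (type_ring :: (('v::finite \<Rightarrow>\<^sub>0 nat) \<Rightarrow>\<^sub>0 'k::field) ring)"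
proof (rule ring.noetherian_ringI[OF ring_from_type_algebra], rule ccontr)
  let ?T = "type_ring :: (('v \<Rightarrow>\<^sub>0 nat) \<Rightarrow>\<^sub>0 'k) ring"
  interpret T: cring ?T by (rule cring_from_type_algebra)
  fix I assume I: "ideal I ?T" and not_fg: "\<not> (\<exists>A \<subseteq> carrier ?T. finite A \<and> I = Idl\<^bsub>?T\<^esub> A)"
  define P where "P A q \<longleftrightarrow> q \<in> I - Idl\<^bsub>?T\<^esub> A \<and>
    (\<exists>e. is_lead q e \<and> (\<forall>p d. p \<in> I - Idl\<^bsub>?T\<^esub> A \<longrightarrow> is_lead p d \<longrightarrow> \<not> lex_less d e))" for A q
  have Idl: "ideal (Idl\<^bsub>?T\<^esub> A) ?T" for A by (rule T.genideal_ideal) simp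
  have ex: "\<exists>q. P A q" if A: "finite A" "A \<subseteq> I" for A
  proof -
    have "Idl\<^bsub>?T\<^esub> A \<subseteq> I" using T.genideal_minimal[OF I A(2)] .
    then obtain p where p: "p \<in> I - Idl\<^bsub>?T\<^esub> A" using not_fg A(1) by auto
    then have "p \<noteq> 0" using type_ideal_zero[OF Idl] by blast
    then obtain e0 where "is_lead p e0" using ex_is_lead by blast
    then have "e0 \<in> {e. \<exists>p. p \<in> I - Idl\<^bsub>?T\<^esub> A \<and> is_lead p e}" using p by blast
    obtain e where e: "e \<in> {e. \<exists>p. p \<in> I - Idl\<^bsub>?T\<^esub> A \<and> is_lead p e}"
      and min: "\<And>d. (d, e) \<in> {(d, e). lex_less d e} \<Longrightarrow> d \<notin> {e. \<exists>p. p \<in> I - Idl\<^bsub>?T\<^esub> A \<and> is_lead p e}"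
      by (rule wfE_min[OF wf_lex_less \<open>e0 \<in> _\<close>], rule that)
    from e obtain q where q: "q \<in> I - Idl\<^bsub>?T\<^esub> A" "is_lead q e" by auto
    have "\<not> lex_less d e" if "p \<in> I - Idl\<^bsub>?T\<^esub> A" "is_lead p d" for p d
      using min[of d] that by auto
    then have "P A q" unfolding P_def using q by auto
    then show ?thesis by blast
  qed
  define pick where "pick A = (SOME q. P A q)" for A
  have pick: "P A (pick A)" if "finite A" "A \<subseteq> I" for A
    unfolding pick_def using someI_ex[OF ex[OF that]] .
  define F where "F = rec_nat {} (\<lambda>_ A. insert (pick A) A)"
  have F_simps: "F 0 = {}" "F (Suc n) = insert (pick (F n)) (F n)" for n by (simp_all add: F_def)
  have F: "finite (F n) \<and> F n \<subseteq> I" for n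
  proof (induction n)
    case (Suc n)
    then show ?case using pick[of "F n"] by (simp add: F_simps P_def)
  qed (simp add: F_simps)
  have F_mono: "F i \<subseteq> F j" if "i \<le> j" for i j
    using lift_Suc_mono_le[of F i j] that by (auto simp: F_simps)
  have "\<forall>n. \<exists>e. is_lead (pick (F n)) e \<and> (\<forall>p d. p \<in> I - Idl\<^bsub>?T\<^esub> (F n) \<longrightarrow> is_lead p d \<longrightarrow> \<not> lex_less d e)"
    using pick F unfolding P_def by blast
  then obtain e where e: "\<And>n. is_lead (pick (F n)) (e n)"
      "\<And>n p d. p \<in> I - Idl\<^bsub>?T\<^esub> (F n) \<Longrightarrow> is_lead p d \<Longrightarrow> \<not> lex_less d (e n)"
    by metis
  obtain i j where ij: "i < j" "Poly_Mapping.lookup (e i) \<le> Poly_Mapping.lookup (e j)"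
    using dickson[of "\<lambda>n. Poly_Mapping.lookup (e n)"] by blast
  from lead_reduction[OF e(1) e(1) ij(2)]
  obtain c where c: "\<forall>b \<in> Poly_Mapping.keys (pick (F j) - c * pick (F i)). lex_less b (e j)" by blast
  let ?g = "pick (F j) - c * pick (F i)"
  have "pick (F i) \<in> F j" using F_mono[of "Suc i" j] ij(1) by (auto simp: F_simps)
  then have "pick (F i) \<in> Idl\<^bsub>?T\<^esub> (F j)" using T.genideal_self[of "F j"] by auto
  then have mult: "c * pick (F i) \<in> Idl\<^bsub>?T\<^esub> (F j)" by (rule type_ideal_mult[OF Idl])
  have mem: "pick (F n) \<in> I - Idl\<^bsub>?T\<^esub> (F n)" for n using pick F unfolding P_def by blast
  have "?g \<in> I" using type_ideal_diff[OF I] type_ideal_mult[OF I] mem by blast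
  moreover have "?g \<notin> Idl\<^bsub>?T\<^esub> (F j)" using type_ideal_add[OF Idl _ mult, of ?g] mem by auto
  ultimately have g: "?g \<in> I - Idl\<^bsub>?T\<^esub> (F j)" by blast
  then have "?g \<noteq> 0" using type_ideal_zero[OF Idl] by (metis DiffE)
  then obtain d where d: "is_lead ?g d" using ex_is_lead by blast
  then have "lex_less d (e j)" using c by (simp add: is_lead_def)
  then show False using e(2)[OF g d] by blast
qed

section \<open>Polynomials in two variables\<close>

text \<open>Gaussian elimination: an equation with a nonzero coefficient removes one unknown
  together with itself, so the surplus of unknowns persists.\<close>

lemma homogeneous_system:
  fixes A :: "'j \<Rightarrow> 'i \<Rightarrow> 'k::field"
  assumes "finite J" "finite I" "card J < card I"
  shows "\<exists>c. (\<exists>i\<in>I. c i \<noteq> 0) \<and> (\<forall>j\<in>J. (\<Sum>i\<in>I. c i * A j i) = 0)"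
  using assms
proof (induction J arbitrary: I A rule: finite_induct)
  case empty
  then obtain i where "i \<in> I" by fastforce
  then show ?case by (intro exI[of _ "\<lambda>_. 1"]) auto
next
  case (insert j J)
  show ?case
  proof (cases "\<forall>i\<in>I. A j i = 0")
    case True
    have "card J < card I" using insert by simp
    from insert.IH[OF insert.prems(1) this, of A] obtain c where
      "\<exists>i\<in>I. c i \<noteq> 0" "\<forall>j\<in>J. (\<Sum>i\<in>I. c i * A j i) = 0" by blast
    then show ?thesis using True by (intro exI[of _ c]) auto
  next
    case False
    then obtain p where p: "p \<in> I" "A j p \<noteq> 0" by blast
    let ?I = "I - {p}"
    \<comment> \<open>\<open>B\<close> is the system left after solving equation \<open>j\<close>
      for the unknown \<open>p\<close>; \<open>d\<close> below restores that unknown.\<close>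
    define B where "B j' i = A j' i - A j' p * A j i / A j p" for j' i
    have "card J < card ?I" using insert p by simp
    then obtain c where c: "\<exists>i\<in>?I. c i \<noteq> 0" "\<forall>j'\<in>J. (\<Sum>i\<in>?I. c i * B j' i) = 0"
      using insert.IH[of ?I B] insert.prems by auto
    define d where "d = c(p := - (\<Sum>i\<in>?I. c i * A j i) / A j p)"
    have split: "(\<Sum>i\<in>I. d i * A j' i) = d p * A j' p + (\<Sum>i\<in>?I. c i * A j' i)" for j'
      unfolding sum.remove[OF insert.prems(1) p(1)] by (auto simp: d_def intro!: sum.cong)
    have "(\<Sum>i\<in>I. d i * A j i) = 0" unfolding split using p by (simp add: d_def)
    moreover have "(\<Sum>i\<in>I. d i * A j' i) = 0" if "j' \<in> J" for j'
    proof -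
      have "(\<Sum>i\<in>?I. c i * B j' i) = (\<Sum>i\<in>?I. c i * A j' i) - (\<Sum>i\<in>?I. c i * A j i) * (A j' p / A j p)"
        unfolding B_def sum_distrib_right sum_subtractf[symmetric]
        by (intro sum.cong) (auto simp: algebra_simps)
      then show ?thesis unfolding split using c(2) that by (simp add: d_def)
    qed
    moreover have "\<exists>i\<in>I. d i \<noteq> 0" using c(1) by (auto simp: d_def)
    ultimately show ?thesis by (intro exI[of _ d]) auto
  qed
qed

section \<open>Algebraic dependence in k[s, t] and the length of its prime chains\<close>

definition bidegree_le :: "nat \<Rightarrow> 'a::comm_ring_1 poly poly \<Rightarrow> bool" where
  "bidegree_le e p \<longleftrightarrow> degree p \<le> e \<and> (\<forall>i. degree (coeff p i) \<le> e)"

lemma bidegree_le_mult: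
  assumes "bidegree_le d p" "bidegree_le e q"
  shows "bidegree_le (d + e) (p * q)"
proof -
  have "degree (coeff p i * coeff q j) \<le> d + e" for i j
    using assms degree_mult_le[of "coeff p i" "coeff q j"] unfolding bidegree_le_def
    by (meson add_mono order_trans)
  then show ?thesis
    using assms degree_mult_le[of p q] unfolding bidegree_le_def coeff_mult
    by (auto intro!: degree_sum_le)
qed

lemma bidegree_le_power: "bidegree_le e p \<Longrightarrow> bidegree_le (n * e) (p ^ n)"
proof (induction n)
  case 0
  show ?case by (simp add: bidegree_le_def flip: one_pCons)
next
  case (Suc n)
  then show ?case using bidegree_le_mult[of e p "n * e" "p ^ n"] by simp
qed

lemma bidegree_le_mono: "bidegree_le d p \<Longrightarrow> d \<le> e \<Longrightarrow> bidegree_le e p"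
  unfolding bidegree_le_def using order_trans by blast

lemma ex_bidegree_le: "\<exists>e. bidegree_le e p"
proof -
  let ?e = "degree p + (\<Sum>i\<le>degree p. degree (coeff p i))"
  have "degree (coeff p i) \<le> ?e" for i
  proof (cases "i \<le> degree p")
    case True
    then show ?thesis using member_le_sum[of i "{..degree p}" "\<lambda>i. degree (coeff p i)"] by simp
  qed (simp add: coeff_eq_0)
  then have "bidegree_le ?e p" by (simp add: bidegree_le_def)
  then show ?thesis by blast
qed

text \<open>There are \<open>N\<^sup>3\<close> unknowns \<open>c i j k\<close>, but only \<open>O(N\<^sup>2)\<close> coefficients to annihilate.\<close>

lemma algebraic_dependence:
  fixes x y z :: "'k::field poly poly"
  shows "\<exists>N c. (\<exists>i<N. \<exists>j<N. \<exists>k<N. c i j k \<noteq> 0) \<and>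
    (\<Sum>i<N. (\<Sum>j<N. (\<Sum>k<N. [:[:c i j k:]:] * z ^ k) * y ^ j) * x ^ i) = 0"
proof -
  obtain e1 e2 e3 where "bidegree_le e1 x" "bidegree_le e2 y" "bidegree_le e3 z"
    using ex_bidegree_le by metis
  then obtain e where e: "bidegree_le e x" "bidegree_le e y" "bidegree_le e z"
    by (metis bidegree_le_mono le_add1 le_add2 trans_le_add1)
  \<comment> \<open>Products of three powers with exponents below \<open>N\<close> have degree at
    most 3 e N in each variable, hence \<open>B\<close> coefficients in each direction. As
    \<open>B\<close> is at most (3 e + 1) N, the number of equations is at most (3 e + 1)^2 N^2, and
    \<open>N\<close> is chosen just large enough to make this less than N^3.\<close>
  define N where "N = (3 * e + 1) ^ 2 + 1"
  define B where "B = 3 * e * N + 1"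
  define I where "I = {..<N} \<times> {..<N} \<times> {..<N}"
  define J where "J = {..<B} \<times> {..<B}"
  define m where "m = (\<lambda>(i, j, k). z ^ k * y ^ j * x ^ i)"
  have "B \<le> (3 * e + 1) * N" unfolding B_def N_def by simp
  then have "B * B \<le> ((3 * e + 1) * N) * ((3 * e + 1) * N)" by (metis mult_le_mono)
  also have "\<dots> = ((3 * e + 1) ^ 2) * N * N" by (simp add: power2_eq_square algebra_simps)
  also have "\<dots> < N * N * N" by (intro mult_strict_right_mono) (auto simp: N_def)
  finally have "card J < card I" by (simp add: I_def J_def)
  then obtain c where c: "\<exists>i\<in>I. c i \<noteq> 0" "\<forall>j\<in>J. (\<Sum>i\<in>I. c i * coeff (coeff (m i) (fst j)) (snd j)) = 0"
    using homogeneous_system[of J I "\<lambda>j i. coeff (coeff (m i) (fst j)) (snd j)"]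
    by (auto simp: I_def J_def)
  have bd: "bidegree_le (3 * e * N) (m i)" if i: "i \<in> I" for i
  proof -
    obtain i1 i2 i3 where ii: "i = (i1, i2, i3)" "i1 < N" "i2 < N" "i3 < N" using i by (auto simp: I_def)
    have "bidegree_le (i3 * e + i2 * e + i1 * e) (m i)"
      unfolding m_def ii by (simp add: bidegree_le_mult bidegree_le_power e)
    moreover have "i3 * e + i2 * e + i1 * e \<le> N * e + N * e + N * e"
      using ii by (intro add_mono mult_right_mono) auto
    then have "i3 * e + i2 * e + i1 * e \<le> 3 * e * N" by (simp add: algebra_simps)
    ultimately show ?thesis by (rule bidegree_le_mono)
  qed
  have "(\<Sum>i\<in>I. [:[:c i:]:] * m i) = 0"
  proof (intro poly_eqI)
    fix a b
    have "coeff (coeff (\<Sum>i\<in>I. [:[:c i:]:] * m i) a) b = (\<Sum>i\<in>I. c i * coeff (coeff (m i) a) b)"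
      by (simp add: coeff_sum)
    also have "\<dots> = 0"
    proof (cases "a < B \<and> b < B")
      case True
      then show ?thesis using c(2) by (auto simp: J_def)
    next
      case False
      have "coeff (coeff (m i) a) b = 0" if "i \<in> I" for i
      proof (cases "a < B")
        case True
        then have "degree (coeff (m i) a) < b"
          using bd[OF that] False unfolding bidegree_le_def B_def
          by (metis Suc_eq_plus1 less_Suc_eq_le not_less_eq order_le_less_trans)
        then show ?thesis by (rule coeff_eq_0)
      next
        case False
        then have "degree (m i) < a" using bd[OF that] unfolding bidegree_le_def B_def by simp
        then show ?thesis by (simp add: coeff_eq_0)
      qed
      then show ?thesis by simp
    qed
    finally show "coeff (coeff (\<Sum>i\<in>I. [:[:c i:]:] * m i) a) b = coeff (coeff 0 a) b" by simp
  qed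
  then have rel: "(\<Sum>i<N. (\<Sum>j<N. (\<Sum>k<N. [:[:c (i, j, k):]:] * z ^ k) * y ^ j) * x ^ i) = 0"
  proof -
    assume "(\<Sum>i\<in>I. [:[:c i:]:] * m i) = 0"
    moreover have "(\<Sum>i\<in>I. [:[:c i:]:] * m i) =
        (\<Sum>i<N. \<Sum>j<N. \<Sum>k<N. [:[:c (i, j, k):]:] * (z ^ k * y ^ j * x ^ i))"
      by (simp add: I_def m_def sum.cartesian_product case_prod_unfold del: mult_pCons_left)
    ultimately show "(\<Sum>i<N. (\<Sum>j<N. (\<Sum>k<N. [:[:c (i, j, k):]:] * z ^ k) * y ^ j) * x ^ i) = 0"
      by (simp add: sum_distrib_right mult.assoc del: mult_pCons_left)
  qed
  moreover have "\<exists>i<N. \<exists>j<N. \<exists>k<N. c (i, j, k) \<noteq> 0" using c(1) by (auto simp: I_def)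
  ultimately show ?thesis by (intro exI[of _ N] exI[of _ "\<lambda>i j k. c (i, j, k)"]) blast
qed

text \<open>The sum is \<open>x ^ n\<close> times a cofactor. Since \<open>x\<close> is not in the
  prime \<open>P\<close>, the cofactor is in \<open>P\<close> and so in \<open>Q\<close>; it equals
  \<open>u n\<close> plus a multiple of \<open>x\<close>, which is in \<open>Q\<close> as
  well.\<close>

lemma lowest_coefficient_mem:
  fixes x :: "'a::comm_ring_1"
  assumes P: "primeideal P type_ring" and x: "x \<notin> P"
    and Q: "ideal Q type_ring" "P \<subseteq> Q" "x \<in> Q"
    and sum: "(\<Sum>i<N. u i * x ^ i) \<in> P" and low: "n < N" "\<And>i. i < n \<Longrightarrow> u i = 0"
  shows "u n \<in> Q"
proof -
  have "(\<Sum>i<N. u i * x ^ i) = (\<Sum>i=n..<N. u i * x ^ i)"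
    using low by (intro sum.mono_neutral_right) auto
  also have "\<dots> = x ^ n * (\<Sum>i=n..<N. u i * x ^ (i - n))"
    unfolding sum_distrib_left by (intro sum.cong) (auto simp: algebra_simps simp flip: power_add)
  finally have "x ^ n * (\<Sum>i=n..<N. u i * x ^ (i - n)) \<in> P" using sum by simp
  moreover have "x ^ n \<notin> P" using x by (induction n) (auto simp: type_prime_mult_iff[OF P] type_prime_one[OF P])
  ultimately have "(\<Sum>i=n..<N. u i * x ^ (i - n)) \<in> Q" using type_prime_mult_iff[OF P] Q by blast
  moreover have "(\<Sum>i=n..<N. u i * x ^ (i - n)) = u n + x * (\<Sum>i=Suc n..<N. u i * x ^ (i - Suc n))"
  proof -
    have "x * (\<Sum>i=Suc n..<N. u i * x ^ (i - Suc n)) = (\<Sum>i=Suc n..<N. u i * x ^ (i - n))"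
      unfolding sum_distrib_left
    proof (intro sum.cong refl)
      fix i assume "i \<in> {Suc n..<N}"
      then have "i - n = Suc (i - Suc n)" by auto
      then show "x * (u i * x ^ (i - Suc n)) = u i * x ^ (i - n)"
        by (simp only: power_Suc mult.left_commute)
    qed
    then show ?thesis using low(1) by (simp add: sum.atLeast_Suc_lessThan)
  qed
  ultimately have "u n + x * (\<Sum>i=Suc n..<N. u i * x ^ (i - Suc n)) \<in> Q" by simp
  from type_ideal_diff[OF Q(1) this type_ideal_mult_right[OF Q(1,3), of "\<Sum>i=Suc n..<N. u i * x ^ (i - Suc n)"]]
  show ?thesis by simp
qed

lemma ex_least_below: "\<exists>i<N::nat. Q i \<Longrightarrow> \<exists>i<N. Q i \<and> (\<forall>j<i. \<not> Q j)"
  by (metis exists_least_iff linorder_neqE_nat order_less_trans)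

text \<open>
  For \<open>x\<close>, \<open>y\<close>, \<open>z\<close> new in the successive primes, the lexicographically lowest nonzero
  coefficient of a relation between them is a unit in the last prime.
\<close>

lemma no_long_prime_chain:
  assumes P: "\<And>i. i \<le> 3 \<Longrightarrow> primeideal (P i) (type_ring :: 'k::field poly poly ring)"
  shows "\<exists>i\<le>2. \<not> P i \<subset> P (Suc i)"
proof (rule ccontr)
  assume "\<not> ?thesis"
  then have sub: "P i \<subset> P (Suc i)" if "i \<le> 2" for i using that by blast
  have s: "P 0 \<subset> P 1" "P 1 \<subset> P 2" "P 2 \<subset> P 3" using sub[of 0] sub[of 1] sub[of 2] by (auto simp: eval_nat_numeral)
  then obtain x y z where xyz: "x \<in> P 1" "x \<notin> P 0" "y \<in> P 2" "y \<notin> P 1" "z \<in> P 3" "z \<notin> P 2" by blast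
  have id: "ideal (P i) type_ring" if "i \<le> 3" for i using type_prime_ideal P that by blast
  obtain N c where c: "\<exists>i<N. \<exists>j<N. \<exists>k<N. c i j k \<noteq> 0"
    "(\<Sum>i<N. (\<Sum>j<N. (\<Sum>k<N. [:[:c i j k:]:] * z ^ k) * y ^ j) * x ^ i) = 0"
    using algebraic_dependence[of z y x] by blast
  define v where "v i j = (\<Sum>k<N. [:[:c i j k:]:] * z ^ k)" for i j
  define u where "u i = (\<Sum>j<N. v i j * y ^ j)" for i
  obtain i where i: "i < N" "\<exists>j<N. \<exists>k<N. c i j k \<noteq> 0" "\<And>i'. i' < i \<Longrightarrow> \<not> (\<exists>j<N. \<exists>k<N. c i' j k \<noteq> 0)"
    using ex_least_below[OF c(1)] by blast
  obtain j where j: "j < N" "\<exists>k<N. c i j k \<noteq> 0" "\<And>j'. j' < j \<Longrightarrow> \<not> (\<exists>k<N. c i j' k \<noteq> 0)"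
    using ex_least_below[OF i(2)] by blast
  obtain k where k: "k < N" "c i j k \<noteq> 0" "\<And>k'. k' < k \<Longrightarrow> \<not> c i j k' \<noteq> 0"
    using ex_least_below[OF j(2)] by blast
  have "u i' = 0" if "i' < i" for i'
    using i(3)[OF that] by (simp add: u_def v_def)
  moreover have "(\<Sum>i<N. u i * x ^ i) \<in> P 0"
    using c(2) type_ideal_zero[OF id[of 0]] by (simp add: u_def v_def)
  ultimately have "u i \<in> P 1"
    using lowest_coefficient_mem[of "P 0" x "P 1" u N i] P id s xyz i by force
  then have "(\<Sum>j<N. v i j * y ^ j) \<in> P 1" by (simp add: u_def)
  moreover have "v i j' = 0" if "j' < j" for j' using j(3)[OF that] by (simp add: v_def)
  ultimately have "v i j \<in> P 2"
    using lowest_coefficient_mem[of "P 1" y "P 2" "v i" N j] P id s xyz j by force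
  then have "(\<Sum>k<N. [:[:c i j k:]:] * z ^ k) \<in> P 2" by (simp add: v_def)
  then have "[:[:c i j k:]:] \<in> P 3"
    using lowest_coefficient_mem[of "P 2" z "P 3" "\<lambda>k. [:[:c i j k:]:]" N k] P id s xyz k by force
  from type_ideal_mult[OF id this, of "[:[:inverse (c i j k):]:]"]
  have "1 \<in> P 3" using k(2) by (simp add: one_pCons)
  then show False using type_prime_one P by blast
qed

text \<open>
  A Nullstellensatz for two variables: for \<open>g\<close> of least \<open>t\<close>-degree in \<open>n\<close> with leading
  coefficient \<open>c(s)\<close>, all denominators modulo \<open>n\<close> are powers of \<open>c\<close>, so that the
  element \<open>1 + s c(s)\<close> could not be invertible modulo \<open>n\<close>.
\<close>

lemma maximal_contains_const:
  fixes n :: "'k::field poly poly set"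
  assumes n: "ideal n type_ring" "1 \<notin> n" and max: "\<And>q. q \<notin> n \<Longrightarrow> \<exists>a. 1 - a * q \<in> n"
  shows "\<exists>f. f \<noteq> 0 \<and> [:f:] \<in> n"
proof (rule ccontr)
  assume "\<not> ?thesis"
  then have no: "[:f:] \<notin> n" if "f \<noteq> 0" for f using that by blast
  \<comment> \<open>An inverse of s modulo \<open>n\<close> exhibits a nonzero element of
    \<open>n\<close>: 1 - a s has value 1 at the origin.\<close>
  have "[:[:0, 1:]:] \<notin> n" using no[of "[:0, 1:]"] by simp
  then obtain a where a: "1 - a * [:[:0, 1:]:] \<in> n" using max by blast
  have "poly (poly (1 - a * [:[:0, 1:]:]) 0) 0 \<noteq> 0" by simp
  then have "1 - a * [:[:0, 1:]:] \<noteq> 0" by (metis poly_0)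
  then obtain g where g: "g \<in> n" "g \<noteq> 0" and min: "\<And>r. r \<in> n \<Longrightarrow> r \<noteq> 0 \<Longrightarrow> degree g \<le> degree r"
    using a ex_has_least_nat[of "\<lambda>g. g \<in> n \<and> g \<noteq> 0" _ degree] by metis
  define c where "c = lead_coeff g"
  have c: "c \<noteq> 0" using g by (simp add: c_def)
  define q where "q = 1 + pCons 0 c"
  have "degree g > 0" using no[of "coeff g 0"] g by (metis degree_eq_zeroE coeff_pCons_0 gr0I pCons_0_0)
  have "coeff q 0 = 1" by (simp add: q_def)
  then have "q \<noteq> 0" by auto
  then obtain b where b: "1 - b * [:q:] \<in> n" using max no by blast
  obtain e r where er: "pseudo_divmod b g = (e, r)" by fastforce
  define k where "k = Suc (degree b) - degree g"
  have div: "smult (c ^ k) b = g * e + r" "r = 0 \<or> degree r < degree g"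
    using pseudo_divmod[OF g(2) er] by (auto simp: c_def k_def)
  \<comment> \<open>Pseudo-division replaces \<open>c ^ k\<close> times the inverse \<open>b\<close>
    of \<open>q\<close> by a remainder \<open>r\<close> of smaller t-degree than \<open>g\<close>.
    The resulting element of \<open>n\<close> must vanish by the choice of \<open>g\<close>, and its
    constant coefficient shows that \<open>q\<close> divides \<open>c ^ k\<close>.\<close>
  have "[:c ^ k:] * (1 - b * [:q:]) + (g * e) * [:q:] \<in> n"
    using type_ideal_add[OF n(1) type_ideal_mult[OF n(1) b] type_ideal_mult_right[OF n(1) type_ideal_mult_right[OF n(1) g(1)]]] .
  also have "[:c ^ k:] * (1 - b * [:q:]) + (g * e) * [:q:] = [:c ^ k:] - smult q r"
  proof -
    have "[:c ^ k:] * b = g * e + r" using div(1) by simp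
    moreover have "[:c ^ k:] * (1 - b * [:q:]) = [:c ^ k:] - ([:c ^ k:] * b) * [:q:]"
      by (simp only: right_diff_distrib mult_1_right mult.assoc)
    ultimately have "[:c ^ k:] * (1 - b * [:q:]) = [:c ^ k:] - (g * e + r) * [:q:]" by (simp only:)
    then show ?thesis by (simp add: algebra_simps)
  qed
  finally have mem: "[:c ^ k:] - smult q r \<in> n" .
  have "degree ([:c ^ k:] - smult q r) < degree g"
    using div(2) \<open>degree g > 0\<close> by (intro degree_diff_less) (auto intro: le_less_trans[OF degree_smult_le])
  then have "[:c ^ k:] - smult q r = 0" using min[OF mem] by force
  then have "coeff [:c ^ k:] 0 = coeff (smult q r) 0" by simp
  then have "q dvd c ^ k" by simp
  \<comment> \<open>Since s c = q - 1 and (q - 1)^k is (-1)^k modulo \<open>q\<close>, divisibility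
    makes \<open>q\<close> a unit, although its degree is one more than that of
    \<open>c\<close>.\<close>
  then have "q dvd [:0, 1:] ^ k * c ^ k" by simp
  also have "[:0, 1:] ^ k * c ^ k = (q - 1) ^ k" by (simp add: q_def flip: power_mult_distrib)
  finally have d: "q dvd (q - 1) ^ k" .
  have "(q - 1) - (- 1) dvd (q - 1) ^ k - (- 1) ^ k"
    by (metis dvd_triv_left power_diff_sumr2)
  then have "q dvd (q - 1) ^ k - (- 1) ^ k" by simp
  with d have "q dvd (- 1) ^ k" by (metis dvd_diff_right_iff dvd_diff_commute)
  moreover have "(- 1) ^ k dvd (1 :: 'k poly)" by (metis dvd_minus_iff dvd_power_same minus_dvd_iff one_dvd power_one)
  ultimately have "is_unit q" by (rule dvd_trans)
  then have "degree q = 0" by (simp add: is_unit_iff_degree \<open>q \<noteq> 0\<close>)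
  moreover have "coeff q (Suc (degree c)) \<noteq> 0" using c by (simp add: q_def)
  ultimately show False by (metis coeff_eq_0 zero_less_Suc)
qed

text \<open>The copy g(t) of g in the outer variable, as opposed to g(s), which is
  \<open>[:g:]\<close>.\<close>

abbreviation const_coeffs :: "'k::field poly \<Rightarrow> 'k poly poly" where
  "const_coeffs \<equiv> map_poly (\<lambda>c. [:c:])"

text \<open>The idea of Gauss's lemma: take the highest coefficient of \<open>a\<close> that
  \<open>f\<close> does not divide. In the product it meets the leading coefficient of
  \<open>g\<close>, a nonzero scalar, and all other contributions to that power of t are divisible
  by \<open>f\<close> or zero.\<close>

lemma const_dvd_cancel:
  assumes "g \<noteq> 0" "[:f:] dvd const_coeffs g * a"
  shows "[:f:] dvd a"
proof (rule ccontr)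
  assume "\<not> [:f:] dvd a"
  then obtain i0 where i0: "\<not> f dvd coeff a i0" by (auto simp: const_poly_dvd_iff)
  have bound: "i \<le> degree a" if "\<not> f dvd coeff a i" for i using that by (intro le_degree) auto
  obtain i where i: "\<not> f dvd coeff a i" "\<And>j. j > i \<Longrightarrow> f dvd coeff a j"
    using Max_in[of "{i. \<not> f dvd coeff a i}"] Max_ge[of "{i. \<not> f dvd coeff a i}"] i0 bound
      finite_subset[of "{i. \<not> f dvd coeff a i}" "{..degree a}"]
    by (metis (mono_tags, lifting) atMost_iff empty_Collect_eq finite_atMost leD mem_Collect_eq subsetI)
  let ?G = "const_coeffs g"
  have G: "coeff ?G j = [:coeff g j:]" for j by (simp add: coeff_map_poly)
  have "f dvd coeff (?G * a) (degree g + i)" using assms(2) by (simp add: const_poly_dvd_iff)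
  also have "coeff (?G * a) (degree g + i) =
      coeff ?G (degree g) * coeff a i + (\<Sum>j\<in>{..degree g + i} - {degree g}. coeff ?G j * coeff a (degree g + i - j))"
    unfolding coeff_mult by (subst sum.remove[of _ "degree g"]) auto
  finally have "f dvd coeff ?G (degree g) * coeff a i + (\<Sum>j\<in>{..degree g + i} - {degree g}. coeff ?G j * coeff a (degree g + i - j))" .
  moreover have "f dvd coeff ?G j * coeff a (degree g + i - j)" if "j \<in> {..degree g + i} - {degree g}" for j
  proof (cases "j < degree g")
    case True
    then show ?thesis using i(2)[of "degree g + i - j"] by simp
  next
    case False
    then have "coeff g j = 0" using that by (intro coeff_eq_0) auto
    then show ?thesis by (simp add: G)
  qed
  then have "f dvd (\<Sum>j\<in>{..degree g + i} - {degree g}. coeff ?G j * coeff a (degree g + i - j))" by (rule dvd_sum)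
  ultimately have "f dvd smult (lead_coeff g) (coeff a i)" by (simp add: dvd_add_left_iff G)
  then show False using i(1) assms(1) by (simp add: dvd_smult_iff)
qed

section \<open>Evaluation homomorphisms\<close>

locale type_ring_hom =
  fixes h :: "'a::comm_ring_1 \<Rightarrow> 'b::comm_ring_1"
  assumes one [simp]: "h 1 = 1"
    and add: "h (a + b) = h a + h b"
    and mult: "h (a * b) = h a * h b"
begin

lemma zero [simp]: "h 0 = 0"
  using add[of 0 0] by simp

lemma uminus: "h (- a) = - h a"
  using add[of a "- a"] by (simp add: eq_neg_iff_add_eq_0 add.commute)

lemma diff: "h (a - b) = h a - h b"
  using add[of a "- b"] by (simp add: uminus)

lemma sum: "h (sum f A) = (\<Sum>x\<in>A. h (f x))"
  by (induction A rule: infinite_finite_induct) (simp_all add: add)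

lemma ideal_vimage: "ideal J type_ring \<Longrightarrow> ideal {a. h a \<in> J} type_ring"
  by (intro type_idealI)
     (auto simp: add mult type_ideal_zero intro: type_ideal_add type_ideal_mult)

lemma prime_vimage:
  assumes "primeideal P type_ring"
  shows "primeideal {a. h a \<in> P} type_ring"
  using type_prime_one[OF assms] type_prime_mult_iff[OF assms]
  by (intro type_primeI ideal_vimage type_prime_ideal[OF assms]) (auto simp: mult)

end

lemma type_ring_hom_comp: "type_ring_hom f \<Longrightarrow> type_ring_hom g \<Longrightarrow> type_ring_hom (\<lambda>x. g (f x))"
  unfolding type_ring_hom_def by simp

lemma type_ring_hom_poly:
  assumes "type_ring_hom C"
  shows "type_ring_hom (\<lambda>p. poly (map_poly C p) y)"
proof -
  interpret C: type_ring_hom C by fact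
  have add: "map_poly C (p + q) = map_poly C p + map_poly C q" for p q
    by (rule poly_eqI) (simp add: coeff_map_poly C.add)
  have smult: "map_poly C (smult a p) = smult (C a) (map_poly C p)" for a p
    by (rule poly_eqI) (simp add: coeff_map_poly C.mult)
  have mult: "map_poly C (p * q) = map_poly C p * map_poly C q" for p q
    by (induction p) (simp_all add: add smult map_poly_pCons)
  show ?thesis by unfold_locales (simp_all add: add mult)
qed

text \<open>Substitution of \<open>l\<close> for the inner variable s and \<open>m\<close> for the
  outer variable t; scalars enter through \<open>C\<close>.\<close>

definition bieval :: "('k::comm_ring_1 \<Rightarrow> 'a::comm_ring_1) \<Rightarrow> 'a \<Rightarrow> 'a \<Rightarrow> 'k poly poly \<Rightarrow> 'a" where
  "bieval C l m g = poly (map_poly (\<lambda>c. poly (map_poly C c) l) g) m"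

lemma type_ring_hom_bieval: "type_ring_hom C \<Longrightarrow> type_ring_hom (bieval C l m)"
  unfolding bieval_def[abs_def] by (intro type_ring_hom_poly)

lemma bieval_simps:
  assumes "type_ring_hom C"
  shows "bieval C l m [:[:c:]:] = C c" "bieval C l m [:[:0, 1:]:] = l" "bieval C l m [:0, 1:] = m"
proof -
  interpret C: type_ring_hom C by fact
  show "bieval C l m [:[:c:]:] = C c" "bieval C l m [:[:0, 1:]:] = l" "bieval C l m [:0, 1:] = m"
    by (simp_all add: bieval_def map_poly_pCons)
qed

lemma bieval_const:
  assumes "type_ring_hom C"
  shows "bieval C l m [:f:] = poly (map_poly C f) l"
proof -
  interpret C: type_ring_hom C by fact
  show ?thesis by (simp add: bieval_def map_poly_pCons)
qed

text \<open>The constants and the two variables generate k[s, t]. This identifies composite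
  substitutions with the identity without expanding polynomials.\<close>

lemma bivariate_hom_eqI:
  fixes f g :: "'k::comm_ring_1 poly poly \<Rightarrow> 'a::comm_ring_1"
  assumes "type_ring_hom f" "type_ring_hom g"
    and const: "\<And>c. f [:[:c:]:] = g [:[:c:]:]"
    and X: "f [:[:0, 1:]:] = g [:[:0, 1:]:]" and Y: "f [:0, 1:] = g [:0, 1:]"
  shows "f p = g p"
proof -
  interpret f: type_ring_hom f by fact
  interpret g: type_ring_hom g by fact
  have inner: "f [:p:] = g [:p:]" for p
  proof (induction p)
    case (pCons a p)
    have "[:pCons a p:] = [:[:a:]:] + [:[:0, 1:]:] * [:p:]" by simp
    then show ?case using pCons by (simp only: f.add f.mult g.add g.mult const X)
  qed simp
  show ?thesis
  proof (induction p)
    case (pCons a p)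
    have "pCons a p = [:a:] + [:0, 1:] * p" by simp
    then show ?case using pCons by (simp only: f.add f.mult g.add g.mult inner Y)
  qed simp
qed

lemma type_ring_hom_const2: "type_ring_hom (\<lambda>c. [:[:c:]:])"
  by unfold_locales (simp_all add: one_pCons)

lemma poly_const2_Y: "poly (map_poly (\<lambda>c. [:[:c:]:]) f) [:0, 1:] = const_coeffs f"
  by (induction f) (simp_all add: map_poly_pCons)

text \<open>The one-variable statement yields only an f(s). Applied to the preimage of
  \<open>n\<close> under the involution \<open>\<tau>\<close> that exchanges s and t, it also yields
  a g(t).\<close>

lemma maximal_contains_both:
  fixes n :: "'k::field poly poly set"
  assumes n: "ideal n type_ring" "1 \<notin> n" and max: "\<And>q. q \<notin> n \<Longrightarrow> \<exists>a. 1 - a * q \<in> n"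
  shows "\<exists>f g. f \<noteq> 0 \<and> g \<noteq> 0 \<and> [:f:] \<in> n \<and> const_coeffs g \<in> n"
proof -
  define \<tau> :: "'k poly poly \<Rightarrow> 'k poly poly" where "\<tau> = bieval (\<lambda>c. [:[:c:]:]) [:0, 1:] [:[:0, 1:]:]"
  interpret \<tau>: type_ring_hom \<tau> unfolding \<tau>_def by (intro type_ring_hom_bieval type_ring_hom_const2)
  have \<tau>_simps: "\<tau> [:[:c:]:] = [:[:c:]:]" "\<tau> [:[:0, 1:]:] = [:0, 1:]" "\<tau> [:0, 1:] = [:[:0, 1:]:]" for c
    unfolding \<tau>_def by (rule bieval_simps[OF type_ring_hom_const2])+
  have "type_ring_hom (\<lambda>p :: 'k poly poly. p)" by unfold_locales auto
  then have inv: "\<tau> (\<tau> p) = p" for p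
    by (rule bivariate_hom_eqI[OF type_ring_hom_comp[OF \<tau>.type_ring_hom_axioms \<tau>.type_ring_hom_axioms]])
       (simp_all only: \<tau>_simps)
  let ?n = "{a. \<tau> a \<in> n}"
  have "\<exists>a. 1 - a * q \<in> ?n" if q: "q \<notin> ?n" for q
  proof -
    obtain a where "1 - a * \<tau> q \<in> n" using max[of "\<tau> q"] q by auto
    then have "1 - \<tau> a * q \<in> ?n" by (simp add: \<tau>.diff \<tau>.mult inv)
    then show ?thesis by blast
  qed
  then obtain g where g: "g \<noteq> 0" "\<tau> [:g:] \<in> n"
    using maximal_contains_const[OF \<tau>.ideal_vimage[OF n(1)]] n(2) by auto
  have "\<tau> [:g:] = const_coeffs g"
    unfolding \<tau>_def by (simp only: bieval_const[OF type_ring_hom_const2] poly_const2_Y)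
  then show ?thesis using maximal_contains_const[OF n max] g by metis
qed

section \<open>Evaluation of polynomials in finitely many variables\<close>

definition monom_val :: "('v::finite \<Rightarrow> 'a::comm_ring_1) \<Rightarrow> ('v \<Rightarrow>\<^sub>0 nat) \<Rightarrow> 'a" where
  "monom_val x e = (\<Prod>v\<in>UNIV. x v ^ Poly_Mapping.lookup e v)"

lemma monom_val_add: "monom_val x (d + e) = monom_val x d * monom_val x e"
  by (simp add: monom_val_def lookup_add power_add prod.distrib)

lemma monom_val_zero [simp]: "monom_val x 0 = 1"
  by (simp add: monom_val_def)

lemma monom_val_single: "monom_val x (Poly_Mapping.single v n) = x v ^ n"
proof -
  have "monom_val x (Poly_Mapping.single v n) = (\<Prod>w\<in>UNIV. if w = v then x v ^ n else 1)"
    unfolding monom_val_def by (intro prod.cong) (auto simp: lookup_single when_def)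
  then show ?thesis by simp
qed

definition pm_eval :: "('k::comm_ring_1 \<Rightarrow> 'a::comm_ring_1) \<Rightarrow> ('v::finite \<Rightarrow> 'a) \<Rightarrow> (('v \<Rightarrow>\<^sub>0 nat) \<Rightarrow>\<^sub>0 'k) \<Rightarrow> 'a" where
  "pm_eval C x f = (\<Sum>e\<in>Poly_Mapping.keys f. C (Poly_Mapping.lookup f e) * monom_val x e)"

lemma pm_eval_superset:
  assumes "type_ring_hom C" "finite A" "Poly_Mapping.keys f \<subseteq> A"
  shows "pm_eval C x f = (\<Sum>e\<in>A. C (Poly_Mapping.lookup f e) * monom_val x e)"
proof -
  interpret C: type_ring_hom C by fact
  show ?thesis unfolding pm_eval_def
    using assms by (intro sum.mono_neutral_left) (auto simp: in_keys_iff)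
qed

lemma pm_eval_single:
  assumes "type_ring_hom C"
  shows "pm_eval C x (Poly_Mapping.single e c) = C c * monom_val x e"
  using pm_eval_superset[OF assms, of "{e}" "Poly_Mapping.single e c" x] by simp

lemma type_ring_hom_pm_eval:
  assumes "type_ring_hom C"
  shows "type_ring_hom (pm_eval C x)"
proof -
  interpret C: type_ring_hom C by fact
  have add: "pm_eval C x (f + g) = pm_eval C x f + pm_eval C x g" for f g
  proof -
    let ?A = "Poly_Mapping.keys f \<union> Poly_Mapping.keys g"
    have "Poly_Mapping.keys (f + g) \<subseteq> ?A" by (rule keys_add)
    then show ?thesis
      using pm_eval_superset[OF assms, of ?A]
      by (simp add: lookup_add C.add distrib_right sum.distrib)
  qed
  have sum: "pm_eval C x (sum f A) = (\<Sum>a\<in>A. pm_eval C x (f a))" for f :: "'e \<Rightarrow> _" and A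
    by (induction A rule: infinite_finite_induct) (simp_all add: add pm_eval_def[of C x 0])
  note single = pm_eval_single[OF assms]
  have "pm_eval C x (f * g) = pm_eval C x f * pm_eval C x g" for f g
  proof -
    let ?s = "\<lambda>f e. Poly_Mapping.single e (Poly_Mapping.lookup f e)"
    have "f * g = (\<Sum>d\<in>Poly_Mapping.keys f. \<Sum>e\<in>Poly_Mapping.keys g. ?s f d * ?s g e)"
      by (subst poly_mapping_sum_single[of f], subst poly_mapping_sum_single[of g]) (rule sum_product)
    then have "pm_eval C x (f * g) =
        (\<Sum>d\<in>Poly_Mapping.keys f. \<Sum>e\<in>Poly_Mapping.keys g. pm_eval C x (?s f d) * pm_eval C x (?s g e))"
      by (simp add: sum mult_single single C.mult monom_val_add mult.assoc mult.left_commute)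
    also have "\<dots> = pm_eval C x f * pm_eval C x g"
      unfolding single pm_eval_def[of C x f] pm_eval_def[of C x g] by (rule sum_product[symmetric])
    finally show ?thesis .
  qed
  then show ?thesis
    using add single[of x 0 1] by unfold_locales simp_all
qed

text \<open>
  \<open>\<psi> u v f\<close> is \<open>f(s u, t v) \<in> k[s, t]\<close>, with \<open>s\<close> the inner and \<open>t\<close> the outer variable.
\<close>

definition \<psi> :: "('m::finite \<Rightarrow> 'k::field) \<Rightarrow> ('n::finite \<Rightarrow> 'k) \<Rightarrow> ('m, 'n, 'k) bipoly \<Rightarrow> 'k poly poly" where
  "\<psi> u v = pm_eval (\<lambda>c. [:[:c:]:]) (case_sum (\<lambda>i. monom (monom (u i) 1) 0) (\<lambda>j. monom (monom (v j) 0) 1))"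

definition deg1 :: "(('m::finite + 'n::finite) \<Rightarrow>\<^sub>0 nat) \<Rightarrow> nat" where
  "deg1 e = (\<Sum>i\<in>UNIV. Poly_Mapping.lookup e (Inl i))"

definition deg2 :: "(('m::finite + 'n::finite) \<Rightarrow>\<^sub>0 nat) \<Rightarrow> nat" where
  "deg2 e = (\<Sum>j\<in>UNIV. Poly_Mapping.lookup e (Inr j))"

interpretation \<psi>: type_ring_hom "\<psi> u v" for u v
  unfolding \<psi>_def by (intro type_ring_hom_pm_eval type_ring_hom_const2)

lemma monom_val_sum:
  "monom_val (case_sum u v) e = (\<Prod>i\<in>UNIV. u i ^ Poly_Mapping.lookup e (Inl i)) * (\<Prod>j\<in>UNIV. v j ^ Poly_Mapping.lookup e (Inr j))"
  unfolding monom_val_def UNIV_Plus_UNIV[symmetric] by (subst prod.Plus) simp_all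

lemma prod_monom_power:
  "(\<Prod>i\<in>A. monom (monom (u i) a) b ^ n i) = monom (monom (\<Prod>i\<in>A. u i ^ n i) (a * sum n A)) (b * sum n A)"
  if "finite A" for u :: "'i \<Rightarrow> 'k::field"
  using that by induction (simp_all add: monom_power mult_monom algebra_simps monom_0 one_pCons)

lemma \<psi>_single:
  "\<psi> u v (Poly_Mapping.single e c) = monom (monom (c * monom_val (case_sum u v) e) (deg1 e)) (deg2 e)"
proof -
  have c: "[:[:c:]:] = monom (monom c 0) 0" by (simp add: monom_0)
  show ?thesis
    unfolding \<psi>_def pm_eval_single[OF type_ring_hom_const2] monom_val_sum
    by (simp add: prod_monom_power mult_monom c deg1_def deg2_def)
qed

lemma \<psi>_altdef:
  "\<psi> u v f = (\<Sum>e\<in>Poly_Mapping.keys f.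
     monom (monom (Poly_Mapping.lookup f e * monom_val (case_sum u v) e) (deg1 e)) (deg2 e))"
proof -
  have "\<psi> u v f = \<psi> u v (\<Sum>e\<in>Poly_Mapping.keys f. Poly_Mapping.single e (Poly_Mapping.lookup f e))"
    by (simp flip: poly_mapping_sum_single)
  then show ?thesis by (simp only: \<psi>.sum \<psi>_single)
qed

lemma eval_bipoly_altdef:
  "eval_bipoly f u v = (\<Sum>e\<in>Poly_Mapping.keys f. Poly_Mapping.lookup f e * monom_val (case_sum u v) e)"
  by (simp add: eval_bipoly_def monom_val_sum)

section \<open>Bihomogeneous components and the ideal of a set of points\<close>

definition component :: "nat \<times> nat \<Rightarrow> ('m::finite, 'n::finite, 'k::field) bipoly \<Rightarrow> ('m, 'n, 'k) bipoly" where
  "component d f = (\<Sum>e\<in>{e \<in> Poly_Mapping.keys f. (deg1 e, deg2 e) = d}. Poly_Mapping.single e (Poly_Mapping.lookup f e))"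

lemma lookup_component:
  "Poly_Mapping.lookup (component d f) e = (if (deg1 e, deg2 e) = d then Poly_Mapping.lookup f e else 0)"
  by (auto simp: component_def lookup_sum lookup_single when_def in_keys_iff)

lemma keys_component:
  "Poly_Mapping.keys (component d f) = {e \<in> Poly_Mapping.keys f. (deg1 e, deg2 e) = d}"
  by (auto simp: in_keys_iff lookup_component split: if_splits)

lemma bihomogeneous_component: "bihomogeneous (component d f)"
  unfolding bihomogeneous_def bihomogeneous_of_degree_def keys_component
  by (auto simp: deg1_def deg2_def)

lemma sum_components:
  "f = (\<Sum>d\<in>(\<lambda>e. (deg1 e, deg2 e)) ` Poly_Mapping.keys f. component d f)"
  by (rule poly_mapping_eqI) (auto simp: lookup_sum lookup_component image_iff in_keys_iff)

text \<open>The parameters s and t record the bidegree, so \<open>\<psi> u v f\<close> vanishes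
  exactly when every bihomogeneous component of \<open>f\<close> vanishes at (u, v). Plain
  evaluation could not tell components apart.\<close>

lemma coeff_\<psi>: "coeff (coeff (\<psi> u v f) b) a = eval_bipoly (component (a, b) f) u v"
proof -
  have "coeff (coeff (\<psi> u v f) b) a =
      (\<Sum>e\<in>Poly_Mapping.keys f. if (deg1 e, deg2 e) = (a, b) then Poly_Mapping.lookup f e * monom_val (case_sum u v) e else 0)"
    unfolding \<psi>_altdef coeff_sum by (intro sum.cong) auto
  then show ?thesis
    by (simp add: eval_bipoly_altdef keys_component lookup_component sum.If_cases Int_def)
qed

lemma \<psi>_bihomogeneous:
  assumes "bihomogeneous_of_degree (a, b) f"
  shows "\<psi> u v f = monom (monom (eval_bipoly f u v) a) b"
proof -
  have "deg1 e = a \<and> deg2 e = b" if "e \<in> Poly_Mapping.keys f" for e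
    using assms that by (auto simp: bihomogeneous_of_degree_def deg1_def deg2_def)
  then show ?thesis
    by (simp add: \<psi>_altdef eval_bipoly_altdef flip: monom_sum)
qed

lemma monom_val_scale:
  "monom_val (case_sum (\<lambda>i. c * u i) (\<lambda>j. d * v j)) e = c ^ deg1 e * d ^ deg2 e * monom_val (case_sum u v) e"
  unfolding monom_val_sum by (simp add: power_mult_distrib prod.distrib deg1_def deg2_def power_sum)

lemma \<psi>_scale_eq_0:
  assumes "bihomogeneous f" "\<psi> u v f = 0"
  shows "eval_bipoly f (\<lambda>i. c * u i) (\<lambda>j. d * v j) = 0"
proof -
  obtain a b where ab: "bihomogeneous_of_degree (a, b) f" using assms(1) by (auto simp: bihomogeneous_def)
  have "eval_bipoly f u v = 0" using assms(2) \<psi>_bihomogeneous[OF ab] by simp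
  moreover have "eval_bipoly f (\<lambda>i. c * u i) (\<lambda>j. d * v j) = c ^ a * d ^ b * eval_bipoly f u v"
    unfolding eval_bipoly_altdef sum_distrib_left monom_val_scale
    using ab by (intro sum.cong) (auto simp: bihomogeneous_of_degree_def deg1_def deg2_def)
  ultimately show ?thesis by simp
qed

lemma proj_space_scale:
  assumes "P \<in> proj_space" "u \<in> P" "w \<in> P"
  shows "\<exists>c. c \<noteq> 0 \<and> w = (\<lambda>i. c * u i)"
proof -
  obtain p where p: "P = proj_rel `` {p}" using assms(1) unfolding proj_space_def by (auto elim: quotientE)
  obtain c where c: "c \<noteq> 0" "u = (\<lambda>i. c * p i)" using assms(2) unfolding p by (auto simp: proj_rel_def)
  obtain d where d: "d \<noteq> 0" "w = (\<lambda>i. d * p i)" using assms(3) unfolding p by (auto simp: proj_rel_def)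
  have "w = (\<lambda>i. (d / c) * u i)" using c d by auto
  then show ?thesis using c d by (intro exI[of _ "d / c"]) simp
qed

text \<open>Turns an ideal given by generators into an intersection of kernels. The right-hand side
  defines an ideal containing all generators; conversely, if it holds, each component of
  \<open>f\<close> is itself a generator. One representative per point suffices because
  bihomogeneous polynomials scale.\<close>

lemma vanishing_ideal_iff:
  fixes Z :: "(('m::finite \<Rightarrow> 'k::field) set \<times> ('n::finite \<Rightarrow> 'k) set) set"
  assumes Z: "Z \<subseteq> proj_space \<times> proj_space"
    and rep: "\<And>p. p \<in> Z \<Longrightarrow> u p \<in> fst p \<and> v p \<in> snd p"
  shows "f \<in> vanishing_ideal Z \<longleftrightarrow> (\<forall>p\<in>Z. \<psi> (u p) (v p) f = 0)"
proof -
  let ?T = "type_ring :: ('m, 'n, 'k) bipoly ring"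
  let ?G = "{f :: ('m, 'n, 'k) bipoly. bihomogeneous f \<and> (\<forall>p \<in> Z. vanishes_at f p)}"
  interpret T: cring ?T by (rule cring_from_type_algebra)
  have vi: "vanishing_ideal Z = Idl\<^bsub>?T\<^esub> ?G" by (simp add: vanishing_ideal_def bipoly_ring_def)
  have id: "ideal (Idl\<^bsub>?T\<^esub> ?G) ?T" by (rule T.genideal_ideal) simp
  have "ideal {f. \<forall>p\<in>Z. \<psi> (u p) (v p) f = 0} ?T"
    by (intro type_idealI) (auto simp: \<psi>.add \<psi>.mult)
  moreover have "?G \<subseteq> {f. \<forall>p\<in>Z. \<psi> (u p) (v p) f = 0}"
  proof safe
    fix f :: "('m, 'n, 'k) bipoly" and P Q
    assume f: "bihomogeneous f" "\<forall>p\<in>Z. vanishes_at f p" and PQ: "(P, Q) \<in> Z"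
    obtain a b where ab: "bihomogeneous_of_degree (a, b) f" using f(1) by (auto simp: bihomogeneous_def)
    have "eval_bipoly f (u (P, Q)) (v (P, Q)) = 0" using f(2) PQ rep[OF PQ] unfolding vanishes_at_def by blast
    then show "\<psi> (u (P, Q)) (v (P, Q)) f = 0" by (simp add: \<psi>_bihomogeneous[OF ab])
  qed
  ultimately have "vanishing_ideal Z \<subseteq> {f. \<forall>p\<in>Z. \<psi> (u p) (v p) f = 0}"
    unfolding vi by (rule T.genideal_minimal)
  moreover have "f \<in> vanishing_ideal Z" if f: "\<forall>p\<in>Z. \<psi> (u p) (v p) f = 0" for f
  proof -
    have "component d f \<in> ?G" for d
    proof (intro CollectI conjI ballI)
      show bh: "bihomogeneous (component d f)" by (rule bihomogeneous_component)
      fix p assume p: "p \<in> Z"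
      have ps: "fst p \<in> proj_space" "snd p \<in> proj_space" using Z p by auto
      obtain a b where d: "d = (a, b)" by fastforce
      have ab: "bihomogeneous_of_degree (a, b) (component d f)"
        unfolding bihomogeneous_of_degree_def keys_component d by (auto simp: deg1_def deg2_def)
      have "eval_bipoly (component d f) (u p) (v p) = 0"
        using f p coeff_\<psi>[of "u p" "v p" f b a] by (simp add: d)
      then have 0: "\<psi> (u p) (v p) (component d f) = 0" by (simp add: \<psi>_bihomogeneous[OF ab])
      show "vanishes_at (component d f) p"
        unfolding vanishes_at_def
      proof (intro ballI)
        fix u' v' assume uv: "u' \<in> fst p" "v' \<in> snd p"
        obtain c c' where "u' = (\<lambda>i. c * u p i)" "v' = (\<lambda>i. c' * v p i)"
          using proj_space_scale[OF ps(1) _ uv(1)] proj_space_scale[OF ps(2) _ uv(2)] rep[OF p] by blast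
        then show "eval_bipoly (component d f) u' v' = 0" using \<psi>_scale_eq_0[OF bh 0] by simp
      qed
    qed
    moreover have "?G \<subseteq> vanishing_ideal Z" unfolding vi by (rule T.genideal_self) simp
    ultimately have mem: "component d f \<in> vanishing_ideal Z" for d by blast
    have "(\<Sum>d\<in>D. component d f) \<in> vanishing_ideal Z" for D
      using id unfolding vi[symmetric]
      by (induction D rule: infinite_finite_induct) (auto intro: mem type_ideal_add type_ideal_zero)
    then show ?thesis by (subst sum_components)
  qed
  ultimately show ?thesis by blast
qed

section \<open>Ferrers diagrams of points\<close>

text \<open>\<open>V d\<close> models the values of forms of degree \<open>d\<close> at
  \<open>r\<close> points, normalized by a linear form with value 1, which is why \<open>V\<close>
  increases. The coefficients are found by triangular interpolation: what remains after
  \<open>n\<close> terms vanishes at the first \<open>n\<close> points, and its value at the next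
  one is the next coefficient.\<close>

lemma adapted_basis:
  fixes V :: "nat \<Rightarrow> (nat \<Rightarrow> 'k::field) set"
  assumes one: "(\<lambda>_. 1) \<in> V 0" and mono: "\<And>d. V d \<subseteq> V (Suc d)"
    and diff: "\<And>d f g. f \<in> V d \<Longrightarrow> g \<in> V d \<Longrightarrow> (\<lambda>i. f i - g i) \<in> V d"
    and scale: "\<And>d f c. f \<in> V d \<Longrightarrow> (\<lambda>i. c * f i) \<in> V d"
    and mult: "\<And>d e f g. f \<in> V d \<Longrightarrow> g \<in> V e \<Longrightarrow> (\<lambda>i. f i * g i) \<in> V (d + e)"
    and sep: "\<And>i j. i < r \<Longrightarrow> j < r \<Longrightarrow> i \<noteq> j \<Longrightarrow> \<exists>f \<in> V 1. f i = 0 \<and> f j \<noteq> 0"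
  shows "\<exists>e \<delta>. (\<forall>a<r. e a \<in> V (\<delta> a) \<and> e a a = 1 \<and> (\<forall>i<a. e a i = 0)) \<and>
    (\<forall>d. \<forall>f \<in> V d. \<exists>c. (\<forall>a<r. d < \<delta> a \<longrightarrow> c a = 0) \<and> (\<forall>i<r. f i = (\<Sum>a<r. c a * e a i)))"
proof -
  have mono': "V d \<subseteq> V d'" if "d \<le> d'" for d d' using lift_Suc_mono_le[of V, OF mono that] .
  have ex: "\<exists>d. \<exists>f \<in> V d. f a \<noteq> 0 \<and> (\<forall>i<a. f i = 0)" if a: "a < r" for a
  proof -
    \<comment> \<open>A product of linear functions, one for each earlier point, that vanish there
      but not at \<open>a\<close>.\<close>
    have "\<exists>f \<in> V n. f a \<noteq> 0 \<and> (\<forall>i<n. f i = 0)" if "n \<le> a" for n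
      using that
    proof (induction n)
      case 0
      show ?case using one by (intro bexI[of _ "\<lambda>_. 1"]) auto
    next
      case (Suc n)
      then obtain f g where "f \<in> V n" "f a \<noteq> 0" "\<forall>i<n. f i = 0" "g \<in> V 1" "g n = 0" "g a \<noteq> 0"
        using sep[of n a] a by auto
      then show ?case using mult[of f n g 1] by (intro bexI[of _ "\<lambda>i. f i * g i"]) (auto simp: less_Suc_eq)
    qed
    then show ?thesis by blast
  qed
  define \<delta> where "\<delta> a = (LEAST d. \<exists>f \<in> V d. f a \<noteq> 0 \<and> (\<forall>i<a. f i = 0))" for a
  have "\<exists>f. a < r \<longrightarrow> f \<in> V (\<delta> a) \<and> f a = 1 \<and> (\<forall>i<a. f i = 0)" for a
  proof (cases "a < r")
    case True
    obtain f where f: "f \<in> V (\<delta> a)" "f a \<noteq> 0" "\<forall>i<a. f i = 0"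
      using LeastI_ex[OF ex[OF True]] unfolding \<delta>_def by blast
    then show ?thesis using scale[OF f(1), of "inverse (f a)"]
      by (intro exI[of _ "\<lambda>i. inverse (f a) * f i"]) auto
  qed blast
  then obtain e where e: "\<And>a. a < r \<Longrightarrow> e a \<in> V (\<delta> a) \<and> e a a = 1 \<and> (\<forall>i<a. e a i = 0)" by metis
  have span: "\<exists>c. (\<forall>a<n. d < \<delta> a \<longrightarrow> c a = 0) \<and> (\<forall>i<n. f i = (\<Sum>a<n. c a * e a i))"
    if "n \<le> r" "f \<in> V d" for n d f
    using that(1)
  proof (induction n)
    case (Suc n)
    then obtain c where c: "\<forall>a<n. d < \<delta> a \<longrightarrow> c a = 0" "\<forall>i<n. f i = (\<Sum>a<n. c a * e a i)" by auto
    have "(\<lambda>i. f i - (\<Sum>a<k. c a * e a i)) \<in> V d" if "k \<le> n" for k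
      using that
    proof (induction k)
      case (Suc k)
      have "(\<lambda>i. c k * e k i) \<in> V d"
      proof (cases "c k = 0")
        case True
        then show ?thesis using scale[OF \<open>f \<in> V d\<close>, of 0] by simp
      next
        case False
        then have "\<delta> k \<le> d" using c(1)[rule_format, of k] False Suc.prems by (metis Suc_le_eq linorder_not_less)
        moreover have "(\<lambda>i. c k * e k i) \<in> V (\<delta> k)" using e[of k] Suc.prems \<open>Suc n \<le> r\<close> by (intro scale) auto
        ultimately show ?thesis using mono' by blast
      qed
      with Suc show ?case using diff[of "\<lambda>i. f i - (\<Sum>a<k. c a * e a i)" d "\<lambda>i. c k * e k i"]
        by (simp add: diff_diff_eq)
    qed (simp add: \<open>f \<in> V d\<close>)
    from this[of n] have g: "(\<lambda>i. f i - (\<Sum>a<n. c a * e a i)) \<in> V d" by simp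
    define x where "x = f n - (\<Sum>a<n. c a * e a n)"
    \<comment> \<open>A nonzero value would make the remainder, which is in \<open>V d\<close>, a
      competitor in the minimum defining \<open>\<delta> n\<close>. So no basis element of degree
      above \<open>d\<close> is ever used.\<close>
    have "x = 0" if "d < \<delta> n"
    proof (rule ccontr)
      assume "x \<noteq> 0"
      then have "\<exists>f \<in> V d. f n \<noteq> 0 \<and> (\<forall>i<n. f i = 0)"
        using g c(2) unfolding x_def by (intro bexI[OF _ g]) auto
      then have "\<delta> n \<le> d" unfolding \<delta>_def by (rule Least_le)
      then show False using that by simp
    qed
    moreover have "f n = (\<Sum>a<n. c a * e a n) + x * e n n" using e[of n] Suc.prems by (simp add: x_def)
    moreover have "e n i = 0" if "i < n" for i using e[of n] Suc.prems that by auto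
    ultimately show ?case using c
      by (intro exI[of _ "c(n := x)"]) (auto simp: less_Suc_eq)
  qed simp
  show ?thesis using e span[OF order_refl] by blast
qed

lemma deg_single [simp]:
  "deg1 (Poly_Mapping.single (Inl i) n) = n" "deg2 (Poly_Mapping.single (Inl i) n) = 0"
  "deg1 (Poly_Mapping.single (Inr j) n) = 0" "deg2 (Poly_Mapping.single (Inr j) n) = n"
  by (simp_all add: deg1_def deg2_def lookup_single when_def)

lemma ex_linear_form1: "\<exists>f. \<forall>u v. \<psi> u v f = monom (monom (\<Sum>i\<in>UNIV. c i * u i) 1) 0"
  by (rule exI[of _ "\<Sum>i\<in>UNIV. Poly_Mapping.single (Poly_Mapping.single (Inl i) 1) (c i)"])
     (simp add: \<psi>.sum \<psi>_single monom_val_single flip: monom_sum)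

lemma ex_linear_form2: "\<exists>f. \<forall>u v. \<psi> u v f = monom (monom (\<Sum>j\<in>UNIV. c j * v j) 0) 1"
  by (rule exI[of _ "\<Sum>j\<in>UNIV. Poly_Mapping.single (Poly_Mapping.single (Inr j) 1) (c j)"])
     (simp add: \<psi>.sum \<psi>_single monom_val_single flip: monom_sum)

text \<open>Normalized coordinates for X. The forms \<open>l\<close> and \<open>m\<close> have to
  become s and t on the whole grid, not only on \<open>T\<close>, since the bases are built on the
  two factors separately.\<close>

locale ferrers_points =
  fixes u :: "nat \<Rightarrow> 'm::finite \<Rightarrow> 'k::field" and v :: "nat \<Rightarrow> 'n::finite \<Rightarrow> 'k"
    and r s :: nat and T :: "(nat \<times> nat) set" and l m :: "('m, 'n, 'k) bipoly"
  assumes T: "T \<subseteq> {..<r} \<times> {..<s}"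
    and down: "\<And>i j i' j'. (i, j) \<in> T \<Longrightarrow> i' \<le> i \<Longrightarrow> j' \<le> j \<Longrightarrow> (i', j') \<in> T"
    and l: "\<And>i j. i < r \<Longrightarrow> j < s \<Longrightarrow> \<psi> (u i) (v j) l = monom (monom 1 1) 0"
    and m: "\<And>i j. i < r \<Longrightarrow> j < s \<Longrightarrow> \<psi> (u i) (v j) m = monom (monom 1 0) 1"
    and sep1: "\<And>i j. i < r \<Longrightarrow> j < r \<Longrightarrow> i \<noteq> j \<Longrightarrow>
      \<exists>c. (\<Sum>k\<in>UNIV. c k * u i k) = 0 \<and> (\<Sum>k\<in>UNIV. c k * u j k) \<noteq> 0"
    and sep2: "\<And>i j. i < s \<Longrightarrow> j < s \<Longrightarrow> i \<noteq> j \<Longrightarrow>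
      \<exists>c. (\<Sum>k\<in>UNIV. c k * v i k) = 0 \<and> (\<Sum>k\<in>UNIV. c k * v j k) \<noteq> 0"
begin

abbreviation \<phi> :: "nat \<times> nat \<Rightarrow> ('m, 'n, 'k) bipoly \<Rightarrow> 'k poly poly" where
  "\<phi> p \<equiv> \<psi> (u (fst p)) (v (snd p))"

definition I :: "('m, 'n, 'k) bipoly set" where
  "I = {f. \<forall>p\<in>T. \<phi> p f = 0}"

text \<open>Makes R an algebra over k[s, t] through s to \<open>l\<close> and t to \<open>m\<close>;
  it is a section of every \<open>\<phi> p\<close> with \<open>p\<close> in
  \<open>T\<close>.\<close>

definition F :: "'k poly poly \<Rightarrow> ('m, 'n, 'k) bipoly" where
  "F = bieval (Poly_Mapping.single 0) l m"

lemma finite_T: "finite T"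
  using T by (rule finite_subset) simp

lemma ideal_I: "ideal I type_ring"
  unfolding I_def by (intro type_idealI) (auto simp: \<psi>.add \<psi>.mult)

lemma type_ring_hom_single: "type_ring_hom (Poly_Mapping.single 0 :: 'k \<Rightarrow> ('m, 'n, 'k) bipoly)"
  by unfold_locales (simp_all add: single_add mult_single)

sublocale F: type_ring_hom F
  unfolding F_def by (intro type_ring_hom_bieval type_ring_hom_single)

lemma \<phi>_F [simp]:
  assumes "p \<in> T"
  shows "\<phi> p (F g) = g"
proof -
  have p: "fst p < r" "snd p < s" using assms T by auto
  have "type_ring_hom (\<lambda>g :: 'k poly poly. g)" by unfold_locales auto
  then show ?thesis
  proof (rule bivariate_hom_eqI[OF type_ring_hom_comp[OF F.type_ring_hom_axioms \<psi>.type_ring_hom_axioms]])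
    show "\<phi> p (F [:[:c:]:]) = [:[:c:]:]" for c
      unfolding F_def bieval_simps[OF type_ring_hom_single] by (simp add: \<psi>_single deg1_def deg2_def monom_0)
    show "\<phi> p (F [:[:0, 1:]:]) = [:[:0, 1:]:]"
      unfolding F_def bieval_simps[OF type_ring_hom_single] l[OF p] by (simp add: monom_Suc monom_0)
    show "\<phi> p (F [:0, 1:]) = [:0, 1:]"
      unfolding F_def bieval_simps[OF type_ring_hom_single] m[OF p] by (simp add: monom_Suc monom_0 one_pCons)
  qed
qed

text \<open>If no kernel lay in \<open>P\<close>, pick in each an element outside \<open>P\<close>.
  The product of these is in \<open>I\<close> but not in \<open>P\<close>; for empty
  \<open>T\<close> the empty product 1 does the same.\<close>

lemma prime_contains_kernel:
  assumes P: "primeideal P type_ring" "I \<subseteq> P"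
  shows "\<exists>p\<in>T. \<forall>f. \<phi> p f = 0 \<longrightarrow> f \<in> P"
proof (rule ccontr)
  assume "\<not> ?thesis"
  then obtain f where f: "\<And>p. p \<in> T \<Longrightarrow> \<phi> p (f p) = 0" "\<And>p. p \<in> T \<Longrightarrow> f p \<notin> P" by metis
  have "prod f A \<notin> P" if "finite A" "A \<subseteq> T" for A
    using that
    by (induction A) (auto simp: type_prime_one[OF P(1)] type_prime_mult_iff[OF P(1)] f(2))
  then have "prod f T \<notin> P" using finite_T by blast
  moreover have "\<phi> p (prod f T) = 0" if "p \<in> T" for p
    using that f(1)[OF that] by (simp add: prod.remove[OF finite_T that] \<psi>.mult)
  then have "prod f T \<in> I" by (simp add: I_def)
  ultimately show False using P(2) by blast
qed

text \<open>\<open>f\<close> and \<open>F (\<phi> p f)\<close> differ by an element of the kernel of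
  \<open>\<phi> p\<close>. Hence an ideal containing that kernel is determined by its preimage under
  \<open>F\<close> in k[s, t].\<close>

lemma prime_F_\<phi>_iff:
  assumes P: "ideal P type_ring" "\<forall>f. \<phi> p f = 0 \<longrightarrow> f \<in> P" and p: "p \<in> T"
  shows "F (\<phi> p f) \<in> P \<longleftrightarrow> f \<in> P"
proof -
  have "\<phi> p (F (\<phi> p f) - f) = 0" using p by (simp add: \<psi>.diff)
  then have d: "F (\<phi> p f) - f \<in> P" using P(2) by blast
  show ?thesis
    using type_ideal_add[OF P(1) d, of f] type_ideal_diff[OF P(1) _ d, of "F (\<phi> p f)"] by auto
qed

text \<open>All members of a chain contain the kernel that the lowest one contains, so their
  preimages in k[s, t] remain distinct and the bound for chains there applies.\<close>

lemma no_prime_chain: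
  "\<nexists>P. (\<forall>i \<le> 3. primeideal (P i) type_ring) \<and> (\<forall>i \<le> 2. P i \<subset> P (Suc i)) \<and> I \<subseteq> P 0"
proof
  assume "\<exists>P. (\<forall>i \<le> 3. primeideal (P i) type_ring) \<and> (\<forall>i \<le> 2. P i \<subset> P (Suc i)) \<and> I \<subseteq> P 0"
  then obtain P where P: "\<And>i. i \<le> 3 \<Longrightarrow> primeideal (P i) type_ring" "\<And>i. i \<le> 2 \<Longrightarrow> P i \<subset> P (Suc i)" "I \<subseteq> P 0"
    by blast
  obtain p where p: "p \<in> T" "\<forall>f. \<phi> p f = 0 \<longrightarrow> f \<in> P 0" using prime_contains_kernel[OF P(1) P(3)] by auto
  have sub: "P 0 \<subseteq> P i" if "i \<le> 3" for i
    using that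
  proof (induction i)
    case (Suc i)
    then show ?case using P(2)[of i] by auto
  qed simp
  have ker: "\<forall>f. \<phi> p f = 0 \<longrightarrow> f \<in> P i" if "i \<le> 3" for i using p(2) sub[OF that] by blast
  note iff = prime_F_\<phi>_iff[OF type_prime_ideal[OF P(1)] ker p(1)]
  obtain i where i: "i \<le> 2" "\<not> {g. F g \<in> P i} \<subset> {g. F g \<in> P (Suc i)}"
    using no_long_prime_chain[of "\<lambda>i. {g. F g \<in> P i}"] F.prime_vimage P(1) by blast
  obtain f where f: "f \<in> P (Suc i)" "f \<notin> P i" using P(2)[OF i(1)] by blast
  have "F (\<phi> p f) \<in> P (Suc i)" "F (\<phi> p f) \<notin> P i" using iff[of "Suc i"] iff[of i] i(1) f by auto
  then show False using i P(2)[OF i(1)] by blast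
qed

text \<open>Values of "forms of degree d" on the first factor: the restriction p(i) s^d must not
  depend on the second index. Multiplication by \<open>l\<close> raises \<open>d\<close> and keeps
  \<open>p\<close>.\<close>

definition V :: "nat \<Rightarrow> (nat \<Rightarrow> 'k) set" where
  "V d = {p. \<exists>f. \<forall>i<r. \<forall>j<s. \<psi> (u i) (v j) f = monom (monom (p i) d) 0}"

definition W :: "nat \<Rightarrow> (nat \<Rightarrow> 'k) set" where
  "W d = {q. \<exists>f. \<forall>i<r. \<forall>j<s. \<psi> (u i) (v j) f = monom (monom (q j) 0) d}"

lemma one_in_V: "(\<lambda>_. 1) \<in> V 0" and one_in_W: "(\<lambda>_. 1) \<in> W 0"
  unfolding V_def W_def by (auto intro!: exI[of _ 1] simp: monom_0 one_pCons)

lemma V_mult: "p \<in> V d \<Longrightarrow> q \<in> V e \<Longrightarrow> (\<lambda>i. p i * q i) \<in> V (d + e)"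
  and W_mult: "p' \<in> W d \<Longrightarrow> q' \<in> W e \<Longrightarrow> (\<lambda>i. p' i * q' i) \<in> W (d + e)"
  unfolding V_def W_def mem_Collect_eq
  by (elim exE, rule_tac x="f * fa" in exI, simp add: \<psi>.mult mult_monom)+

lemma V_diff: "p \<in> V d \<Longrightarrow> q \<in> V d \<Longrightarrow> (\<lambda>i. p i - q i) \<in> V d"
  and W_diff: "p' \<in> W d \<Longrightarrow> q' \<in> W d \<Longrightarrow> (\<lambda>i. p' i - q' i) \<in> W d"
  unfolding V_def W_def mem_Collect_eq
  by (elim exE, rule_tac x="f - fa" in exI, simp add: \<psi>.diff flip: diff_monom)+

lemma const_in_V: "(\<lambda>_. c) \<in> V 0" and const_in_W: "(\<lambda>_. c) \<in> W 0"
  unfolding V_def W_def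
  by (auto intro!: exI[of _ "Poly_Mapping.single 0 c"] simp: \<psi>_single deg1_def deg2_def)

lemma linear_in_V: "(\<lambda>i. \<Sum>k\<in>UNIV. c k * u i k) \<in> V 1" and linear_in_W: "(\<lambda>j. \<Sum>k\<in>UNIV. c' k * v j k) \<in> W 1"
  using ex_linear_form1[of c] ex_linear_form2[of c'] unfolding V_def W_def mem_Collect_eq by blast+

lemma V_mono: "V d \<subseteq> V (Suc d)" and W_mono: "W d \<subseteq> W (Suc d)"
proof -
  have "(\<lambda>_. 1) \<in> V 1" "(\<lambda>_. 1) \<in> W 1"
    unfolding V_def W_def mem_Collect_eq using l m by blast+
  then show "V d \<subseteq> V (Suc d)" "W d \<subseteq> W (Suc d)"
    using V_mult[of _ d "\<lambda>_. 1" 1] W_mult[of _ d "\<lambda>_. 1" 1] by auto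
qed

lemma coord_power_in_V: "(\<lambda>i. u i k ^ n) \<in> V n" and coord_power_in_W: "(\<lambda>j. v j k' ^ n) \<in> W n"
proof -
  have delta: "(if x = y then 1 else 0) * z = (if x = y then z else 0)" for x y :: 'x and z :: 'k by simp
  have 1: "(\<lambda>i. u i k) \<in> V 1" using linear_in_V[of "\<lambda>x. if x = k then 1 else 0"] by (simp add: delta)
  have 2: "(\<lambda>j. v j k') \<in> W 1" using linear_in_W[of "\<lambda>x. if x = k' then 1 else 0"] by (simp add: delta)
  show "(\<lambda>i. u i k ^ n) \<in> V n"
    by (induction n) (use one_in_V V_mult[OF 1] in auto)
  show "(\<lambda>j. v j k' ^ n) \<in> W n"
    by (induction n) (use one_in_W W_mult[OF 2] in auto)
qed

lemma monomial_in_V: "(\<lambda>i. \<Prod>k\<in>A. u i k ^ n k) \<in> V (sum n A)"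
  by (induction A rule: infinite_finite_induct) (use one_in_V V_mult[OF coord_power_in_V] in auto)

lemma monomial_in_W: "(\<lambda>i. \<Prod>k\<in>A. v i k ^ n k) \<in> W (sum n A)"
  by (induction A rule: infinite_finite_induct) (use one_in_W W_mult[OF coord_power_in_W] in auto)

text \<open>
  \<open>e\<close> and \<open>h\<close> are triangular for the order of the points and adapted to the degree
  filtration; since \<open>T\<close> is a Ferrers diagram, \<open>e a \<otimes> h b\<close> vanishes on \<open>T\<close> unless
  \<open>(a, b) \<in> T\<close>. So the \<open>E (a, b)\<close> with \<open>(a, b) \<in> T\<close> form a basis of
  \<open>R / I\<close> over \<open>k[l, m]\<close>.
\<close>

lemma free_basis:
  obtains E :: "nat \<times> nat \<Rightarrow> ('m, 'n, 'k) bipoly"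
  where "\<And>f. \<exists>G. \<forall>p\<in>T. \<phi> p f = (\<Sum>q\<in>T. G q * \<phi> p (E q))"
    and "\<And>D. (\<forall>p\<in>T. (\<Sum>q\<in>T. D q * \<phi> p (E q)) = 0) \<Longrightarrow> \<forall>q\<in>T. D q = 0"
proof -
  have "\<exists>e \<delta>. (\<forall>a<r. e a \<in> V (\<delta> a) \<and> e a a = 1 \<and> (\<forall>i<a. e a i = 0)) \<and>
    (\<forall>d. \<forall>f \<in> V d. \<exists>c. (\<forall>a<r. d < \<delta> a \<longrightarrow> c a = 0) \<and> (\<forall>i<r. f i = (\<Sum>a<r. c a * e a i)))"
  proof (rule adapted_basis)
    show "\<exists>f \<in> V 1. f i = 0 \<and> f j \<noteq> 0" if "i < r" "j < r" "i \<noteq> j" for i j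
      using sep1[OF that] linear_in_V by (elim exE conjE) (rule bexI, erule (1) conjI)
    show "(\<lambda>i. c * f i) \<in> V d" if "f \<in> V d" for d f c
      using V_mult[OF const_in_V that, of c] by simp
    show "(\<lambda>_. 1) \<in> V 0" by (rule one_in_V)
    show "V d \<subseteq> V (Suc d)" for d by (rule V_mono)
    show "(\<lambda>i. f i - g i) \<in> V d" if "f \<in> V d" "g \<in> V d" for d f g using that by (rule V_diff)
    show "(\<lambda>i. f i * g i) \<in> V (d + e)" if "f \<in> V d" "g \<in> V e" for d e f g using that by (rule V_mult)
  qed
  then obtain e \<delta> where e_basis: "(\<forall>a<r. e a \<in> V (\<delta> a) \<and> e a a = 1 \<and> (\<forall>i<a. e a i = 0)) \<and>
    (\<forall>d. \<forall>f \<in> V d. \<exists>c. (\<forall>a<r. d < \<delta> a \<longrightarrow> c a = 0) \<and> (\<forall>i<r. f i = (\<Sum>a<r. c a * e a i)))"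
    by (elim exE)
  from e_basis have e: "\<And>a. a < r \<Longrightarrow> e a \<in> V (\<delta> a)" "\<And>a. a < r \<Longrightarrow> e a a = 1" "\<And>a i. a < r \<Longrightarrow> i < a \<Longrightarrow> e a i = 0"
    by auto
  have e_span: "\<And>d f. f \<in> V d \<Longrightarrow> \<exists>c. (\<forall>a<r. d < \<delta> a \<longrightarrow> c a = 0) \<and> (\<forall>i<r. f i = (\<Sum>a<r. c a * e a i))"
    by (rule e_basis[THEN conjunct2, rule_format])
  have "\<exists>e \<delta>. (\<forall>a<s. e a \<in> W (\<delta> a) \<and> e a a = 1 \<and> (\<forall>i<a. e a i = 0)) \<and>
    (\<forall>d. \<forall>f \<in> W d. \<exists>c. (\<forall>a<s. d < \<delta> a \<longrightarrow> c a = 0) \<and> (\<forall>i<s. f i = (\<Sum>a<s. c a * e a i)))"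
  proof (rule adapted_basis)
    show "\<exists>f \<in> W 1. f i = 0 \<and> f j \<noteq> 0" if "i < s" "j < s" "i \<noteq> j" for i j
      using sep2[OF that] linear_in_W by (elim exE conjE) (rule bexI, erule (1) conjI)
    show "(\<lambda>i. c * f i) \<in> W d" if "f \<in> W d" for d f c
      using W_mult[OF const_in_W that, of c] by simp
    show "(\<lambda>_. 1) \<in> W 0" by (rule one_in_W)
    show "W d \<subseteq> W (Suc d)" for d by (rule W_mono)
    show "(\<lambda>i. f i - g i) \<in> W d" if "f \<in> W d" "g \<in> W d" for d f g using that by (rule W_diff)
    show "(\<lambda>i. f i * g i) \<in> W (d + e)" if "f \<in> W d" "g \<in> W e" for d e f g using that by (rule W_mult)
  qed
  then obtain h \<epsilon> where h_basis: "(\<forall>a<s. h a \<in> W (\<epsilon> a) \<and> h a a = 1 \<and> (\<forall>i<a. h a i = 0)) \<and>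
    (\<forall>d. \<forall>f \<in> W d. \<exists>c. (\<forall>a<s. d < \<epsilon> a \<longrightarrow> c a = 0) \<and> (\<forall>i<s. f i = (\<Sum>a<s. c a * h a i)))"
    by (elim exE)
  from h_basis have h: "\<And>a. a < s \<Longrightarrow> h a \<in> W (\<epsilon> a)" "\<And>a. a < s \<Longrightarrow> h a a = 1" "\<And>a i. a < s \<Longrightarrow> i < a \<Longrightarrow> h a i = 0"
    by auto
  have h_span: "\<And>d f. f \<in> W d \<Longrightarrow> \<exists>c. (\<forall>a<s. d < \<epsilon> a \<longrightarrow> c a = 0) \<and> (\<forall>i<s. f i = (\<Sum>a<s. c a * h a i))"
    by (rule h_basis[THEN conjunct2, rule_format])
  have "\<exists>f. a < r \<longrightarrow> (\<forall>i<r. \<forall>j<s. \<psi> (u i) (v j) f = monom (monom (e a i) (\<delta> a)) 0)" for a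
    using e(1)[of a] unfolding V_def by blast
  then obtain e' where e': "\<And>a i j. a < r \<Longrightarrow> i < r \<Longrightarrow> j < s \<Longrightarrow> \<psi> (u i) (v j) (e' a) = monom (monom (e a i) (\<delta> a)) 0" by metis
  have "\<exists>f. b < s \<longrightarrow> (\<forall>i<r. \<forall>j<s. \<psi> (u i) (v j) f = monom (monom (h b j) 0) (\<epsilon> b))" for b
    using h(1)[of b] unfolding W_def by blast
  then obtain h' where h': "\<And>b i j. b < s \<Longrightarrow> i < r \<Longrightarrow> j < s \<Longrightarrow> \<psi> (u i) (v j) (h' b) = monom (monom (h b j) 0) (\<epsilon> b)" by metis
  define E where "E q = e' (fst q) * h' (snd q)" for q
  have \<phi>_E: "\<phi> p (E q) = monom (monom (e (fst q) (fst p) * h (snd q) (snd p)) (\<delta> (fst q))) (\<epsilon> (snd q))"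
    if "p \<in> T" "q \<in> {..<r} \<times> {..<s}" for p q
  proof -
    have "fst p < r" "snd p < s" "fst q < r" "snd q < s" using that T by auto
    then show ?thesis by (simp add: E_def \<psi>.mult e' h' mult_monom)
  qed
  have support: "fst q \<le> fst p \<and> snd q \<le> snd p \<and> q \<in> T"
    if "p \<in> T" "q \<in> {..<r} \<times> {..<s}" "e (fst q) (fst p) * h (snd q) (snd p) \<noteq> 0" for p q
  proof -
    have "fst q \<le> fst p" "snd q \<le> snd p" using that e(3)[of "fst q" "fst p"] h(3)[of "snd q" "snd p"] by force+
    then show ?thesis using down[of "fst p" "snd p" "fst q" "snd q"] that by simp
  qed
  let ?spanned = "\<lambda>f. \<exists>G. \<forall>p\<in>T. \<phi> p f = (\<Sum>q\<in>T. G q * \<phi> p (E q))"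
  have single: "?spanned (Poly_Mapping.single d c)" for d c
  proof -
    define x where "x i = (\<Prod>k\<in>UNIV. u i k ^ Poly_Mapping.lookup d (Inl k))" for i
    define y where "y j = (\<Prod>k\<in>UNIV. v j k ^ Poly_Mapping.lookup d (Inr k))" for j
    have "x \<in> V (deg1 d)" unfolding x_def[abs_def] deg1_def by (rule monomial_in_V)
    then obtain a where a: "\<And>i. i < r \<Longrightarrow> deg1 d < \<delta> i \<Longrightarrow> a i = 0" "\<And>i. i < r \<Longrightarrow> x i = (\<Sum>k<r. a k * e k i)"
      using e_span by blast
    have "y \<in> W (deg2 d)" unfolding y_def[abs_def] deg2_def by (rule monomial_in_W)
    then obtain b where b: "\<And>i. i < s \<Longrightarrow> deg2 d < \<epsilon> i \<Longrightarrow> b i = 0" "\<And>i. i < s \<Longrightarrow> y i = (\<Sum>k<s. b k * h k i)"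
      using h_span by blast
    \<comment> \<open>The powers of s and t fill the gap between the degrees of the basis element
      and those of the monomial. Truncated subtraction is harmless: where a degree would be
      negative, \<open>a\<close> or \<open>b\<close> is zero.\<close>
    define G where "G q = monom (monom (c * (a (fst q) * b (snd q))) (deg1 d - \<delta> (fst q))) (deg2 d - \<epsilon> (snd q))" for q
    have "\<phi> p (Poly_Mapping.single d c) = (\<Sum>q\<in>T. G q * \<phi> p (E q))" if p: "p \<in> T" for p
    proof -
      have p': "fst p < r" "snd p < s" using p T by auto
      let ?t = "\<lambda>q. e (fst q) (fst p) * h (snd q) (snd p)"
      have "x (fst p) * y (snd p) = (\<Sum>q\<in>{..<r} \<times> {..<s}. a (fst q) * b (snd q) * ?t q)"
        unfolding a(2)[OF p'(1)] b(2)[OF p'(2)] sum_product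
        by (simp add: sum.cartesian_product case_prod_unfold algebra_simps)
      \<comment> \<open>Here the Ferrers shape enters: products indexed outside \<open>T\<close>
        vanish at every point of \<open>T\<close>, so the expansion over the full grid shrinks to
        \<open>T\<close>.\<close>
      also have "\<dots> = (\<Sum>q\<in>T. a (fst q) * b (snd q) * ?t q)"
        using T support[OF p] by (intro sum.mono_neutral_right) auto
      finally have xy: "x (fst p) * y (snd p) = (\<Sum>q\<in>T. a (fst q) * b (snd q) * ?t q)" .
      have "G q * \<phi> p (E q) = monom (monom (c * (a (fst q) * b (snd q) * ?t q)) (deg1 d)) (deg2 d)" if q: "q \<in> T" for q
      proof (cases "a (fst q) = 0 \<or> b (snd q) = 0")
        case True
        then show ?thesis by (auto simp: G_def)
      next
        case False
        have q': "q \<in> {..<r} \<times> {..<s}" using q T by blast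
        have "\<delta> (fst q) \<le> deg1 d" "\<epsilon> (snd q) \<le> deg2 d"
          using False a(1)[of "fst q"] b(1)[of "snd q"] q' by force+
        then show ?thesis unfolding \<phi>_E[OF p q'] G_def by (simp add: mult_monom mult.assoc)
      qed
      then have "(\<Sum>q\<in>T. G q * \<phi> p (E q)) = monom (monom (c * (x (fst p) * y (snd p))) (deg1 d)) (deg2 d)"
        unfolding xy sum_distrib_left by (simp add: monom_sum)
      also have "\<dots> = \<phi> p (Poly_Mapping.single d c)"
        unfolding \<psi>_single monom_val_sum x_def y_def ..
      finally show ?thesis by simp
    qed
    then show ?thesis by blast
  qed
  have spanned: "?spanned f" for f
  proof -
    have "\<forall>d. ?spanned (Poly_Mapping.single d (Poly_Mapping.lookup f d))" using single by blast
    then have "\<exists>G. \<forall>d. \<forall>p\<in>T. \<phi> p (Poly_Mapping.single d (Poly_Mapping.lookup f d)) = (\<Sum>q\<in>T. G d q * \<phi> p (E q))"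
      by (rule choice)
    then obtain G where "\<forall>d. \<forall>p\<in>T. \<phi> p (Poly_Mapping.single d (Poly_Mapping.lookup f d)) = (\<Sum>q\<in>T. G d q * \<phi> p (E q))"
      by (elim exE)
    then have G: "\<phi> p (Poly_Mapping.single d (Poly_Mapping.lookup f d)) = (\<Sum>q\<in>T. G d q * \<phi> p (E q))"
      if "p \<in> T" for d p using that by (elim allE ballE) auto
    have "\<phi> p f = (\<Sum>q\<in>T. (\<Sum>d\<in>Poly_Mapping.keys f. G d q) * \<phi> p (E q))" if "p \<in> T" for p
    proof -
      have "\<phi> p f = \<phi> p (\<Sum>d\<in>Poly_Mapping.keys f. Poly_Mapping.single d (Poly_Mapping.lookup f d))"
        by (simp flip: poly_mapping_sum_single)
      also have "\<dots> = (\<Sum>d\<in>Poly_Mapping.keys f. \<Sum>q\<in>T. G d q * \<phi> p (E q))"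
        by (simp only: \<psi>.sum G[OF that])
      also have "\<dots> = (\<Sum>q\<in>T. (\<Sum>d\<in>Poly_Mapping.keys f. G d q) * \<phi> p (E q))"
        by (subst sum.swap) (simp add: sum_distrib_right)
      finally show ?thesis .
    qed
    then show ?thesis by (intro exI ballI)
  qed
  have indep: "\<forall>q\<in>T. D q = 0" if D: "\<forall>p\<in>T. (\<Sum>q\<in>T. D q * \<phi> p (E q)) = 0" for D
  proof -
    \<comment> \<open>In the relation at \<open>p\<close> only indices below \<open>p\<close> in
      both coordinates survive. Those other than \<open>p\<close> have a smaller coordinate sum, so
      their coefficients vanish by induction, and the diagonal entry is a monomial with coefficient
      1.\<close>
    have "D p = 0" if "p \<in> T" for p
      using that
    proof (induction "fst p + snd p" arbitrary: p rule: less_induct)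
      case less
      have p': "p \<in> {..<r} \<times> {..<s}" using less.prems T by blast
      have zero: "D q * \<phi> p (E q) = 0" if q: "q \<in> T - {p}" for q
      proof (cases "e (fst q) (fst p) * h (snd q) (snd p) = 0")
        case True
        have "q \<in> {..<r} \<times> {..<s}" using q T by blast
        then show ?thesis using \<phi>_E[OF less.prems] True by simp
      next
        case False
        have "q \<in> {..<r} \<times> {..<s}" using q T by blast
        then have "fst q \<le> fst p" "snd q \<le> snd p" using support[OF less.prems] False by blast+
        moreover have "q \<noteq> p" using q by blast
        ultimately have "fst q + snd q < fst p + snd p" by (cases p; cases q) auto
        then show ?thesis using less.hyps q by simp
      qed
      have "(\<Sum>q\<in>T - {p}. D q * \<phi> p (E q)) = 0" by (rule sum.neutral) (use zero in blast)
      then have "D p * \<phi> p (E p) = (\<Sum>q\<in>T. D q * \<phi> p (E q))"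
        by (simp only: sum.remove[OF finite_T less.prems] add_0_right)
      also have "\<dots> = 0" using D less.prems by blast
      finally show ?case using \<phi>_E[OF less.prems p'] p' e(2) h(2) by (auto simp: monom_eq_0_iff)
    qed
    then show ?thesis by blast
  qed
  show thesis using that spanned indep by blast
qed

text \<open>The first claim holds because each \<open>\<phi> p\<close> maps into a domain. For the
  second, independence of the basis turns the relation into g(t) A = f(s) B for each pair of
  coefficients; f(s) and g(t) share no factor, so f(s) divides every A and can be pulled out of
  \<open>a\<close>.\<close>

lemma regular_pair:
  assumes fg: "f \<noteq> 0" "g \<noteq> 0"
  shows "F [:f:] * a \<in> I \<Longrightarrow> a \<in> I"
    and "F (const_coeffs g) * a - F [:f:] * b \<in> I \<Longrightarrow> \<exists>c. a - F [:f:] * c \<in> I"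
proof -
  show "a \<in> I" if "F [:f:] * a \<in> I"
    using that fg by (auto simp: I_def \<psi>.mult)
  assume mem: "F (const_coeffs g) * a - F [:f:] * b \<in> I"
  obtain E where span: "\<And>f. \<exists>G. \<forall>p\<in>T. \<phi> p f = (\<Sum>q\<in>T. G q * \<phi> p (E q))"
    and indep: "\<And>D. (\<forall>p\<in>T. (\<Sum>q\<in>T. D q * \<phi> p (E q)) = 0) \<Longrightarrow> \<forall>q\<in>T. D q = 0"
    by (rule free_basis, rule that)
  obtain A where A: "\<And>p. p \<in> T \<Longrightarrow> \<phi> p a = (\<Sum>q\<in>T. A q * \<phi> p (E q))" using span by blast
  obtain B where B: "\<And>p. p \<in> T \<Longrightarrow> \<phi> p b = (\<Sum>q\<in>T. B q * \<phi> p (E q))" using span by blast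
  have "\<forall>q\<in>T. const_coeffs g * A q - [:f:] * B q = 0"
  proof (rule indep, intro ballI)
    fix p assume p: "p \<in> T"
    have "(\<Sum>q\<in>T. (const_coeffs g * A q - [:f:] * B q) * \<phi> p (E q)) = const_coeffs g * \<phi> p a - [:f:] * \<phi> p b"
      unfolding A[OF p] B[OF p] sum_distrib_left sum_subtractf[symmetric]
      by (intro sum.cong refl) (simp only: left_diff_distrib mult.assoc)
    also have "\<dots> = \<phi> p (F (const_coeffs g) * a - F [:f:] * b)" using p by (simp add: \<psi>.diff \<psi>.mult)
    also have "\<dots> = 0" using mem p by (simp add: I_def)
    finally show "(\<Sum>q\<in>T. (const_coeffs g * A q - [:f:] * B q) * \<phi> p (E q)) = 0" .
  qed
  then have "const_coeffs g * A q = [:f:] * B q" if "q \<in> T" for q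
    using that by simp
  then have "[:f:] dvd A q" if "q \<in> T" for q
    using that const_dvd_cancel[OF fg(2), of f "A q"] dvd_triv_left by metis
  then have "\<exists>H. q \<in> T \<longrightarrow> A q = [:f:] * H" for q unfolding dvd_def by blast
  then obtain H where H: "\<And>q. q \<in> T \<Longrightarrow> A q = [:f:] * H q" by metis
  have "\<phi> p (a - F [:f:] * (\<Sum>q\<in>T. F (H q) * E q)) = 0" if p: "p \<in> T" for p
  proof -
    have "\<phi> p (F [:f:] * (\<Sum>q\<in>T. F (H q) * E q)) = (\<Sum>q\<in>T. A q * \<phi> p (E q))"
      using p H by (simp add: \<psi>.mult \<psi>.sum sum_distrib_left mult.assoc del: mult_pCons_left)
    then show ?thesis by (simp add: \<psi>.diff A[OF p])
  qed
  then show "\<exists>c. a - F [:f:] * c \<in> I" unfolding I_def by blast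
qed

lemma cohen_macaulay: "cohen_macaulay_ring (type_ring Quot I)"
proof (rule cohen_macaulay_quotient[OF ideal_I noetherian_ring_polynomials no_prime_chain])
  fix M :: "('m, 'n, 'k) bipoly set"
  assume M: "primeideal M type_ring" "I \<subseteq> M" and max: "\<And>r. r \<notin> M \<Longrightarrow> \<exists>a. 1 - a * r \<in> M"
  obtain p where p: "p \<in> T" "\<forall>f. \<phi> p f = 0 \<longrightarrow> f \<in> M" using prime_contains_kernel[OF M] by blast
  note iff = prime_F_\<phi>_iff[OF type_prime_ideal[OF M(1)] p(2) p(1)]
  let ?n = "{q. F q \<in> M}"
  \<comment> \<open>Maximality passes to the preimage: \<open>\<phi> p\<close> carries an inverse of
    \<open>F q\<close> modulo \<open>M\<close> to an inverse of \<open>q\<close> modulo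
    \<open>?n\<close>.\<close>
  have "\<exists>a. 1 - a * q \<in> ?n" if q: "q \<notin> ?n" for q
  proof -
    obtain a where "1 - a * F q \<in> M" using max[of "F q"] q by auto
    then have "F (\<phi> p (1 - a * F q)) \<in> M" by (simp only: iff)
    then have "1 - \<phi> p a * q \<in> ?n" using p(1) by (simp add: \<psi>.diff \<psi>.mult)
    then show ?thesis by blast
  qed
  from maximal_contains_both[OF F.ideal_vimage[OF type_prime_ideal[OF M(1)]] _ this]
  obtain f g where fg: "f \<noteq> 0" "g \<noteq> 0" and mem: "F [:f:] \<in> M" "F (const_coeffs g) \<in> M"
    using type_prime_one[OF M(1)] by auto
  show "\<exists>x\<in>M. \<exists>y\<in>M. (\<forall>a. x * a \<in> I \<longrightarrow> a \<in> I) \<and> (\<forall>a b. y * a - x * b \<in> I \<longrightarrow> (\<exists>c. a - x * c \<in> I))"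
  proof (rule bexI[of _ "F [:f:]"], rule bexI[of _ "F (const_coeffs g)"], intro conjI allI impI)
    show "F [:f:] \<in> M" "F (const_coeffs g) \<in> M" by fact+
    show "a \<in> I" if "F [:f:] * a \<in> I" for a using regular_pair(1)[OF fg that] .
    show "\<exists>c. a - F [:f:] * c \<in> I" if "F (const_coeffs g) * a - F [:f:] * b \<in> I" for a b
      using regular_pair(2)[OF fg that] .
  qed
qed

end

section \<open>Normalized coordinates and the ordering of the points\<close>

lemma ex_separating_form:
  fixes x y :: "'i::finite \<Rightarrow> 'k::field"
  assumes "x \<noteq> (\<lambda>_. 0)" "y \<noteq> (\<lambda>_. 0)" "\<And>c. c \<noteq> 0 \<Longrightarrow> y \<noteq> (\<lambda>i. c * x i)"
  shows "\<exists>c. (\<Sum>i\<in>UNIV. c i * x i) = 0 \<and> (\<Sum>i\<in>UNIV. c i * y i) \<noteq> 0"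
proof -
  obtain a where a: "x a \<noteq> 0" using assms(1) by auto
  have "\<exists>b. x a * y b \<noteq> y a * x b"
  proof (rule ccontr)
    assume "\<not> ?thesis"
    then have y: "y = (\<lambda>i. (y a / x a) * x i)" using a by (auto simp: field_simps)
    then have "y a \<noteq> 0" using assms(2) by auto
    then show False using assms(3)[of "y a / x a"] y a by simp
  qed
  then obtain b where b: "x a * y b \<noteq> y a * x b" by blast
  \<comment> \<open>The form z to x_a z_b - x_b z_a, a 2 by 2 minor of the rows x and z: it vanishes
    at \<open>x\<close>, and its value at \<open>y\<close> is nonzero by the choice of
    \<open>b\<close>.\<close>
  let ?c = "\<lambda>i. (if i = b then x a else 0) - (if i = a then x b else 0)"
  have delta: "(if i = j then p else 0) * q = (if i = j then p * q else 0)" for i j :: 'i and p q :: 'k by simp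
  have "(\<Sum>i\<in>UNIV. ?c i * z i) = x a * z b - x b * z a" for z
    by (simp add: left_diff_distrib sum_subtractf delta)
  then show ?thesis using b by (intro exI[of _ ?c]) (simp add: mult.commute)
qed

text \<open>Take as coefficients the distinct powers of one scalar \<open>z\<close>. The value at
  \<open>x\<close> is then a nonzero polynomial in \<open>z\<close>, and an infinite field has a
  \<open>z\<close> that is a root of none of these finitely many polynomials.\<close>

lemma ex_nonvanishing_form:
  fixes U :: "('i::finite \<Rightarrow> 'k::field_char_0) set"
  assumes "finite U" "(\<lambda>_. 0) \<notin> U"
  shows "\<exists>c. \<forall>x\<in>U. (\<Sum>i\<in>UNIV. c i * x i) \<noteq> 0"
proof -
  let ?t = "to_nat_on (UNIV :: 'i set)"
  have inj: "?t i = ?t j \<longleftrightarrow> i = j" for i j using inj_on_to_nat_on[of "UNIV :: 'i set"] by (auto simp add: inj_on_def countable_finite)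
  define p where "p x = (\<Sum>i\<in>UNIV. monom (x i) (?t i))" for x :: "'i \<Rightarrow> 'k"
  have "coeff (p x) (?t i) = x i" for x i
    by (simp add: p_def coeff_sum inj)
  then have "p x \<noteq> 0" if "x \<in> U" for x using assms(2) that by (metis coeff_0 ext)
  then have "finite (\<Union>x\<in>U. {z. poly (p x) z = 0})" using assms(1) poly_roots_finite by blast
  then obtain z where z: "z \<notin> (\<Union>x\<in>U. {z. poly (p x) z = 0})"
    using ex_new_if_finite[OF infinite_UNIV_char_0] by blast
  have "(\<Sum>i\<in>UNIV. z ^ ?t i * x i) = poly (p x) z" for x
    by (simp add: p_def poly_sum poly_monom mult.commute)
  then show ?thesis using z by (intro exI[of _ "\<lambda>i. z ^ ?t i"]) auto
qed

text \<open>Sort by decreasing cardinality: of two comparable finite sets, the one with no more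
  elements is contained in the other.\<close>

lemma ex_nested_enumeration:
  assumes "finite A" "\<And>x. x \<in> A \<Longrightarrow> finite (F x)" "\<And>x y. x \<in> A \<Longrightarrow> y \<in> A \<Longrightarrow> F x \<subseteq> F y \<or> F y \<subseteq> F x"
  shows "\<exists>xs. set xs = A \<and> distinct xs \<and> (\<forall>i j. i \<le> j \<longrightarrow> j < length xs \<longrightarrow> F (xs ! j) \<subseteq> F (xs ! i))"
proof -
  obtain ys where ys: "set ys = A" "distinct ys" using finite_distinct_list[OF assms(1)] by blast
  define xs where "xs = rev (sort_key (\<lambda>x. card (F x)) ys)"
  have xs: "set xs = A" "distinct xs" using ys by (simp_all add: xs_def)
  have "sorted (rev (map (\<lambda>x. card (F x)) xs))" by (simp add: xs_def rev_map)
  then have card: "card (F (xs ! j)) \<le> card (F (xs ! i))" if "i \<le> j" "j < length xs" for i j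
    using that sorted_rev_nth_mono[of "map (\<lambda>x. card (F x)) xs" i j] by simp
  have "F (xs ! j) \<subseteq> F (xs ! i)" if "i \<le> j" "j < length xs" for i j
  proof -
    have mem: "xs ! i \<in> A" "xs ! j \<in> A" using that xs(1) nth_mem[of i xs] nth_mem[of j xs] by auto
    show ?thesis using assms(3)[OF mem] card_seteq[OF assms(2)[OF mem(2)] _ card[OF that]] by blast
  qed
  then show ?thesis using xs by blast
qed

lemma ex_normalized_representatives:
  fixes A :: "('i::finite \<Rightarrow> 'k::field_char_0) set set"
  assumes A: "A \<subseteq> proj_space" "finite A"
  shows "\<exists>c \<rho>. \<forall>P\<in>A. \<rho> P \<in> P \<and> \<rho> P \<noteq> (\<lambda>_. 0) \<and> (\<Sum>i\<in>UNIV. c i * \<rho> P i) = 1"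
proof -
  have "\<exists>x. P \<in> A \<longrightarrow> x \<noteq> (\<lambda>_. 0) \<and> (\<forall>d. d \<noteq> 0 \<longrightarrow> (\<lambda>i. d * x i) \<in> P)" for P
  proof (cases "P \<in> A")
    case True
    then obtain x where x: "x \<noteq> (\<lambda>_. 0)" "P = proj_rel `` {x}"
      using A(1) unfolding proj_space_def by (auto elim: quotientE)
    have "(\<lambda>i. d * x i) \<in> P" if d: "d \<noteq> 0" for d
    proof -
      have "(\<lambda>i. d * x i) \<noteq> (\<lambda>_. 0)" using x(1) d by (auto simp: fun_eq_iff)
      then show ?thesis unfolding x(2) proj_rel_def using x(1) d by auto
    qed
    then show ?thesis using x(1) by blast
  qed blast
  then obtain x where x: "\<And>P. P \<in> A \<Longrightarrow> x P \<noteq> (\<lambda>_. 0)" "\<And>P d. P \<in> A \<Longrightarrow> d \<noteq> 0 \<Longrightarrow> (\<lambda>i. d * x P i) \<in> P"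
    by metis
  have "(\<lambda>_. 0) \<notin> x ` A" using x(1) by (metis imageE)
  then obtain c where "\<forall>y\<in>x ` A. (\<Sum>i\<in>UNIV. c i * y i) \<noteq> 0"
    using ex_nonvanishing_form[OF finite_imageI[OF A(2)]] by blast
  then have c: "(\<Sum>i\<in>UNIV. c i * x P i) \<noteq> 0" if "P \<in> A" for P using that by simp
  define d where "d P = inverse (\<Sum>i\<in>UNIV. c i * x P i)" for P
  have d: "d P \<noteq> 0" if "P \<in> A" for P using c[OF that] by (simp add: d_def)
  have "(\<Sum>i\<in>UNIV. c i * (d P * x P i)) = 1" if "P \<in> A" for P
  proof -
    have "(\<Sum>i\<in>UNIV. c i * (d P * x P i)) = d P * (\<Sum>i\<in>UNIV. c i * x P i)"
      by (simp add: sum_distrib_left mult.left_commute)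
    then show ?thesis using c[OF that] by (simp add: d_def)
  qed
  moreover have "(\<lambda>i. d P * x P i) \<noteq> (\<lambda>_. 0)" if "P \<in> A" for P
    using x(1)[OF that] d[OF that] by (auto simp: fun_eq_iff)
  ultimately show ?thesis using x(2) d by (intro exI[of _ c] exI[of _ "\<lambda>P i. d P * x P i"]) auto
qed

lemma representatives_not_proportional:
  assumes "P \<in> proj_space" "Q \<in> proj_space" "x \<in> P" "y \<in> Q" "P \<noteq> Q" "c \<noteq> 0"
  shows "y \<noteq> (\<lambda>i. c * x i)"
proof
  assume y: "y = (\<lambda>i. c * x i)"
  obtain p where p: "P = proj_rel `` {p}" using assms(1) unfolding proj_space_def by (auto elim: quotientE)
  obtain q where q: "Q = proj_rel `` {q}" using assms(2) unfolding proj_space_def by (auto elim: quotientE)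
  obtain d where d: "p \<noteq> (\<lambda>_. 0)" "d \<noteq> 0" "x = (\<lambda>i. d * p i)" using assms(3) unfolding p by (auto simp: proj_rel_def)
  obtain e where e: "q \<noteq> (\<lambda>_. 0)" "e \<noteq> 0" "y = (\<lambda>i. e * q i)" using assms(4) unfolding q by (auto simp: proj_rel_def)
  have "q = (\<lambda>i. (c * d / e) * p i)"
  proof
    fix i
    have "e * q i = c * (d * p i)" using fun_cong[OF y, of i] unfolding d(3) e(3) .
    then show "q i = (c * d / e) * p i" using e(2) by (simp add: field_simps)
  qed
  then have q': "q = (\<lambda>i. a * p i)" "a \<noteq> 0" if "a = c * d / e" for a using that assms(6) d e by auto
  obtain a where a: "q = (\<lambda>i. a * p i)" "a \<noteq> 0" using q' by blast
  have "(p, z) \<in> proj_rel \<longleftrightarrow> (q, z) \<in> proj_rel" for z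
  proof
    assume "(p, z) \<in> proj_rel"
    then obtain b where b: "b \<noteq> 0" "z = (\<lambda>i. b * p i)" "z \<noteq> (\<lambda>_. 0)" by (auto simp: proj_rel_def)
    then have "z = (\<lambda>i. (b / a) * q i)" using a by simp
    then show "(q, z) \<in> proj_rel" unfolding proj_rel_def using b a e(1)
      by (intro CollectI case_prodI conjI exI[of _ "b / a"]) auto
  next
    assume "(q, z) \<in> proj_rel"
    then obtain b where b: "b \<noteq> 0" "z = (\<lambda>i. b * q i)" "z \<noteq> (\<lambda>_. 0)" by (auto simp: proj_rel_def)
    then have "z = (\<lambda>i. (b * a) * p i)" using a by (simp add: mult.assoc)
    then show "(p, z) \<in> proj_rel" unfolding proj_rel_def using b a d(1)
      by (intro CollectI case_prodI conjI exI[of _ "b * a"]) auto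
  qed
  then show False using assms(5) unfolding p q by auto
qed

theorem theorem3p7:
  fixes Z :: "(('m::finite \<Rightarrow> 'k::field_char_0) set \<times> ('n::finite \<Rightarrow> 'k) set) set"
  assumes "Z \<subseteq> proj_space \<times> proj_space"
    and "finite Z"
    and "star_property Z"
  shows "arithmetically_cohen_macaulay Z"
proof -
  let ?A = "fst ` Z" and ?B = "snd ` Z"
  have A: "?A \<subseteq> proj_space" "finite ?A" and B: "?B \<subseteq> proj_space" "finite ?B" using assms(1,2) by auto
  obtain a \<rho> where "\<forall>P\<in>?A. \<rho> P \<in> P \<and> \<rho> P \<noteq> (\<lambda>_. 0) \<and> (\<Sum>i\<in>UNIV. a i * \<rho> P i) = 1"
    using ex_normalized_representatives[OF A] by (elim exE)
  then have \<rho>: "\<And>P. P \<in> ?A \<Longrightarrow> \<rho> P \<in> P" "\<And>P. P \<in> ?A \<Longrightarrow> \<rho> P \<noteq> (\<lambda>_. 0)"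
      "\<And>P. P \<in> ?A \<Longrightarrow> (\<Sum>i\<in>UNIV. a i * \<rho> P i) = 1"
    by blast+
  obtain b \<sigma> where "\<forall>Q\<in>?B. \<sigma> Q \<in> Q \<and> \<sigma> Q \<noteq> (\<lambda>_. 0) \<and> (\<Sum>i\<in>UNIV. b i * \<sigma> Q i) = 1"
    using ex_normalized_representatives[OF B] by (elim exE)
  then have \<sigma>: "\<And>Q. Q \<in> ?B \<Longrightarrow> \<sigma> Q \<in> Q" "\<And>Q. Q \<in> ?B \<Longrightarrow> \<sigma> Q \<noteq> (\<lambda>_. 0)"
      "\<And>Q. Q \<in> ?B \<Longrightarrow> (\<Sum>i\<in>UNIV. b i * \<sigma> Q i) = 1"
    by blast+
  have star: "(P1, Q2) \<in> Z \<or> (P2, Q1) \<in> Z" if "(P1, Q1) \<in> Z" "(P2, Q2) \<in> Z" for P1 Q1 P2 Q2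
    using assms(3) that unfolding star_property_def by blast
  have "\<exists>ps. set ps = ?A \<and> distinct ps \<and>
      (\<forall>i j. i \<le> j \<longrightarrow> j < length ps \<longrightarrow> Z `` {ps ! j} \<subseteq> Z `` {ps ! i})"
  proof (rule ex_nested_enumeration[OF A(2)])
    show "finite (Z `` {P})" for P using assms(2) by (rule finite_Image)
    \<comment> \<open>If neither inclusion held, a point only in the first fibre and one only in the
      second would contradict the star property.\<close>
    show "Z `` {P} \<subseteq> Z `` {Q} \<or> Z `` {Q} \<subseteq> Z `` {P}" for P Q using star by blast
  qed
  then obtain ps where ps: "set ps = ?A" "distinct ps"
      "\<And>i j. i \<le> j \<Longrightarrow> j < length ps \<Longrightarrow> Z `` {ps ! j} \<subseteq> Z `` {ps ! i}" by blast
  have "\<exists>qs. set qs = ?B \<and> distinct qs \<and>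
      (\<forall>i j. i \<le> j \<longrightarrow> j < length qs \<longrightarrow> Z\<inverse> `` {qs ! j} \<subseteq> Z\<inverse> `` {qs ! i})"
  proof (rule ex_nested_enumeration[OF B(2)])
    show "finite (Z\<inverse> `` {P})" for P using assms(2) by (intro finite_Image) simp
    show "Z\<inverse> `` {P} \<subseteq> Z\<inverse> `` {Q} \<or> Z\<inverse> `` {Q} \<subseteq> Z\<inverse> `` {P}" for P Q using star by blast
  qed
  then obtain qs where qs: "set qs = ?B" "distinct qs"
      "\<And>i j. i \<le> j \<Longrightarrow> j < length qs \<Longrightarrow> Z\<inverse> `` {qs ! j} \<subseteq> Z\<inverse> `` {qs ! i}" by blast
  define u where "u i = \<rho> (ps ! i)" for i
  define v where "v j = \<sigma> (qs ! j)" for j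
  define T where "T = {(i, j). i < length ps \<and> j < length qs \<and> (ps ! i, qs ! j) \<in> Z}"
  obtain l :: "('m, 'n, 'k) bipoly" where l: "\<And>u v. \<psi> u v l = monom (monom (\<Sum>i\<in>UNIV. a i * u i) 1) 0"
    using ex_linear_form1 by blast
  obtain m :: "('m, 'n, 'k) bipoly" where m: "\<And>u v. \<psi> u v m = monom (monom (\<Sum>i\<in>UNIV. b i * v i) 0) 1"
    using ex_linear_form2 by blast
  have ps_mem: "ps ! i \<in> ?A" if "i < length ps" for i using ps(1) that nth_mem by metis
  have qs_mem: "qs ! j \<in> ?B" if "j < length qs" for j using qs(1) that nth_mem by metis
  interpret ferrers_points u v "length ps" "length qs" T l m
  proof
    show "T \<subseteq> {..<length ps} \<times> {..<length qs}" by (auto simp: T_def)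
    show "(i', j') \<in> T" if "(i, j) \<in> T" "i' \<le> i" "j' \<le> j" for i j i' j'
    proof -
      have ij: "i < length ps" "j < length qs" "(ps ! i, qs ! j) \<in> Z" using that(1) by (auto simp: T_def)
      \<comment> \<open>The first index is lowered by nestedness of the fibres over the first
        factor, then the second index by that over the second.\<close>
      have "(ps ! i', qs ! j) \<in> Z" using ps(3)[OF that(2) ij(1)] ij(3) by blast
      then have "(ps ! i', qs ! j') \<in> Z" using qs(3)[OF that(3) ij(2)] by blast
      then show ?thesis using that ij by (simp add: T_def)
    qed
    show "\<psi> (u i) (v j) l = monom (monom 1 1) 0" if "i < length ps" for i j
      unfolding l u_def \<rho>(3)[OF ps_mem[OF that]] ..
    show "\<psi> (u i) (v j) m = monom (monom 1 0) 1" if "j < length qs" for i j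
      unfolding m v_def \<sigma>(3)[OF qs_mem[OF that]] ..
    show "\<exists>c. (\<Sum>k\<in>UNIV. c k * u i k) = 0 \<and> (\<Sum>k\<in>UNIV. c k * u j k) \<noteq> 0"
      if "i < length ps" "j < length ps" "i \<noteq> j" for i j
    proof (rule ex_separating_form)
      have ne: "ps ! i \<noteq> ps ! j" using that ps(2) nth_eq_iff_index_eq by blast
      show "u j \<noteq> (\<lambda>k. c * u i k)" if "c \<noteq> 0" for c
        unfolding u_def
        by (rule representatives_not_proportional[OF _ _ \<rho>(1) \<rho>(1) ne that])
           (use A(1) ps_mem \<open>i < length ps\<close> \<open>j < length ps\<close> in blast)+
    qed (use \<rho>(2) ps_mem that in \<open>auto simp: u_def\<close>)
    show "\<exists>c. (\<Sum>k\<in>UNIV. c k * v i k) = 0 \<and> (\<Sum>k\<in>UNIV. c k * v j k) \<noteq> 0"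
      if "i < length qs" "j < length qs" "i \<noteq> j" for i j
    proof (rule ex_separating_form)
      have ne: "qs ! i \<noteq> qs ! j" using that qs(2) nth_eq_iff_index_eq by blast
      show "v j \<noteq> (\<lambda>k. c * v i k)" if "c \<noteq> 0" for c
        unfolding v_def
        by (rule representatives_not_proportional[OF _ _ \<sigma>(1) \<sigma>(1) ne that])
           (use B(1) qs_mem \<open>i < length qs\<close> \<open>j < length qs\<close> in blast)+
    qed (use \<sigma>(2) qs_mem that in \<open>auto simp: v_def\<close>)
  qed
  have Z_T: "Z = (\<lambda>(i, j). (ps ! i, qs ! j)) ` T"
  proof
    show "Z \<subseteq> (\<lambda>(i, j). (ps ! i, qs ! j)) ` T"
    proof clarify
      fix P Q assume PQ: "(P, Q) \<in> Z"
      then have "P \<in> set ps" "Q \<in> set qs" unfolding ps(1) qs(1) by force+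
      then obtain i j where "i < length ps" "ps ! i = P" "j < length qs" "qs ! j = Q"
        by (meson in_set_conv_nth)
      then show "(P, Q) \<in> (\<lambda>(i, j). (ps ! i, qs ! j)) ` T"
        using PQ by (intro image_eqI[of _ _ "(i, j)"]) (auto simp: T_def)
    qed
  qed (auto simp: T_def)
  have "vanishing_ideal Z = I"
  proof (rule Set.set_eqI)
    fix f
    have "f \<in> vanishing_ideal Z \<longleftrightarrow> (\<forall>p\<in>Z. \<psi> (\<rho> (fst p)) (\<sigma> (snd p)) f = 0)"
      by (rule vanishing_ideal_iff[OF assms(1)]) (simp add: \<rho>(1) \<sigma>(1))
    also have "\<dots> \<longleftrightarrow> f \<in> I"
      by (subst Z_T) (simp add: I_def u_def v_def case_prod_unfold)
    finally show "f \<in> vanishing_ideal Z \<longleftrightarrow> f \<in> I" .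
  qed
  then show ?thesis
    unfolding arithmetically_cohen_macaulay_def bipoly_ring_def using cohen_macaulay by simp
qed

end
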